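(* Let $(M,g,\Phi)$ be an eight-dimensional Riemannian manifold with a $Spin(7)$-structure given by a self-dual four-form $\Phi$. Then $\Phi$ is a generalized calibration of degree four on $M$. The contact set at every point of $M$ is $Spin(7)/K$, where $K=SU(2)\times SU(2)\times SU(2)/\mathbb Z_2$ (a single orbit of the group $Spin(7)\subset SO(T_pM)$ preserving $\Phi_p$, with stabilizer $K$).
   Context: A $Spin(7)$-structure here means that near each point there is an orthonormal coframe $\{e^1,\dots,e^8\}$ of $g$ with $\Phi=e^{1234}+(e^{12}-e^{34})\wedge(e^{56}-e^{78})+(e^{13}+e^{24})\wedge(e^{57}+e^{68})+(e^{14}-e^{23})\wedge(e^{58}-e^{67})+e^{5678}$, where $e^{ij}=e^i\wedge e^j$ etc.; equivalently $(M,g)$ carries a metric connection, possibly with torsion, with holonomy contained in $Spin(7)$ and $\Phi$ parallel. $\Phi$ is not assumed closed. A generalized calibration of degree $m$ is an $m$-form $\phi$ (not necessarily closed) such that $\phi(\xi)|_p\le1$ for every $p\in M$ and every oriented $m$-plane $\xi\subset T_pM$, where $\phi(\xi)$ is $\phi$ evaluated on an oriented orthonormal basis of $\xi$. The contact set at $p$ is the set of oriented $m$-planes $\xi\subset T_pM$ with $\phi(\xi)=1$. *)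

theory Defs
  imports
    "HOL-Analysis.Analysis"
    "HOL-Algebra.Group_Action"
    "HOL-Combinatorics.Permutations"
    "HOL-Library.Function_Algebras"
begin

text \<open>Functions into a real vector space form a real vector space. Tangent vectors are
  encoded below as functions on charts, so that \<^const>\<open>span\<close> and \<^const>\<open>independent\<close>
  apply to them.\<close>

instantiation "fun" :: (type, real_vector) real_vector
begin

definition scaleR_fun :: "real \<Rightarrow> ('a \<Rightarrow> 'b) \<Rightarrow> 'a \<Rightarrow> 'b" where
  "scaleR_fun r f = (\<lambda>x. r *\<^sub>R f x)"

instance
  by standard (auto simp: scaleR_fun_def fun_eq_iff scaleR_right_distrib scaleR_left_distrib)

end


section \<open>Smooth manifolds and tangent spaces\<close>

text \<open>Meaningful for open \<^term>\<open>S\<close> in a finite-dimensional domain.\<close>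

primrec Ck_on :: "nat \<Rightarrow> 'a::real_normed_vector set \<Rightarrow> ('a \<Rightarrow> 'b::real_normed_vector) \<Rightarrow> bool" where
  "Ck_on 0 S f \<longleftrightarrow> continuous_on S f"
| "Ck_on (Suc k) S f \<longleftrightarrow>
     (\<forall>x\<in>S. f differentiable (at x)) \<and> (\<forall>v. Ck_on k S (\<lambda>x. frechet_derivative f (at x) v))"

definition smooth_on :: "'a::real_normed_vector set \<Rightarrow> ('a \<Rightarrow> 'b::real_normed_vector) \<Rightarrow> bool" where
  "smooth_on S f \<longleftrightarrow> (\<forall>k. Ck_on k S f)"

text \<open>A chart is a pair of its domain and its coordinate map; the values of the coordinate
  map outside the domain are irrelevant.\<close>

type_synonym ('m, 'n) chart = "'m set \<times> ('m \<Rightarrow> real^'n)"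

definition chart_on :: "'m topology \<Rightarrow> ('m, 'n::finite) chart \<Rightarrow> bool" where
  "chart_on X c \<longleftrightarrow> openin X (fst c) \<and> open (snd c ` fst c) \<and>
     homeomorphic_map (subtopology X (fst c)) (top_of_set (snd c ` fst c)) (snd c)"

definition chart_inv :: "('m, 'n) chart \<Rightarrow> real^'n \<Rightarrow> 'm" where
  "chart_inv c = the_inv_into (fst c) (snd c)"

definition transition :: "('m, 'n) chart \<Rightarrow> ('m, 'n) chart \<Rightarrow> real^'n \<Rightarrow> real^'n" where
  "transition c d = snd d \<circ> chart_inv c"

definition smooth_manifold :: "'m topology \<Rightarrow> ('m, 'n::finite) chart set \<Rightarrow> bool" where
  "smooth_manifold X A \<longleftrightarrow> Hausdorff_space X \<and> second_countable X \<and>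
     (\<forall>c\<in>A. chart_on X c) \<and> (\<Union>c\<in>A. fst c) = topspace X \<and>
     (\<forall>c\<in>A. \<forall>d\<in>A. smooth_on (snd c ` (fst c \<inter> fst d)) (transition c d))"

text \<open>A tangent vector at \<^term>\<open>p\<close> assigns to every chart of the atlas around \<^term>\<open>p\<close> a
  coordinate vector, the coordinate vectors being related by the derivatives of the transition
  maps. The value 0 at all other charts makes this function unique.\<close>

type_synonym ('m, 'n) tangent = "('m, 'n) chart \<Rightarrow> real^'n"

definition tangent_space :: "('m, 'n::finite) chart set \<Rightarrow> 'm \<Rightarrow> ('m, 'n) tangent set" where
  "tangent_space A p = {v.
     (\<forall>c. \<not> (c \<in> A \<and> p \<in> fst c) \<longrightarrow> v c = 0) \<and>
     (\<forall>c\<in>A. \<forall>d\<in>A. p \<in> fst c \<longrightarrow> p \<in> fst d \<longrightarrow>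
        v d = frechet_derivative (transition c d) (at (snd c p)) (v c))}"

text \<open>The tangent vector at \<^term>\<open>p\<close> whose coordinates in the chart \<^term>\<open>c\<close> are \<^term>\<open>u\<close>.\<close>

definition tangent_of ::
    "('m, 'n::finite) chart set \<Rightarrow> ('m, 'n) chart \<Rightarrow> 'm \<Rightarrow> real^'n \<Rightarrow> ('m, 'n) tangent" where
  "tangent_of A c p u = (\<lambda>d. if d \<in> A \<and> p \<in> fst d
     then frechet_derivative (transition c d) (at (snd c p)) u else 0)"


section \<open>Multilinear algebra\<close>

definition linear_on_set :: "'v::real_vector set \<Rightarrow> ('v \<Rightarrow> 'w::real_vector) \<Rightarrow> bool" where
  "linear_on_set V f \<longleftrightarrow>
     (\<forall>v\<in>V. \<forall>w\<in>V. \<forall>a b. f (a *\<^sub>R v + b *\<^sub>R w) = a *\<^sub>R f v + b *\<^sub>R f w)"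

definition inner_product_on :: "'v::real_vector set \<Rightarrow> ('v \<Rightarrow> 'v \<Rightarrow> real) \<Rightarrow> bool" where
  "inner_product_on V g \<longleftrightarrow> (\<forall>v\<in>V. linear_on_set V (g v)) \<and>
     (\<forall>v\<in>V. \<forall>w\<in>V. g v w = g w v) \<and> (\<forall>v\<in>V. v \<noteq> 0 \<longrightarrow> g v v > 0)"

definition orthonormal :: "('v \<Rightarrow> 'v \<Rightarrow> real) \<Rightarrow> 'v list \<Rightarrow> bool" where
  "orthonormal g xs \<longleftrightarrow>
     (\<forall>i<length xs. \<forall>j<length xs. g (xs ! i) (xs ! j) = (if i = j then 1 else 0))"

definition orthonormal_basis ::
    "'v::real_vector set \<Rightarrow> ('v \<Rightarrow> 'v \<Rightarrow> real) \<Rightarrow> 'v list \<Rightarrow> bool" where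
  "orthonormal_basis V g E \<longleftrightarrow> set E \<subseteq> V \<and> orthonormal g E \<and> span (set E) = V"

text \<open>A \<^term>\<open>k\<close>-form on \<^term>\<open>V\<close> is a function on lists, of which only the values at lists of
  length \<^term>\<open>k\<close> over \<^term>\<open>V\<close> matter.\<close>

definition alternating_form :: "'v::real_vector set \<Rightarrow> nat \<Rightarrow> ('v list \<Rightarrow> real) \<Rightarrow> bool" where
  "alternating_form V k \<omega> \<longleftrightarrow>
     (\<forall>xs i. set xs \<subseteq> V \<longrightarrow> length xs = k \<longrightarrow> i < k \<longrightarrow> linear_on_set V (\<lambda>v. \<omega> (xs[i := v]))) \<and>
     (\<forall>xs. set xs \<subseteq> V \<longrightarrow> length xs = k \<longrightarrow> \<not> distinct xs \<longrightarrow> \<omega> xs = 0)"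

text \<open>The normalisation is that in which
  \<open>(e\<^sup>1 \<and> \<dots> \<and> e\<^sup>k) (x\<^sub>1, \<dots>, x\<^sub>k) = det (e\<^sup>i (x\<^sub>j))\<close> for 1-forms.\<close>

definition wedge ::
    "nat \<Rightarrow> nat \<Rightarrow> ('v list \<Rightarrow> real) \<Rightarrow> ('v list \<Rightarrow> real) \<Rightarrow> 'v list \<Rightarrow> real" where
  "wedge k l \<alpha> \<beta> xs =
     (\<Sum>\<sigma> | \<sigma> permutes {..<k + l}. of_int (sign \<sigma>) *
        \<alpha> (map (\<lambda>i. xs ! \<sigma> i) [0..<k]) * \<beta> (map (\<lambda>i. xs ! \<sigma> i) [k..<k + l])) / (fact k * fact l)"

text \<open>In index notation \<open>(\<star>\<alpha>)\<^bsub>J\<^esub> = (1/k!) \<alpha>\<^bsup>I\<^esup> vol\<^bsub>IJ\<^esub>\<close>, that is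
  \<open>\<beta> \<and> \<star>\<alpha> = \<langle>\<beta>, \<alpha>\<rangle> vol\<close>.\<close>

definition hodge_star ::
    "'v::real_vector set \<Rightarrow> ('v \<Rightarrow> 'v \<Rightarrow> real) \<Rightarrow> ('v list \<Rightarrow> real) \<Rightarrow>
     nat \<Rightarrow> ('v list \<Rightarrow> real) \<Rightarrow> 'v list \<Rightarrow> real" where
  "hodge_star V g vol k \<alpha> xs =
     (let E = (SOME E. orthonormal_basis V g E) in
      (\<Sum>I | set I \<subseteq> set E \<and> length I = k. \<alpha> I * vol (I @ xs)) / fact k)"


section \<open>Oriented planes\<close>

definition leibniz_det :: "nat \<Rightarrow> (nat \<Rightarrow> nat \<Rightarrow> real) \<Rightarrow> real" where
  "leibniz_det m a = (\<Sum>\<sigma> | \<sigma> permutes {..<m}. of_int (sign \<sigma>) * (\<Prod>i<m. a i (\<sigma> i)))"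

definition same_orientation :: "'v::real_vector list \<Rightarrow> 'v list \<Rightarrow> bool" where
  "same_orientation xs ys \<longleftrightarrow> length ys = length xs \<and>
     (\<exists>a. leibniz_det (length xs) a > 0 \<and>
        (\<forall>i<length xs. ys ! i = (\<Sum>j<length xs. a i j *\<^sub>R xs ! j)))"

definition frames :: "'v::real_vector set \<Rightarrow> nat \<Rightarrow> 'v list set" where
  "frames V m = {xs. set xs \<subseteq> V \<and> length xs = m \<and> distinct xs \<and> independent (set xs)}"

text \<open>An oriented \<^term>\<open>m\<close>-plane in \<^term>\<open>V\<close> is identified with the set of all its positively
  oriented bases.\<close>

definition oriented_planes :: "'v::real_vector set \<Rightarrow> nat \<Rightarrow> 'v list set set" where
  "oriented_planes V m =
     frames V m // {(xs, ys). xs \<in> frames V m \<and> ys \<in> frames V m \<and> same_orientation xs ys}"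

definition plane_value ::
    "('v \<Rightarrow> 'v \<Rightarrow> real) \<Rightarrow> ('v list \<Rightarrow> real) \<Rightarrow> 'v list set \<Rightarrow> real" where
  "plane_value g \<omega> \<xi> = \<omega> (SOME xs. xs \<in> \<xi> \<and> orthonormal g xs)"


section \<open>Riemannian manifolds and calibrations\<close>

definition riemannian_metric ::
    "'m topology \<Rightarrow> ('m, 'n::finite) chart set \<Rightarrow>
     ('m \<Rightarrow> ('m, 'n) tangent \<Rightarrow> ('m, 'n) tangent \<Rightarrow> real) \<Rightarrow> bool" where
  "riemannian_metric X A g \<longleftrightarrow>
     (\<forall>p\<in>topspace X. inner_product_on (tangent_space A p) (g p)) \<and>
     (\<forall>c\<in>A. \<forall>u w. smooth_on (snd c ` fst c)
        (\<lambda>x. let p = chart_inv c x in g p (tangent_of A c p u) (tangent_of A c p w)))"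

definition differential_form ::
    "('m, 'n::finite) chart set \<Rightarrow> 'm set \<Rightarrow> nat \<Rightarrow> ('m \<Rightarrow> ('m, 'n) tangent list \<Rightarrow> real) \<Rightarrow> bool" where
  "differential_form A U k \<omega> \<longleftrightarrow>
     (\<forall>p\<in>U. alternating_form (tangent_space A p) k (\<omega> p)) \<and>
     (\<forall>c\<in>A. \<forall>us. length us = k \<longrightarrow> smooth_on (snd c ` (fst c \<inter> U))
        (\<lambda>x. let p = chart_inv c x in \<omega> p (map (tangent_of A c p) us)))"

text \<open>An orientation of a Riemannian manifold is given by its Riemannian volume form.\<close>

definition riemannian_volume_form ::
    "'m topology \<Rightarrow> ('m, 'n::finite) chart set \<Rightarrow>
     ('m \<Rightarrow> ('m, 'n) tangent \<Rightarrow> ('m, 'n) tangent \<Rightarrow> real) \<Rightarrow>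
     ('m \<Rightarrow> ('m, 'n) tangent list \<Rightarrow> real) \<Rightarrow> bool" where
  "riemannian_volume_form X A g vol \<longleftrightarrow>
     differential_form A (topspace X) CARD('n) vol \<and>
     (\<forall>p\<in>topspace X. \<forall>E. orthonormal_basis (tangent_space A p) (g p) E \<longrightarrow> \<bar>vol p E\<bar> = 1)"

definition self_dual ::
    "'m topology \<Rightarrow> ('m, 8) chart set \<Rightarrow>
     ('m \<Rightarrow> ('m, 8) tangent \<Rightarrow> ('m, 8) tangent \<Rightarrow> real) \<Rightarrow>
     ('m \<Rightarrow> ('m, 8) tangent list \<Rightarrow> real) \<Rightarrow> ('m \<Rightarrow> ('m, 8) tangent list \<Rightarrow> real) \<Rightarrow> bool" where
  "self_dual X A g vol \<Phi> \<longleftrightarrow>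
     (\<forall>p\<in>topspace X. \<forall>xs. set xs \<subseteq> tangent_space A p \<longrightarrow> length xs = 4 \<longrightarrow>
        hodge_star (tangent_space A p) (g p) (vol p) 4 (\<Phi> p) xs = \<Phi> p xs)"

definition generalized_calibration ::
    "'m topology \<Rightarrow> ('m, 'n::finite) chart set \<Rightarrow>
     ('m \<Rightarrow> ('m, 'n) tangent \<Rightarrow> ('m, 'n) tangent \<Rightarrow> real) \<Rightarrow>
     nat \<Rightarrow> ('m \<Rightarrow> ('m, 'n) tangent list \<Rightarrow> real) \<Rightarrow> bool" where
  "generalized_calibration X A g m \<phi> \<longleftrightarrow>
     differential_form A (topspace X) m \<phi> \<and>
     (\<forall>p\<in>topspace X. \<forall>\<xi>\<in>oriented_planes (tangent_space A p) m. plane_value (g p) (\<phi> p) \<xi> \<le> 1)"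

definition contact_set ::
    "('m, 'n::finite) chart set \<Rightarrow>
     ('m \<Rightarrow> ('m, 'n) tangent \<Rightarrow> ('m, 'n) tangent \<Rightarrow> real) \<Rightarrow>
     nat \<Rightarrow> ('m \<Rightarrow> ('m, 'n) tangent list \<Rightarrow> real) \<Rightarrow> 'm \<Rightarrow> ('m, 'n) tangent list set set" where
  "contact_set A g m \<phi> p =
     {\<xi> \<in> oriented_planes (tangent_space A p) m. plane_value (g p) (\<phi> p) \<xi> = 1}"


section \<open>Spin(7)-structures\<close>

text \<open>The functions \<^term>\<open>e 1\<close> to \<^term>\<open>e 8\<close> are 1-forms; sums and differences of forms are
  pointwise, and \<open>e\<^sup>i\<^sup>j\<^sup>k\<^sup>l\<close> is formed as \<open>e\<^sup>i\<^sup>j \<and> e\<^sup>k\<^sup>l\<close>.\<close>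

definition cayley_form :: "(nat \<Rightarrow> 'v list \<Rightarrow> real) \<Rightarrow> 'v list \<Rightarrow> real" where
  "cayley_form e =
     (let d = (\<lambda>i j. wedge 1 1 (e i) (e j)) in
        wedge 2 2 (d 1 2) (d 3 4)
      + wedge 2 2 (d 1 2 - d 3 4) (d 5 6 - d 7 8)
      + wedge 2 2 (d 1 3 + d 2 4) (d 5 7 + d 6 8)
      + wedge 2 2 (d 1 4 - d 2 3) (d 5 8 - d 6 7)
      + wedge 2 2 (d 5 6) (d 7 8))"

text \<open>An orthonormal coframe is the dual basis of an orthonormal basis.\<close>

definition orthonormal_coframe ::
    "'v::real_vector set \<Rightarrow> ('v \<Rightarrow> 'v \<Rightarrow> real) \<Rightarrow> nat \<Rightarrow> (nat \<Rightarrow> 'v list \<Rightarrow> real) \<Rightarrow> bool" where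
  "orthonormal_coframe V g n e \<longleftrightarrow>
     (\<forall>i\<in>{1..n}. alternating_form V 1 (e i)) \<and>
     (\<exists>E. orthonormal_basis V g E \<and> length E = n \<and>
        (\<forall>i\<in>{1..n}. \<forall>j\<in>{1..n}. e i [E ! (j - 1)] = (if i = j then 1 else 0)))"

definition spin7_structure ::
    "'m topology \<Rightarrow> ('m, 8) chart set \<Rightarrow>
     ('m \<Rightarrow> ('m, 8) tangent \<Rightarrow> ('m, 8) tangent \<Rightarrow> real) \<Rightarrow>
     ('m \<Rightarrow> ('m, 8) tangent list \<Rightarrow> real) \<Rightarrow> bool" where
  "spin7_structure X A g \<Phi> \<longleftrightarrow>
     differential_form A (topspace X) 4 \<Phi> \<and>
     (\<forall>p\<in>topspace X. \<exists>U e. openin X U \<and> p \<in> U \<and>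
        (\<forall>i\<in>{1..8}. differential_form A U 1 (e i)) \<and>
        (\<forall>q\<in>U. orthonormal_coframe (tangent_space A q) (g q) 8 (\<lambda>i. e i q) \<and>
           (\<forall>xs. set xs \<subseteq> tangent_space A q \<longrightarrow> length xs = 4 \<longrightarrow>
              \<Phi> q xs = cayley_form (\<lambda>i. e i q) xs)))"

definition special_orthogonal ::
    "'v::real_vector set \<Rightarrow> ('v \<Rightarrow> 'v \<Rightarrow> real) \<Rightarrow> ('v \<Rightarrow> 'v) set" where
  "special_orthogonal V g = {L \<in> Bij V. linear_on_set V L \<and>
     (\<forall>v\<in>V. \<forall>w\<in>V. g (L v) (L w) = g v w) \<and>
     (\<forall>E. orthonormal_basis V g E \<longrightarrow> same_orientation E (map L E))}"

text \<open>The subgroup Spin(7) of SO(V) preserving the 4-form \<^term>\<open>\<phi>\<close>.\<close>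

definition spin7_group ::
    "'v::real_vector set \<Rightarrow> ('v \<Rightarrow> 'v \<Rightarrow> real) \<Rightarrow> ('v list \<Rightarrow> real) \<Rightarrow> ('v \<Rightarrow> 'v) monoid" where
  "spin7_group V g \<phi> = (BijGroup V)\<lparr>carrier := {L \<in> special_orthogonal V g.
     \<forall>xs. set xs \<subseteq> V \<longrightarrow> length xs = 4 \<longrightarrow> \<phi> (map L xs) = \<phi> xs}\<rparr>"

definition plane_action ::
    "'v list set set \<Rightarrow> ('v \<Rightarrow> 'v) \<Rightarrow> 'v list set \<Rightarrow> 'v list set" where
  "plane_action C L = (\<lambda>\<xi>\<in>C. map L ` \<xi>)"

definition SU2 :: "(complex^2^2) monoid" where
  "SU2 = \<lparr>carrier = {A. A ** (\<chi> i j. cnj (A $ j $ i)) = mat 1 \<and> det A = 1},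
          mult = (**), one = mat 1\<rparr>"

definition SU2_cubed :: "((complex^2^2) \<times> (complex^2^2) \<times> (complex^2^2)) monoid" where
  "SU2_cubed = SU2 \<times>\<times> SU2 \<times>\<times> SU2"

definition diagonal_Z2 :: "((complex^2^2) \<times> (complex^2^2) \<times> (complex^2^2)) set" where
  "diagonal_Z2 = {(mat 1, mat 1, mat 1), (- mat 1, - mat 1, - mat 1)}"

text \<open>Isomorphism of topological groups between the quotient of \<^term>\<open>G\<close> by \<^term>\<open>N\<close>, with the
  quotient topology, and \<^term>\<open>H\<close>. For bijective \<^term>\<open>h\<close>, being a homeomorphism from the
  quotient topology means that the composition of \<^term>\<open>h\<close> with the projection is a quotient map.
  On linear maps, functions on a set of functions, the product topology is that of pointwise
  convergence, which for a finite-dimensional space is the usual topology.\<close>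

definition topological_quotient_iso ::
    "('a::topological_space) monoid \<Rightarrow> 'a set \<Rightarrow> ('b::topological_space) monoid \<Rightarrow> bool" where
  "topological_quotient_iso G N H \<longleftrightarrow>
     (\<exists>h \<in> iso (G Mod N) H.
        quotient_map (top_of_set (carrier G)) (top_of_set (carrier H)) (\<lambda>x. h (N #>\<^bsub>G\<^esub> x)))"

end

(* In an adapted coframe a tangent space becomes pairs of quaternions, and the Cayley form becomes
   vol(a) + vol(b) + <Im(a* a') wedge Im(b* b')>. Its triple cross product satisfies a single
   polynomial identity (triple_inner_triple) from which everything metric follows: the length of
   x * y * z is the volume of x, y, z, whence the calibration inequality with equality exactly for
   w = x * y * z; and a unit vector turns the remaining seven dimensions into a cross product
   algebra whose multiplication table is forced, so that any frame of a contact plane extends to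
   an adapted frame. Hence Spin(7) is transitive on contact planes. An element fixing the plane
   b = 0 acts on a by p a q* because an automorphism of the quaternions is inner, and then on b
   by r b q*; the triples (p, q, r) acting trivially are (1,1,1) and (-1,-1,-1). Self-duality
   makes all adapted frames equally oriented. *)
theory Submission
  imports Defs
begin

section \<open>Quaternions\<close>

text \<open>The three factors of K are visible in the 2-forms \<open>e12 - e34\<close>,
  \<open>e13 + e24\<close>, \<open>e14 - e23\<close>: they are the components of Im(a* a'), which
  left multiplication of a by a unit leaves fixed and right multiplication rotates. Hence a and b
  admit independent left factors but must share the right one. One unit vector suffices to recover
  the form, because the polynomial identity can be solved for the form at four arbitrary vectors in
  terms of inner products and the cross product of that unit vector. A linear isometry that
  intertwines the cross products of two unit vectors therefore preserves everything. Orientation is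
  a separate obstacle: a map preserving metric and form must be shown to lie in the special
  orthogonal group of an abstract tangent space. Evaluating the self-duality equation on the last
  four vectors of an adapted frame gives that frame volume 1, so maps between adapted frames have
  determinant 1. The isomorphism of the stabilizer with K is topological by compactness: a
  continuous map from a compact group onto a Hausdorff one is closed.\<close>

datatype quat = Quat (q0: real) (q1: real) (q2: real) (q3: real)

lemma quat_eq_iff: "x = y \<longleftrightarrow> q0 x = q0 y \<and> q1 x = q1 y \<and> q2 x = q2 y \<and> q3 x = q3 y"
  by (auto intro: quat.expand)

instantiation quat :: ring_1
begin

definition "0 = Quat 0 0 0 0"
definition "1 = Quat 1 0 0 0"
definition "x + y = Quat (q0 x + q0 y) (q1 x + q1 y) (q2 x + q2 y) (q3 x + q3 y)"
definition "- x = Quat (- q0 x) (- q1 x) (- q2 x) (- q3 x)"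
definition "x - y = Quat (q0 x - q0 y) (q1 x - q1 y) (q2 x - q2 y) (q3 x - q3 y)"
definition "x * y = Quat
  (q0 x * q0 y - q1 x * q1 y - q2 x * q2 y - q3 x * q3 y)
  (q0 x * q1 y + q1 x * q0 y + q2 x * q3 y - q3 x * q2 y)
  (q0 x * q2 y - q1 x * q3 y + q2 x * q0 y + q3 x * q1 y)
  (q0 x * q3 y + q1 x * q2 y - q2 x * q1 y + q3 x * q0 y)"

instance
  by standard (auto simp: quat_eq_iff zero_quat_def one_quat_def plus_quat_def uminus_quat_def
      minus_quat_def times_quat_def algebra_simps)

end

instantiation quat :: real_inner
begin

definition "r *\<^sub>R x = Quat (r * q0 x) (r * q1 x) (r * q2 x) (r * q3 x)"
definition "inner x y = q0 x * q0 y + q1 x * q1 y + q2 x * q2 y + q3 x * q3 y"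
definition "norm (x::quat) = sqrt (inner x x)"
definition "sgn (x::quat) = inverse (norm x) *\<^sub>R x"
definition "dist x (y::quat) = norm (x - y)"
definition "uniformity = (INF e\<in>{0<..}. principal {(x::quat, y). dist x y < e})"
definition "open (U::quat set) \<longleftrightarrow> (\<forall>x\<in>U. eventually (\<lambda>(x', y). x' = x \<longrightarrow> y \<in> U) uniformity)"

instance
proof
  fix x y z :: quat and r s :: real
  show "inner x x = 0 \<longleftrightarrow> x = 0"
  proof
    assume "inner x x = 0"
    then have "(q0 x)\<^sup>2 + (q1 x)\<^sup>2 + (q2 x)\<^sup>2 + (q3 x)\<^sup>2 = 0"
      by (simp add: inner_quat_def power2_eq_square)
    then have "(q0 x)\<^sup>2 = 0" "(q1 x)\<^sup>2 = 0" "(q2 x)\<^sup>2 = 0" "(q3 x)\<^sup>2 = 0"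
      by (smt (verit) zero_le_power2)+
    then show "x = 0"
      by (simp add: quat_eq_iff zero_quat_def)
  qed (simp add: inner_quat_def zero_quat_def)
qed (auto simp: quat_eq_iff scaleR_quat_def inner_quat_def norm_quat_def sgn_quat_def
    dist_quat_def uniformity_quat_def open_quat_def plus_quat_def algebra_simps)

end

lemma quat_sel [simp]:
  "q0 0 = 0" "q1 0 = 0" "q2 0 = 0" "q3 0 = 0"
  "q0 1 = 1" "q1 1 = 0" "q2 1 = 0" "q3 1 = 0"
  "q0 (x + y) = q0 x + q0 y" "q1 (x + y) = q1 x + q1 y"
  "q2 (x + y) = q2 x + q2 y" "q3 (x + y) = q3 x + q3 y"
  "q0 (- x) = - q0 x" "q1 (- x) = - q1 x" "q2 (- x) = - q2 x" "q3 (- x) = - q3 x"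
  "q0 (x - y) = q0 x - q0 y" "q1 (x - y) = q1 x - q1 y"
  "q2 (x - y) = q2 x - q2 y" "q3 (x - y) = q3 x - q3 y"
  "q0 (r *\<^sub>R x) = r * q0 x" "q1 (r *\<^sub>R x) = r * q1 x"
  "q2 (r *\<^sub>R x) = r * q2 x" "q3 (r *\<^sub>R x) = r * q3 x"
  by (simp_all add: zero_quat_def one_quat_def plus_quat_def uminus_quat_def minus_quat_def
      scaleR_quat_def)

lemma quat_sel_mult:
  "q0 (x * y) = q0 x * q0 y - q1 x * q1 y - q2 x * q2 y - q3 x * q3 y"
  "q1 (x * y) = q0 x * q1 y + q1 x * q0 y + q2 x * q3 y - q3 x * q2 y"
  "q2 (x * y) = q0 x * q2 y - q1 x * q3 y + q2 x * q0 y + q3 x * q1 y"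
  "q3 (x * y) = q0 x * q3 y + q1 x * q2 y - q2 x * q1 y + q3 x * q0 y"
  by (simp_all add: times_quat_def)

instance quat :: real_algebra_1
  by standard (auto simp: quat_eq_iff quat_sel_mult algebra_simps)

definition qcnj :: "quat \<Rightarrow> quat" where
  "qcnj x = Quat (q0 x) (- q1 x) (- q2 x) (- q3 x)"

lemma qcnj_sel [simp]: "q0 (qcnj x) = q0 x" "q1 (qcnj x) = - q1 x" "q2 (qcnj x) = - q2 x" "q3 (qcnj x) = - q3 x"
  by (simp_all add: qcnj_def)

lemma qcnj_mult: "qcnj (x * y) = qcnj y * qcnj x"
  by (simp add: quat_eq_iff quat_sel_mult algebra_simps)

lemma qcnj_simps [simp]:
  "qcnj (qcnj x) = x" "qcnj 0 = 0" "qcnj 1 = 1" "qcnj (- x) = - qcnj x"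
  "qcnj (x + y) = qcnj x + qcnj y" "qcnj (x - y) = qcnj x - qcnj y" "qcnj (r *\<^sub>R x) = r *\<^sub>R qcnj x"
  by (simp_all add: quat_eq_iff)

lemma mult_qcnj: "x * qcnj x = (x \<bullet> x) *\<^sub>R 1" "qcnj x * x = (x \<bullet> x) *\<^sub>R 1"
  by (simp_all add: quat_eq_iff quat_sel_mult inner_quat_def algebra_simps)

lemma inner_quat_eq: "x \<bullet> y = q0 (qcnj x * y)"
  by (simp add: inner_quat_def quat_sel_mult)

lemma inner_mult_left: "(p * x :: quat) \<bullet> (p * y) = (p \<bullet> p) * (x \<bullet> y)"
  by (simp add: inner_quat_def quat_sel_mult algebra_simps)

lemma inner_mult_right: "(x * p :: quat) \<bullet> (y * p) = (p \<bullet> p) * (x \<bullet> y)"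
  by (simp add: inner_quat_def quat_sel_mult algebra_simps)

lemma inner_qcnj [simp]: "qcnj x \<bullet> qcnj y = x \<bullet> y"
  by (simp add: inner_quat_def)

lemma quat_norm_mult: "norm (x * y :: quat) = norm x * norm y"
  by (simp add: norm_quat_def inner_mult_left flip: real_sqrt_mult)

lemma norm_one_quat: "norm (1::quat) = 1"
  by (simp add: norm_quat_def inner_quat_def)

instance quat :: real_normed_algebra_1
  by standard (auto simp: quat_norm_mult norm_one_quat)

definition qi :: quat where "qi = Quat 0 1 0 0"
definition qj :: quat where "qj = Quat 0 0 1 0"
definition qk :: quat where "qk = Quat 0 0 0 1"

lemma qijk_sel [simp]:
  "q0 qi = 0" "q1 qi = 1" "q2 qi = 0" "q3 qi = 0"
  "q0 qj = 0" "q1 qj = 0" "q2 qj = 1" "q3 qj = 0"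
  "q0 qk = 0" "q1 qk = 0" "q2 qk = 0" "q3 qk = 1"
  by (simp_all add: qi_def qj_def qk_def)

lemma quat_units_neq [simp]:
  "qi \<noteq> 0" "qj \<noteq> 0" "qk \<noteq> 0" 
  "1 \<noteq> qi" "1 \<noteq> qj" "1 \<noteq> qk" "qi \<noteq> 1" "qj \<noteq> 1" "qk \<noteq> 1"
  "qi \<noteq> qj" "qi \<noteq> qk" "qj \<noteq> qi" "qj \<noteq> qk" "qk \<noteq> qi" "qk \<noteq> qj"
  by (simp_all add: quat_eq_iff)

instantiation quat :: euclidean_space
begin

definition "Basis = {1, qi, qj, qk}"

instance
proof
  fix x :: quat
  show "(\<forall>u\<in>Basis. x \<bullet> u = 0) \<longleftrightarrow> x = 0"
    by (simp add: Basis_quat_def inner_quat_def) (simp add: quat_eq_iff)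
qed (auto simp: Basis_quat_def inner_quat_def)

end

lemma DIM_quat [simp]: "DIM(quat) = 4"
  by (simp add: Basis_quat_def)

lemma quat_expand: "x = q0 x *\<^sub>R 1 + q1 x *\<^sub>R qi + q2 x *\<^sub>R qj + q3 x *\<^sub>R qk"
  by (simp add: quat_eq_iff)

lemma qcnj_left_cancel: "p \<bullet> p = 1 \<Longrightarrow> qcnj p * (p * x) = x" "p \<bullet> p = 1 \<Longrightarrow> p * (qcnj p * x) = x"
  by (simp_all add: mult_qcnj flip: mult.assoc)

lemma qcnj_right_cancel: "p \<bullet> p = 1 \<Longrightarrow> x * qcnj p * p = x" "p \<bullet> p = 1 \<Longrightarrow> x * p * qcnj p = x"
  by (simp_all add: mult_qcnj mult.assoc)

section \<open>The model Cayley form\<close>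

type_synonym oct = "quat \<times> quat"

text \<open>\<open>qvol\<close> is the volume form and \<open>qform a b c d\<close> is \<open>\<langle>Im (a* b), Im (c* d)\<rangle>\<close>. For
  \<open>a = x\<^sub>1 + x\<^sub>2 i + x\<^sub>3 j + x\<^sub>4 k\<close> the components of \<open>Im (a* b)\<close> are \<open>e\<^sup>1\<^sup>2 - e\<^sup>3\<^sup>4\<close>,
  \<open>e\<^sup>1\<^sup>3 + e\<^sup>2\<^sup>4\<close> and \<open>e\<^sup>1\<^sup>4 - e\<^sup>2\<^sup>3\<close>.\<close>

definition qvol :: "quat \<Rightarrow> quat \<Rightarrow> quat \<Rightarrow> quat \<Rightarrow> real" where
  "qvol a b c d = ((c * qcnj b * a - a * qcnj b * c) \<bullet> d) / 2"

definition qform :: "quat \<Rightarrow> quat \<Rightarrow> quat \<Rightarrow> quat \<Rightarrow> real" where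
  "qform a b c d = (qcnj a * b) \<bullet> (qcnj c * d) - (a \<bullet> b) * (c \<bullet> d)"

text \<open>The right-hand side is the cofactor expansion of a 4 by 4 determinant, which identifies
  \<open>qvol\<close> with the volume form. The quaternionic expression is kept as the definition
  because it makes invariance under two-sided multiplication visible.\<close>

lemma qvol_coord: "qvol a b c d =
    q0 a * (q1 b * (q2 c * q3 d - q3 c * q2 d) - q2 b * (q1 c * q3 d - q3 c * q1 d)
      + q3 b * (q1 c * q2 d - q2 c * q1 d))
  - q1 a * (q0 b * (q2 c * q3 d - q3 c * q2 d) - q2 b * (q0 c * q3 d - q3 c * q0 d)
      + q3 b * (q0 c * q2 d - q2 c * q0 d))
  + q2 a * (q0 b * (q1 c * q3 d - q3 c * q1 d) - q1 b * (q0 c * q3 d - q3 c * q0 d)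
      + q3 b * (q0 c * q1 d - q1 c * q0 d))
  - q3 a * (q0 b * (q1 c * q2 d - q2 c * q1 d) - q1 b * (q0 c * q2 d - q2 c * q0 d)
      + q2 b * (q0 c * q1 d - q1 c * q0 d))"
  unfolding qvol_def inner_quat_def quat_sel_mult qcnj_sel quat_sel by algebra

lemma qform_coord: "qform a b c d =
    (q0 a * q1 b - q1 a * q0 b - q2 a * q3 b + q3 a * q2 b) *
    (q0 c * q1 d - q1 c * q0 d - q2 c * q3 d + q3 c * q2 d)
  + (q0 a * q2 b + q1 a * q3 b - q2 a * q0 b - q3 a * q1 b) *
    (q0 c * q2 d + q1 c * q3 d - q2 c * q0 d - q3 c * q1 d)
  + (q0 a * q3 b - q1 a * q2 b + q2 a * q1 b - q3 a * q0 b) *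
    (q0 c * q3 d - q1 c * q2 d + q2 c * q1 d - q3 c * q0 d)"
proof -
  have "(qcnj a * b) \<bullet> (qcnj c * d) = (a \<bullet> b) * (c \<bullet> d) + q1 (qcnj a * b) * q1 (qcnj c * d)
      + q2 (qcnj a * b) * q2 (qcnj c * d) + q3 (qcnj a * b) * q3 (qcnj c * d)"
    by (simp add: inner_quat_def[of "qcnj a * b"] inner_quat_eq[of a b] inner_quat_eq[of c d])
  then have "qform a b c d = q1 (qcnj a * b) * q1 (qcnj c * d)
      + q2 (qcnj a * b) * q2 (qcnj c * d) + q3 (qcnj a * b) * q3 (qcnj c * d)"
    by (simp add: qform_def)
  then show ?thesis
    by (simp add: quat_sel_mult)
qed

text \<open>The six mixed terms are the signed (2,2)-shuffles in the wedge product of the two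
  quaternion-valued 2-forms Im(a* a') and Im(b* b').\<close>

definition cayley :: "oct \<Rightarrow> oct \<Rightarrow> oct \<Rightarrow> oct \<Rightarrow> real" where
  "cayley x y z w =
     qvol (fst x) (fst y) (fst z) (fst w) + qvol (snd x) (snd y) (snd z) (snd w)
   + qform (fst x) (fst y) (snd z) (snd w) - qform (fst x) (fst z) (snd y) (snd w)
   + qform (fst x) (fst w) (snd y) (snd z) + qform (fst y) (fst z) (snd x) (snd w)
   - qform (fst y) (fst w) (snd x) (snd z) + qform (fst z) (fst w) (snd x) (snd y)"

lemma qvol_swap: "qvol b a c d = - qvol a b c d" "qvol a c b d = - qvol a b c d" "qvol a b d c = - qvol a b c d"
  unfolding qvol_coord by algebra+

lemma qform_swap: "qform b a c d = - qform a b c d" "qform a b d c = - qform a b c d"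
  unfolding qform_coord by algebra+

lemma linear_qvol: "linear (\<lambda>d. qvol a b c d)"
  by (rule linearI) (simp_all add: qvol_def inner_add_right add_divide_distrib)

lemma linear_qform: "linear (\<lambda>d. qform a b c d)" "linear (\<lambda>b. qform a b c d)"
  by (rule linearI; simp add: qform_def inner_add_left inner_add_right distrib_left distrib_right right_diff_distrib left_diff_distrib)+

lemma cayley_swap: "cayley y x z w = - cayley x y z w" "cayley x z y w = - cayley x y z w"
  "cayley x y w z = - cayley x y z w"
proof -
  show "cayley y x z w = - cayley x y z w"
    by (simp add: cayley_def qvol_swap(1)[of "fst y" "fst x"] qvol_swap(1)[of "snd y" "snd x"]
        qform_swap(1)[of "fst y" "fst x"] qform_swap(2)[of _ _ "snd y" "snd x"])
  show "cayley x z y w = - cayley x y z w"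
    by (simp add: cayley_def qvol_swap(2)[of _ "fst z" "fst y"] qvol_swap(2)[of _ "snd z" "snd y"]
        qform_swap(1)[of "fst z" "fst y"] qform_swap(2)[of _ _ "snd z" "snd y"])
  show "cayley x y w z = - cayley x y z w"
    by (simp add: cayley_def qvol_swap(3)[of _ _ "fst w" "fst z"] qvol_swap(3)[of _ _ "snd w" "snd z"]
        qform_swap(1)[of "fst w" "fst z"] qform_swap(2)[of _ _ "snd w" "snd z"])
qed

lemma linear_cayley: "linear (\<lambda>w. cayley x y z w)"
proof -
  have 1: "linear (\<lambda>w::oct. f (fst w))" "linear (\<lambda>w::oct. f (snd w))" if "linear f" for f :: "quat \<Rightarrow> real"
    using linear_compose[OF linear_fst that] linear_compose[OF linear_snd that] by (simp_all add: o_def)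
  show ?thesis
    unfolding cayley_def by (intro linear_compose_add linear_compose_sub 1 linear_qvol linear_qform)
qed

lemma cayley_same [simp]: "cayley x x z w = 0" "cayley x y x w = 0" "cayley x y z x = 0"
  "cayley x y y w = 0" "cayley x y z y = 0" "cayley x y z z = 0"
proof -
  show 1: "cayley x x z w = 0" for x z w
    using cayley_swap(1)[of x x z w] by simp
  show 2: "cayley x y y w = 0" for x y w
    using cayley_swap(2)[of x y y w] by simp
  show 3: "cayley x y z z = 0" for x y z
    using cayley_swap(3)[of x y z z] by simp
  show 4: "cayley x y x w = 0" for x y w
    using cayley_swap(2)[of x x y w] 1 by simp
  show "cayley x y z y = 0"
    using cayley_swap(3)[of x y y z] 2 by simp
  show "cayley x y z x = 0"
    using cayley_swap(3)[of x y x z] 4 by simp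
qed

section \<open>Automorphisms of the form given by three unit quaternions\<close>

definition octK :: "quat \<Rightarrow> quat \<Rightarrow> quat \<Rightarrow> oct \<Rightarrow> oct" where
  "octK p q r x = (p * fst x * qcnj q, r * snd x * qcnj q)"

definition cayley_auto :: "(oct \<Rightarrow> oct) \<Rightarrow> bool" where
  "cayley_auto f \<longleftrightarrow> orthogonal_transformation f \<and>
     (\<forall>x y z w. cayley (f x) (f y) (f z) (f w) = cayley x y z w)"

lemma linear_octK: "linear (octK p q r)"
  by (rule linearI) (simp_all add: octK_def algebra_simps)

lemma qcnj_mult_cancel:
  assumes "p \<bullet> p = 1"
  shows "qcnj (p * a * qcnj q) * (p * b * qcnj q) = q * (qcnj a * b) * qcnj q"
proof -
  have "qcnj (p * a * qcnj q) * (p * b * qcnj q) = q * (qcnj a * (qcnj p * (p * b))) * qcnj q"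
    by (simp add: qcnj_mult mult.assoc)
  with assms show ?thesis by (simp add: qcnj_left_cancel)
qed

lemma inner_mult_both:
  assumes "p \<bullet> p = 1" "q \<bullet> q = 1"
  shows "(p * a * qcnj q) \<bullet> (p * b * qcnj q) = a \<bullet> b"
  using assms by (simp add: inner_mult_right inner_mult_left)

text \<open>In \<open>a * qcnj b * c\<close> the inner copies of \<open>p\<close> and
  \<open>q\<close> cancel in pairs, so this cubic expression transforms exactly like a vector and
  its pairing with \<open>d\<close> is unchanged.\<close>

lemma qvol_octK:
  assumes "p \<bullet> p = 1" "q \<bullet> q = 1"
  shows "qvol (p * a * qcnj q) (p * b * qcnj q) (p * c * qcnj q) (p * d * qcnj q) = qvol a b c d"
proof -
  have *: "p * a * qcnj q * qcnj (p * b * qcnj q) * (p * c * qcnj q) = p * (a * qcnj b * c) * qcnj q" for a b c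
  proof -
    have "p * a * qcnj q * qcnj (p * b * qcnj q) * (p * c * qcnj q)
        = p * (a * (qcnj q * (q * (qcnj b * (qcnj p * (p * c)))))) * qcnj q"
      by (simp add: qcnj_mult mult.assoc)
    then show ?thesis
      using assms by (simp add: qcnj_left_cancel mult.assoc)
  qed
  have "p * c * qcnj q * qcnj (p * b * qcnj q) * (p * a * qcnj q)
      - p * a * qcnj q * qcnj (p * b * qcnj q) * (p * c * qcnj q)
      = p * (c * qcnj b * a - a * qcnj b * c) * qcnj q"
    unfolding * by (simp add: algebra_simps)
  then show ?thesis
    unfolding qvol_def by (simp add: inner_mult_both assms)
qed

lemma qform_octK:
  assumes "p \<bullet> p = 1" "q \<bullet> q = 1" "r \<bullet> r = 1"
  shows "qform (p * a * qcnj q) (p * b * qcnj q) (r * c * qcnj q) (r * d * qcnj q) = qform a b c d"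
  unfolding qform_def using assms by (simp add: inner_mult_both qcnj_mult_cancel)

text \<open>The right factor \<open>q\<close> is shared: both \<open>qcnj a * b\<close> and
  \<open>qcnj c * d\<close> are conjugated by it, so their pairing in \<open>qform\<close> survives,
  while the left factors \<open>p\<close> and \<open>r\<close> cancel separately.\<close>

lemma cayley_auto_octK:
  assumes "p \<bullet> p = 1" "q \<bullet> q = 1" "r \<bullet> r = 1"
  shows "cayley_auto (octK p q r)"
  unfolding cayley_auto_def orthogonal_transformation_def
  using assms by (simp add: linear_octK cayley_def)
    (simp add: octK_def inner_prod_def inner_mult_both qvol_octK qform_octK)

section \<open>The triple cross product and the calibration inequality\<close>

definition triple :: "oct \<Rightarrow> oct \<Rightarrow> oct \<Rightarrow> oct" where
  "triple x y z = (\<Sum>b\<in>Basis. cayley x y z b *\<^sub>R b)"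

lemma inner_triple: "triple x y z \<bullet> w = cayley x y z w"
proof -
  interpret linear "\<lambda>w. cayley x y z w" by (rule linear_cayley)
  have "cayley x y z w = cayley x y z (\<Sum>b\<in>Basis. (w \<bullet> b) *\<^sub>R b)"
    by (simp add: euclidean_representation)
  also have "\<dots> = (\<Sum>b\<in>Basis. (w \<bullet> b) * cayley x y z b)"
    by (simp add: sum scale)
  also have "\<dots> = triple x y z \<bullet> w"
    by (simp add: triple_def inner_sum_right inner_commute[of _ w] mult.commute)
  finally show ?thesis ..
qed

lemma Basis_oct: "Basis = {(1,0),(qi,0),(qj,0),(qk,0),(0,1),(0,qi),(0,qj),(0,qk)::oct}"
  by (auto simp: Basis_prod_def Basis_quat_def)


lemma triple_inner_coord: "triple x y v \<bullet> triple x' z w = 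
   cayley x y v (1,0) * cayley x' z w (1,0) + cayley x y v (qi,0) * cayley x' z w (qi,0)
 + cayley x y v (qj,0) * cayley x' z w (qj,0) + cayley x y v (qk,0) * cayley x' z w (qk,0)
 + cayley x y v (0,1) * cayley x' z w (0,1) + cayley x y v (0,qi) * cayley x' z w (0,qi)
 + cayley x y v (0,qj) * cayley x' z w (0,qj) + cayley x y v (0,qk) * cayley x' z w (0,qk)"
proof -
  have "triple x y v \<bullet> triple x' z w = (\<Sum>b\<in>Basis. (triple x y v \<bullet> b) * (triple x' z w \<bullet> b))"
    by (rule euclidean_inner)
  then show ?thesis
    unfolding inner_triple Basis_oct by (simp add: prod_eq_iff)
qed

text \<open>The sign of the last bracket depends on the orientation: it distinguishes the two types of
  triple cross products in dimension eight.\<close>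

lemma triple_inner_triple:
  "triple x y v \<bullet> triple x z w =
     (x \<bullet> x) * ((y \<bullet> z) * (v \<bullet> w) - (y \<bullet> w) * (v \<bullet> z))
   - (x \<bullet> z) * ((y \<bullet> x) * (v \<bullet> w) - (y \<bullet> w) * (v \<bullet> x))
   + (x \<bullet> w) * ((y \<bullet> x) * (v \<bullet> z) - (y \<bullet> z) * (v \<bullet> x))
   - ((x \<bullet> x) * cayley y v z w - (x \<bullet> y) * cayley x v z w - (x \<bullet> v) * cayley y x z w
     - (x \<bullet> z) * cayley y v x w - (x \<bullet> w) * cayley y v z x)"
proof -
  obtain x0 x1 x2 x3 x4 x5 x6 x7 where x: "x = (Quat x0 x1 x2 x3, Quat x4 x5 x6 x7)"
    by (metis prod.exhaust quat.exhaust)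
  obtain y0 y1 y2 y3 y4 y5 y6 y7 where y: "y = (Quat y0 y1 y2 y3, Quat y4 y5 y6 y7)"
    by (metis prod.exhaust quat.exhaust)
  obtain v0 v1 v2 v3 v4 v5 v6 v7 where v: "v = (Quat v0 v1 v2 v3, Quat v4 v5 v6 v7)"
    by (metis prod.exhaust quat.exhaust)
  obtain z0 z1 z2 z3 z4 z5 z6 z7 where z: "z = (Quat z0 z1 z2 z3, Quat z4 z5 z6 z7)"
    by (metis prod.exhaust quat.exhaust)
  obtain w0 w1 w2 w3 w4 w5 w6 w7 where w: "w = (Quat w0 w1 w2 w3, Quat w4 w5 w6 w7)"
    by (metis prod.exhaust quat.exhaust)
  show ?thesis
    \<comment> \<open>Only the vectors of the standard basis occur in the last slots now. Clearing
      their zero coordinates leaves a polynomial identity in forty real variables.\<close>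
    unfolding triple_inner_coord
    unfolding cayley_def fst_conv snd_conv x y z v w qvol_coord qform_coord quat_sel quat.sel
      qijk_sel inner_prod_def inner_quat_def
    by (simp only: mult_zero_left mult_zero_right diff_zero add_0_left add_0_right mult_1_left
        mult_1_right diff_0) algebra
qed

lemma linear_cayley_args:
  "linear (\<lambda>w. cayley x y z w)" "linear (\<lambda>w. cayley x y w z)" "linear (\<lambda>w. cayley x w y z)"
  "linear (\<lambda>w. cayley w x y z)"
proof -
  show 1: "linear (\<lambda>w. cayley x y z w)" for x y z by (rule linear_cayley)
  have "(\<lambda>w. cayley x y w z) = (\<lambda>w. - cayley x y z w)" for x y z
    by (intro ext cayley_swap)
  then show 2: "linear (\<lambda>w. cayley x y w z)" for x y z
    using linear_compose_neg[OF 1] by simp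
  have "(\<lambda>w. cayley x w y z) = (\<lambda>w. - cayley x y w z)" for x y z
    by (intro ext cayley_swap)
  then show 3: "linear (\<lambda>w. cayley x w y z)" for x y z
    using linear_compose_neg[OF 2] by simp
  have "(\<lambda>w. cayley w x y z) = (\<lambda>w. - cayley x w y z)" for x y z
    by (intro ext cayley_swap)
  then show "linear (\<lambda>w. cayley w x y z)"
    using linear_compose_neg[OF 3] by simp
qed

lemmas cayley_simps [simp] =
  linear_cayley_args[THEN linear_add] linear_cayley_args[THEN linear_diff]
  linear_cayley_args[THEN linear_neg] linear_cayley_args[THEN linear_0]
  linear_cayley_args[THEN linear_scale]

lemma oct_eq_iff: "x = y \<longleftrightarrow> (\<forall>w. x \<bullet> w = y \<bullet> w)" for x y :: oct
  using vector_eq_rdot by blast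

lemma triple_swap: "triple y x z = - triple x y z" "triple x z y = - triple x y z"
  using cayley_swap(1)[of y x z] cayley_swap(2)[of x z y] by (auto simp: oct_eq_iff inner_triple)

lemma triple_same [simp]: "triple x x y = 0" "triple x y x = 0" "triple y x x = 0"
  by (auto simp: oct_eq_iff inner_triple)

lemma triple_simps [simp]:
  "triple x y (z + w) = triple x y z + triple x y w" "triple x y (z - w) = triple x y z - triple x y w"
  "triple x y (r *\<^sub>R z) = r *\<^sub>R triple x y z" "triple x y (- z) = - triple x y z" "triple x y 0 = 0"
  "triple x (z + w) y = triple x z y + triple x w y" "triple x (z - w) y = triple x z y - triple x w y"
  "triple x (r *\<^sub>R z) y = r *\<^sub>R triple x z y" "triple x (- z) y = - triple x z y" "triple x 0 y = 0"
  by (auto simp: oct_eq_iff inner_triple inner_simps)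

text \<open>For \<open>z = y\<close> and \<open>w = v\<close> every value of the form in
  \<open>triple_inner_triple\<close> has a repeated argument and vanishes. What remains is the Gram
  determinant of \<open>x\<close>, \<open>y\<close>, \<open>v\<close>, which is 1 for an orthonormal
  triple.\<close>

lemma triple_norm:
  assumes "x \<bullet> x = 1" "y \<bullet> y = 1" "v \<bullet> v = 1" "x \<bullet> y = 0" "x \<bullet> v = 0" "y \<bullet> v = 0"
  shows "triple x y v \<bullet> triple x y v = 1"
  unfolding triple_inner_triple using assms by (simp add: inner_commute)

text \<open>The squared distance from \<open>w\<close> to the unit vector
  \<open>triple x y v\<close> is \<open>2 - 2 * cayley x y v w\<close>. Its nonnegativity is the
  inequality, and its vanishing is the equality case.\<close>

lemma cayley_le_1:
  assumes "x \<bullet> x = 1" "y \<bullet> y = 1" "v \<bullet> v = 1" "x \<bullet> y = 0" "x \<bullet> v = 0" "y \<bullet> v = 0" "w \<bullet> w = 1"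
  shows "cayley x y v w \<le> 1"
    and "cayley x y v w = 1 \<Longrightarrow> w = triple x y v"
proof -
  have *: "(triple x y v - w) \<bullet> (triple x y v - w) = 2 - 2 * cayley x y v w"
    using triple_norm[OF assms(1-6)] assms(7)
    by (simp add: inner_diff inner_triple inner_commute[of w "triple x y v"])
  show "cayley x y v w \<le> 1"
    using inner_ge_zero[of "triple x y v - w"] unfolding * by simp
  show "w = triple x y v" if "cayley x y v w = 1"
    using * that by simp
qed

text \<open>For a unit vector \<open>u\<close> the product \<open>triple u\<close> is a cross product on the seven-dimensional
  complement of \<open>u\<close>.\<close>

lemma triple_triple:
  assumes "u \<bullet> u = 1" "u \<bullet> y = 0" "u \<bullet> z = 0" "u \<bullet> w = 0"
  shows "triple u y (triple u z w) =
    (y \<bullet> w) *\<^sub>R z - (y \<bullet> z) *\<^sub>R w + triple y z w + cayley u y z w *\<^sub>R u"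
proof -
  have "triple u y (triple u z w) \<bullet> v =
    ((y \<bullet> w) *\<^sub>R z - (y \<bullet> z) *\<^sub>R w + triple y z w + cayley u y z w *\<^sub>R u) \<bullet> v" for v
  proof -
    have "triple u y (triple u z w) \<bullet> v = - (triple u y v \<bullet> triple u z w)"
      by (simp add: inner_triple cayley_swap(3)[of u y v])
    also have "\<dots> = - ((y \<bullet> z) * (v \<bullet> w) - (y \<bullet> w) * (v \<bullet> z) - cayley y v z w
        + (u \<bullet> v) * cayley y u z w)"
      unfolding triple_inner_triple using assms by (simp add: inner_commute)
    also have "cayley y v z w = cayley y z w v"
      by (simp add: cayley_swap(2)[of y v z] cayley_swap(3)[of y z w v])
    also have "cayley y u z w = - cayley u y z w"
      by (rule cayley_swap)
    finally show ?thesis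
      by (simp add: inner_simps inner_triple inner_commute[of v w] inner_commute[of v z])
  qed
  then show ?thesis by (simp add: oct_eq_iff)
qed

text \<open>Orthogonality removes the inner products from \<open>triple_triple\<close>, and the
  remaining terms \<open>triple y z w + cayley u y z w *\<^sub>R u\<close> are invariant under
  cyclic permutation of \<open>y\<close>, \<open>z\<close>, \<open>w\<close>.\<close>

lemma triple_triple_rotate:
  assumes "u \<bullet> u = 1" "u \<bullet> y = 0" "u \<bullet> z = 0" "u \<bullet> w = 0" "y \<bullet> z = 0" "y \<bullet> w = 0" "z \<bullet> w = 0"
  shows "triple u y (triple u z w) = triple u w (triple u y z)"
  using assms triple_triple[of u y z w] triple_triple[of u w y z]
    triple_swap(1)[of w y z] triple_swap(2)[of y z w] cayley_swap(2)[of u w y z] cayley_swap(3)[of u y z w]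
  by (simp add: inner_commute)

lemma triple_triple_self:
  assumes "u \<bullet> u = 1" "u \<bullet> y = 0" "u \<bullet> z = 0" "y \<bullet> y = 1" "y \<bullet> z = 0"
  shows "triple u y (triple u y z) = - z" "triple u y (triple u z y) = z"
  using assms triple_triple[of u y y z] triple_triple[of u y z y] by (simp_all add: inner_commute)

lemma inner_triple_args [simp]: "triple x y z \<bullet> x = 0" "triple x y z \<bullet> y = 0" "triple x y z \<bullet> z = 0"
  "x \<bullet> triple x y z = 0" "y \<bullet> triple x y z = 0" "z \<bullet> triple x y z = 0"
  by (simp_all add: inner_triple inner_commute[of _ "triple x y z"])

section \<open>Adapted frames and their multiplication table\<close>

locale spin7_frame =
  fixes f1 f2 f3 f4 f5 f6 f7 f8 :: oct
  assumes unit: "f1 \<bullet> f1 = 1" "f2 \<bullet> f2 = 1" "f3 \<bullet> f3 = 1" "f5 \<bullet> f5 = 1"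
    and orth: "f1 \<bullet> f2 = 0" "f1 \<bullet> f3 = 0" "f1 \<bullet> f5 = 0" "f2 \<bullet> f3 = 0" "f2 \<bullet> f5 = 0" "f3 \<bullet> f5 = 0"
      "f4 \<bullet> f5 = 0"
    and f4: "f4 = triple f1 f2 f3" and f6: "f6 = triple f1 f2 f5" and f7: "f7 = triple f1 f3 f5"
    and f8: "f8 = triple f1 f4 f5"
begin

lemma orth4: "f1 \<bullet> f4 = 0" "f2 \<bullet> f4 = 0" "f3 \<bullet> f4 = 0" "f4 \<bullet> f4 = 1"
  using unit orth by (simp_all add: f4 triple_norm)

abbreviation cr where "cr \<equiv> triple f1"

lemma cr_anti: "cr y x = - cr x y" by (rule triple_swap)

text \<open>Cyclic symmetry of the 3-form obtained by inserting \<open>f1\<close> into the Cayley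
  form; it turns known products into orthogonality relations.\<close>

lemma inner_cr: "a \<bullet> cr y x = x \<bullet> cr a y"
  unfolding inner_commute[of a] inner_commute[of x] inner_triple
  by (simp add: cayley_swap(3)[of f1 y x a] cayley_swap(2)[of f1 y a x])

text \<open>The vectors \<open>f2\<close>, \<open>f3\<close>, \<open>f5\<close> are a basic triple:
  like generators of the octonions they determine all other products. A product either is a
  definition, or follows because multiplication by a unit vector squares to -1
  (\<open>triple_triple_self\<close>), or is moved to a known one by
  \<open>triple_triple_rotate\<close>.\<close>

lemma table:
  "cr f2 f3 = f4" "cr f2 f4 = - f3" "cr f2 f5 = f6" "cr f2 f6 = - f5" "cr f2 f7 = - f8" "cr f2 f8 = f7"
  "cr f3 f4 = f2" "cr f3 f5 = f7" "cr f3 f6 = f8" "cr f3 f7 = - f5" "cr f3 f8 = - f6"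
  "cr f4 f5 = f8" "cr f4 f6 = - f7" "cr f4 f7 = f6" "cr f4 f8 = - f5"
  "cr f5 f6 = f2" "cr f5 f7 = f3" "cr f5 f8 = f4" "cr f6 f7 = - f4" "cr f6 f8 = f3" "cr f7 f8 = - f2"
proof -
  note o = unit orth orth4
  show c23: "cr f2 f3 = f4" and c25: "cr f2 f5 = f6" and c35: "cr f3 f5 = f7" and c45: "cr f4 f5 = f8"
    by (simp_all add: f4 f6 f7 f8)
  show c24: "cr f2 f4 = - f3"
    using triple_triple_self(1)[of f1 f2 f3] o by (simp add: c23)
  show c34: "cr f3 f4 = f2"
    using triple_triple_self(2)[of f1 f3 f2] o by (simp add: c23 inner_commute)
  show c26: "cr f2 f6 = - f5"
    using triple_triple_self(1)[of f1 f2 f5] o by (simp add: c25)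
  show c37: "cr f3 f7 = - f5"
    using triple_triple_self(1)[of f1 f3 f5] o by (simp add: c35)
  show "cr f4 f8 = - f5"
    using triple_triple_self(1)[of f1 f4 f5] o by (simp add: c45)
  show c56: "cr f5 f6 = f2"
    using triple_triple_self(2)[of f1 f5 f2] o by (simp add: c25 inner_commute)
  show c57: "cr f5 f7 = f3"
    using triple_triple_self(2)[of f1 f5 f3] o by (simp add: c35 inner_commute)
  show c58: "cr f5 f8 = f4"
    using triple_triple_self(2)[of f1 f5 f4] o by (simp add: c45 inner_commute)
  show "cr f2 f7 = - f8"
    using triple_triple_rotate[of f1 f2 f3 f5] o
    by (simp add: c23 c35 cr_anti[of f5 f4] c45)
  show "cr f3 f6 = f8"
    using triple_triple_rotate[of f1 f3 f2 f5] o
    by (simp add: c25 cr_anti[of f3 f2] c23 cr_anti[of f5 f4] c45 inner_commute)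
  show "cr f2 f8 = f7"
    using triple_triple_rotate[of f1 f2 f4 f5] o
    by (simp add: c45 c24 cr_anti[of f5 f3] c35)
  show "cr f4 f6 = - f7"
    using triple_triple_rotate[of f1 f4 f2 f5] o
    by (simp add: c25 cr_anti[of f4 f2] c24 cr_anti[of f5 f3] c35 inner_commute)
  show "cr f3 f8 = - f6"
    using triple_triple_rotate[of f1 f3 f4 f5] o
    by (simp add: c45 c34 cr_anti[of f5 f2] c25)
  show "cr f4 f7 = f6"
    using triple_triple_rotate[of f1 f4 f3 f5] o
    by (simp add: c35 cr_anti[of f4 f3] c34 cr_anti[of f5 f2] c25 inner_commute)
  \<comment> \<open>The last three products rotate triples containing \<open>f6\<close> or
    \<open>f7\<close>, which requires these orthogonalities first.\<close>
  have o6: "f1 \<bullet> f6 = 0" "f6 \<bullet> f3 = 0" "f6 \<bullet> f5 = 0" "f6 \<bullet> f4 = 0"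
    using o inner_cr[of f3 f2 f5] inner_cr[of f4 f2 f5]
    by (simp_all add: c25 cr_anti[of f3 f2] c23 cr_anti[of f4 f2] c24 inner_commute)
      (simp_all add: f6)
  have o7: "f1 \<bullet> f7 = 0" "f7 \<bullet> f4 = 0" "f7 \<bullet> f5 = 0"
    using o inner_cr[of f4 f3 f5]
    by (simp_all add: c35 cr_anti[of f4 f3] c34 inner_commute) (simp_all add: f7)
  show "cr f6 f7 = - f4"
    using triple_triple_rotate[of f1 f3 f5 f6] o o6 c23
    by (simp add: c35 c56 inner_commute cr_anti[of f3 f2])
  show "cr f6 f8 = f3"
    using triple_triple_rotate[of f1 f4 f5 f6] o o6 c24
    by (simp add: c45 c56 inner_commute cr_anti[of f4 f2])
  show "cr f7 f8 = - f2"
    using triple_triple_rotate[of f1 f4 f5 f7] o o7 c34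
    by (simp add: c45 c57 inner_commute cr_anti[of f4 f3])
qed

lemma table':
  "cr f3 f2 = - f4" "cr f4 f2 = f3" "cr f5 f2 = - f6" "cr f6 f2 = f5" "cr f7 f2 = f8" "cr f8 f2 = - f7"
  "cr f4 f3 = - f2" "cr f5 f3 = - f7" "cr f6 f3 = - f8" "cr f7 f3 = f5" "cr f8 f3 = f6"
  "cr f5 f4 = - f8" "cr f6 f4 = f7" "cr f7 f4 = - f6" "cr f8 f4 = f5"
  "cr f6 f5 = - f2" "cr f7 f5 = - f3" "cr f8 f5 = - f4" "cr f7 f6 = f4" "cr f8 f6 = - f3" "cr f8 f7 = f2"
  using table by (simp_all add: cr_anti[of f3 f2] cr_anti[of f4 f2] cr_anti[of f5 f2] cr_anti[of f6 f2]
      cr_anti[of f7 f2] cr_anti[of f8 f2] cr_anti[of f4 f3] cr_anti[of f5 f3] cr_anti[of f6 f3]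
      cr_anti[of f7 f3] cr_anti[of f8 f3] cr_anti[of f5 f4] cr_anti[of f6 f4] cr_anti[of f7 f4]
      cr_anti[of f8 f4] cr_anti[of f6 f5] cr_anti[of f7 f5] cr_anti[of f8 f5] cr_anti[of f7 f6]
      cr_anti[of f8 f6] cr_anti[of f8 f7])

lemma orthonormal_frame:
  "f1 \<bullet> f1 = 1" "f2 \<bullet> f2 = 1" "f3 \<bullet> f3 = 1" "f4 \<bullet> f4 = 1" "f5 \<bullet> f5 = 1" "f6 \<bullet> f6 = 1" "f7 \<bullet> f7 = 1" "f8 \<bullet> f8 = 1"
  "f1 \<bullet> f2 = 0" "f1 \<bullet> f3 = 0" "f1 \<bullet> f4 = 0" "f1 \<bullet> f5 = 0" "f1 \<bullet> f6 = 0" "f1 \<bullet> f7 = 0" "f1 \<bullet> f8 = 0"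
  "f2 \<bullet> f3 = 0" "f2 \<bullet> f4 = 0" "f2 \<bullet> f5 = 0" "f2 \<bullet> f6 = 0" "f2 \<bullet> f7 = 0" "f2 \<bullet> f8 = 0"
  "f3 \<bullet> f4 = 0" "f3 \<bullet> f5 = 0" "f3 \<bullet> f6 = 0" "f3 \<bullet> f7 = 0" "f3 \<bullet> f8 = 0"
  "f4 \<bullet> f5 = 0" "f4 \<bullet> f6 = 0" "f4 \<bullet> f7 = 0" "f4 \<bullet> f8 = 0"
  "f5 \<bullet> f6 = 0" "f5 \<bullet> f7 = 0" "f5 \<bullet> f8 = 0" "f6 \<bullet> f7 = 0" "f6 \<bullet> f8 = 0" "f7 \<bullet> f8 = 0"
proof -
  note o = unit orth orth4
  show "f1 \<bullet> f1 = 1" "f2 \<bullet> f2 = 1" "f3 \<bullet> f3 = 1" "f4 \<bullet> f4 = 1" "f5 \<bullet> f5 = 1"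
    "f1 \<bullet> f2 = 0" "f1 \<bullet> f3 = 0" "f1 \<bullet> f4 = 0" "f1 \<bullet> f5 = 0" "f2 \<bullet> f3 = 0" "f2 \<bullet> f4 = 0" "f2 \<bullet> f5 = 0"
    "f3 \<bullet> f4 = 0" "f3 \<bullet> f5 = 0" "f4 \<bullet> f5 = 0"
    using o by simp_all
  show "f1 \<bullet> f6 = 0" "f1 \<bullet> f7 = 0" "f1 \<bullet> f8 = 0" "f2 \<bullet> f6 = 0" "f3 \<bullet> f7 = 0" "f4 \<bullet> f8 = 0"
    "f5 \<bullet> f6 = 0" "f5 \<bullet> f7 = 0" "f5 \<bullet> f8 = 0"
    by (simp_all add: f6 f7 f8)
  show "f6 \<bullet> f6 = 1" "f7 \<bullet> f7 = 1" "f8 \<bullet> f8 = 1"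
    using o by (simp_all add: f6 f7 f8 triple_norm)
  note inner_cr[of f3 f2 f5] inner_cr[of f4 f2 f5] inner_cr[of f2 f3 f5] inner_cr[of f4 f3 f5]
    inner_cr[of f2 f4 f5] inner_cr[of f3 f4 f5]
  with o
  show "f2 \<bullet> f7 = 0" "f2 \<bullet> f8 = 0" "f3 \<bullet> f6 = 0" "f3 \<bullet> f8 = 0" "f4 \<bullet> f6 = 0" "f4 \<bullet> f7 = 0"
    by (simp_all add: table table' inner_commute)
  show "f6 \<bullet> f7 = 0" "f6 \<bullet> f8 = 0" "f7 \<bullet> f8 = 0"
    unfolding f6 f7 f8 triple_inner_triple using o by (simp_all add: inner_commute)
qed

definition frame_map :: "oct \<Rightarrow> oct" where
  "frame_map x = q0 (fst x) *\<^sub>R f1 + q1 (fst x) *\<^sub>R f2 + q2 (fst x) *\<^sub>R f3 + q3 (fst x) *\<^sub>R f4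
     + q0 (snd x) *\<^sub>R f5 + q1 (snd x) *\<^sub>R f6 + q2 (snd x) *\<^sub>R f7 + q3 (snd x) *\<^sub>R f8"

lemma linear_frame_map: "linear frame_map"
  by (rule linearI) (simp_all add: frame_map_def algebra_simps)

lemma frame_map_basis: "frame_map (1,0) = f1" "frame_map (qi,0) = f2" "frame_map (qj,0) = f3"
  "frame_map (qk,0) = f4" "frame_map (0,1) = f5" "frame_map (0,qi) = f6" "frame_map (0,qj) = f7"
  "frame_map (0,qk) = f8"
  by (simp_all add: frame_map_def)

lemma orthogonal_frame_map: "orthogonal_transformation frame_map"
proof -
  have "(\<lambda>x y. frame_map x \<bullet> frame_map y) = (\<lambda>x y. x \<bullet> y)"
  proof (rule bilinear_eq_stdbasis)
    show "bilinear (\<lambda>x y. frame_map x \<bullet> frame_map y)"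
      unfolding bilinear_def by (intro conjI allI linearI)
        (simp_all add: inner_simps linear_frame_map[THEN linear_add] linear_frame_map[THEN linear_scale])
    show "bilinear ((\<bullet>) :: oct \<Rightarrow> oct \<Rightarrow> real)"
      unfolding bilinear_def by (intro conjI allI linearI) (simp_all add: inner_simps del: inner_Pair)
    fix i j :: oct assume "i \<in> Basis" "j \<in> Basis"
    then show "frame_map i \<bullet> frame_map j = i \<bullet> j"
      unfolding Basis_oct
      by (elim insertE emptyE) (simp_all add: frame_map_basis orthonormal_frame
          orthonormal_frame[THEN trans[OF inner_commute]] inner_quat_def)
  qed
  then show ?thesis
    unfolding orthogonal_transformation_def by (auto simp: linear_frame_map fun_eq_iff)
qed

end

lemma triple_coord: "triple x y z =
   (Quat (cayley x y z (1,0)) (cayley x y z (qi,0)) (cayley x y z (qj,0)) (cayley x y z (qk,0)),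
    Quat (cayley x y z (0,1)) (cayley x y z (0,qi)) (cayley x y z (0,qj)) (cayley x y z (0,qk)))"
  unfolding inner_triple[symmetric] by (simp add: prod_eq_iff quat_eq_iff inner_prod_def inner_quat_def)

text \<open>With the standard basis as an instance of the locale, one derivation of
  \<open>table\<close> supplies the structure constants on both sides of the comparison
  below.\<close>

lemma spin7_frame_standard: "spin7_frame (1,0) (qi,0) (qj,0) (qk,0) (0,1) (0,qi) (0,qj) (0,qk)"
proof
  show "(qk,0) = triple (1,0) (qi,0) (qj,0)" "(0,qi) = triple (1,0) (qi,0) (0,1)"
    "(0,qj) = triple (1,0) (qj,0) (0,1)" "(0,qk) = triple (1,0) (qk,0) (0,1)"
    by (simp_all add: triple_coord cayley_def qvol_coord qform_coord prod_eq_iff quat_eq_iff)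
qed (simp_all add: inner_prod_def inner_quat_def)

context spin7_frame
begin

text \<open>By bilinearity it is enough to compare the 64 products of basis vectors, and both frames
  obey the same table.\<close>

lemma triple_frame_map: "cr (frame_map x) (frame_map y) = frame_map (triple (1,0) x y)"
proof -
  interpret std: spin7_frame "(1,0)" "(qi,0)" "(qj,0)" "(qk,0)" "(0,1)" "(0,qi)" "(0,qj)" "(0,qk)"
    by (rule spin7_frame_standard)
  have "(\<lambda>x y. cr (frame_map x) (frame_map y)) = (\<lambda>x y. frame_map (triple (1,0) x y))"
  proof (rule bilinear_eq_stdbasis)
    show "bilinear (\<lambda>x y. cr (frame_map x) (frame_map y))"
      unfolding bilinear_def by (intro conjI allI linearI)
        (simp_all add: linear_frame_map[THEN linear_add] linear_frame_map[THEN linear_scale])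
    show "bilinear (\<lambda>x y. frame_map (triple (1,0) x y))"
      unfolding bilinear_def by (intro conjI allI linearI)
        (simp_all add: linear_frame_map[THEN linear_add] linear_frame_map[THEN linear_scale])
    fix i j :: oct assume "i \<in> Basis" "j \<in> Basis"
    then show "cr (frame_map i) (frame_map j) = frame_map (triple (1,0) i j)"
      unfolding Basis_oct
      by (elim insertE emptyE) (simp_all only: frame_map_basis table table' std.table std.table'
          triple_same linear_frame_map[THEN linear_neg] linear_frame_map[THEN linear_0])
  qed
  from fun_cong[OF fun_cong[OF this, of x], of y] show ?thesis by simp
qed

text \<open>For a unit vector \<open>x\<close>, solving \<open>triple_inner_triple\<close> for
  \<open>cayley y v z w\<close> leaves only inner products, values of the form with first argument
  \<open>x\<close>, and inner products of values of \<open>triple x\<close>. With \<open>x\<close>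
  equal to \<open>f1\<close> and to the first basis vector respectively, \<open>frame_map\<close> is
  already known to match all of these.\<close>

lemma cayley_auto_frame_map: "cayley_auto frame_map"
proof -
  let ?L = frame_map
  have inner: "?L x \<bullet> ?L y = x \<bullet> y" for x y
    using orthogonal_frame_map unfolding orthogonal_transformation_def by blast
  have first: "cayley f1 (?L x) (?L y) (?L z) = cayley (1,0) x y z" for x y z
    unfolding inner_triple[symmetric] triple_frame_map by (rule inner)
  have "cayley (?L y) (?L v) (?L z) (?L w) = cayley y v z w" for y v z w
  proof -
    have eq: "cayley y v z w = (y \<bullet> z) * (v \<bullet> w) - (y \<bullet> w) * (v \<bullet> z)
      - (x \<bullet> z) * ((y \<bullet> x) * (v \<bullet> w) - (y \<bullet> w) * (v \<bullet> x))
      + (x \<bullet> w) * ((y \<bullet> x) * (v \<bullet> z) - (y \<bullet> z) * (v \<bullet> x))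
      + (x \<bullet> y) * cayley x v z w - (x \<bullet> v) * cayley x y z w
      + (x \<bullet> z) * cayley x y v w - (x \<bullet> w) * cayley x y v z
      - triple x y v \<bullet> triple x z w" if "x \<bullet> x = 1" for x y v z w
    proof -
      have 1: "cayley y x z w = - cayley x y z w" "cayley y v x w = cayley x y v w"
        "cayley y v z x = - cayley x y v z"
        using cayley_swap(1)[of x y z w] cayley_swap(2)[of y x v w] cayley_swap(1)[of x y v w]
          cayley_swap(3)[of y v x z] cayley_swap(2)[of y x v z] cayley_swap(1)[of x y v z] by simp_all
      show ?thesis
        unfolding triple_inner_triple 1 that by simp
    qed
    have "f1 = ?L (1,0)" by (simp add: frame_map_basis)
    then have f1: "f1 \<bullet> ?L y = (1,0) \<bullet> y" "?L y \<bullet> f1 = y \<bullet> (1,0)" for y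
      by (metis inner)+
    show ?thesis
      unfolding eq[OF unit(1), of "?L y" "?L v" "?L z" "?L w"]
        eq[OF spin7_frame.unit(1)[OF spin7_frame_standard], of y v z w]
      unfolding triple_frame_map inner f1 first ..
  qed
  then show ?thesis by (simp add: cayley_auto_def orthogonal_frame_map)
qed

end

text \<open>The equality case forces \<open>f4 = triple f1 f2 f3\<close>. Four vectors cannot span
  eight dimensions, so a unit vector orthogonal to them exists, and any such choice of
  \<open>f5\<close> completes an adapted frame.\<close>

lemma cayley_frame_transport:
  assumes unit: "f1 \<bullet> f1 = 1" "f2 \<bullet> f2 = 1" "f3 \<bullet> f3 = 1" "f4 \<bullet> f4 = 1"
    and orth: "f1 \<bullet> f2 = 0" "f1 \<bullet> f3 = 0" "f2 \<bullet> f3 = 0"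
    and "cayley f1 f2 f3 f4 = 1"
  obtains L where "cayley_auto L" "L (1,0) = f1" "L (qi,0) = f2" "L (qj,0) = f3" "L (qk,0) = f4"
proof -
  have f4: "f4 = triple f1 f2 f3"
    using assms by (intro cayley_le_1(2)) auto
  have "dim {f1,f2,f3,f4} \<le> card {f1,f2,f3,f4}"
    by (rule dim_le_card') auto
  also have "\<dots> < DIM(oct)"
    by (auto simp: card_insert_if)
  finally obtain x where x: "x \<noteq> 0" "\<And>y. y \<in> span {f1,f2,f3,f4} \<Longrightarrow> orthogonal x y"
    using orthogonal_to_subspace_exists by metis
  define f5 where "f5 = x /\<^sub>R norm x"
  have "f5 \<bullet> f5 = 1"
    using x(1) by (simp add: f5_def power2_norm_eq_inner[symmetric] power2_eq_square)
  moreover have "y \<bullet> f5 = 0" if "y \<in> {f1,f2,f3,f4}" for y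
    using x(2)[OF span_base[OF that]] by (simp add: f5_def orthogonal_def inner_commute)
  ultimately interpret spin7_frame f1 f2 f3 f4 f5 "triple f1 f2 f5" "triple f1 f3 f5" "triple f1 f4 f5"
    using assms by unfold_locales (auto simp: f4)
  show thesis
    using cayley_auto_frame_map frame_map_basis by (intro that[of frame_map])
qed

section \<open>The stabilizer of the standard Cayley plane\<close>

lemma inner_qcnj_mult: "x \<bullet> (qcnj b * c) = (b * x) \<bullet> c"
  by (simp add: inner_quat_eq qcnj_mult mult.assoc)

lemma quat_anticommutator: "(a::quat) * b + b * a = (2 * (a \<bullet> 1)) *\<^sub>R b + (2 * (b \<bullet> 1)) *\<^sub>R a - (2 * (a \<bullet> b)) *\<^sub>R 1"
  by (simp add: quat_eq_iff quat_sel_mult inner_quat_def)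

lemma quat_units_mult [simp]:
  "qi * qi = - 1" "qj * qj = - 1" "qk * qk = - 1" "qi * qj = qk" "qj * qk = qi" "qk * qi = qj"
  "qj * qi = - qk" "qk * qj = - qi" "qi * qk = - qj"
  by (simp_all add: quat_eq_iff quat_sel_mult)

text \<open>Skolem--Noether for the quaternions: averaging \<open>z\<close> over the quaternion group yields an
  intertwiner, which is nonzero for some \<open>z\<close>.\<close>

lemma quat_automorphism_inner:
  fixes \<rho> :: "quat \<Rightarrow> quat"
  assumes "linear \<rho>" and mult: "\<And>a b. \<rho> (a * b) = \<rho> a * \<rho> b" and "\<rho> 1 = 1"
  obtains q where "q \<bullet> q = 1" "\<And>a. \<rho> a = q * a * qcnj q"
proof -
  interpret linear \<rho> by fact
  \<comment> \<open>The summands are \<open>\<rho> u * z * inverse u\<close> for \<open>u\<close> in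
    \<open>{1, qi, qj, qk}\<close>, the minus signs coming from the inverses. A unit and its
    negative contribute equally, so four of the eight group elements suffice.\<close>
  define Q where "Q z = z - \<rho> qi * z * qi - \<rho> qj * z * qj - \<rho> qk * z * qk" for z
  have rel: "\<rho> qi * \<rho> qi = - 1" "\<rho> qj * \<rho> qj = - 1" "\<rho> qk * \<rho> qk = - 1"
    "\<rho> qi * \<rho> qj = \<rho> qk" "\<rho> qj * \<rho> qk = \<rho> qi" "\<rho> qk * \<rho> qi = \<rho> qj"
    "\<rho> qj * \<rho> qi = - \<rho> qk" "\<rho> qk * \<rho> qj = - \<rho> qi" "\<rho> qi * \<rho> qk = - \<rho> qj"
    by (simp_all add: neg \<open>\<rho> 1 = 1\<close> flip: mult)
  have rel': "\<rho> qi * (\<rho> qi * x) = - x" "\<rho> qj * (\<rho> qj * x) = - x" "\<rho> qk * (\<rho> qk * x) = - x"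
    "\<rho> qi * (\<rho> qj * x) = \<rho> qk * x" "\<rho> qj * (\<rho> qk * x) = \<rho> qi * x" "\<rho> qk * (\<rho> qi * x) = \<rho> qj * x"
    "\<rho> qj * (\<rho> qi * x) = - (\<rho> qk * x)" "\<rho> qk * (\<rho> qj * x) = - (\<rho> qi * x)"
    "\<rho> qi * (\<rho> qk * x) = - (\<rho> qj * x)" for x
    by (simp_all add: rel flip: mult.assoc)
  have "\<rho> qi * Q z = Q z * qi" "\<rho> qj * Q z = Q z * qj" "\<rho> qk * Q z = Q z * qk" for z
    by (simp_all add: Q_def algebra_simps rel')
  then have inter: "\<rho> a * Q z = Q z * a" for a z
    by (subst (1 2) quat_expand[of a])
      (simp add: add scale \<open>\<rho> 1 = 1\<close> distrib_left distrib_right)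
  \<comment> \<open>In this combination every occurrence of \<open>\<rho>\<close> cancels, so
    \<open>Q\<close> cannot vanish at all of \<open>1\<close>, \<open>qi\<close>, \<open>qj\<close>,
    \<open>qk\<close>.\<close>
  have "Q 1 - Q qi * qi - Q qj * qj - Q qk * qk = 4"
    by (simp add: Q_def algebra_simps)
  moreover have "(4::quat) \<noteq> 0"
    by simp
  ultimately obtain z where z: "Q z \<noteq> 0"
    by (metis diff_zero mult_zero_left)
  define q where "q = Q z /\<^sub>R norm (Q z)"
  have q: "q \<bullet> q = 1"
    using z by (simp add: q_def power2_norm_eq_inner[symmetric] power2_eq_square)
  have "\<rho> a * q = q * a" for a
    using inter[of a z] by (simp add: q_def)
  then have "\<rho> a = q * a * qcnj q" for a
    using q by (metis qcnj_right_cancel(2))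
  with q show thesis by (rule that)
qed

text \<open>This is the double cover of SO(4) by pairs of unit quaternions. After division by
  \<open>f 1\<close> the map fixes 1. Anticommutators are then preserved because
  \<open>quat_anticommutator\<close> expresses them by inner products, and commutators because
  \<open>qvol a 1 b d\<close> is half the inner product of \<open>b * a - a * b\<close> with
  \<open>d\<close>. Adding the two gives multiplicativity, and an automorphism is inner.\<close>

lemma orthogonal_quat_decomp:
  fixes f :: "quat \<Rightarrow> quat"
  assumes f: "orthogonal_transformation f"
    and vol: "\<And>a b c d. qvol (f a) (f b) (f c) (f d) = qvol a b c d"
  obtains p q where "p \<bullet> p = 1" "q \<bullet> q = 1" "\<And>a. f a = p * a * qcnj q"
proof -
  define u where "u = f 1"
  have u: "u \<bullet> u = 1"
    using f by (simp add: u_def orthogonal_transformation_def inner_quat_def)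
  define \<rho> where "\<rho> a = qcnj u * f a" for a
  have f_eq: "f a = u * \<rho> a" for a
    using u by (simp add: \<rho>_def qcnj_left_cancel)
  have inner: "\<rho> a \<bullet> \<rho> b = a \<bullet> b" for a b
    using f u by (simp add: \<rho>_def inner_mult_left orthogonal_transformation_def)
  interpret f: linear f using f by (simp add: orthogonal_transformation_def)
  have lin: "linear \<rho>"
    by (rule linearI) (simp_all add: \<rho>_def f.add f.scale distrib_left)
  then interpret linear \<rho> .
  have one: "\<rho> 1 = 1"
    using u by (simp add: \<rho>_def u_def mult_qcnj)
  have "orthogonal_transformation \<rho>"
    using lin inner by (simp add: orthogonal_transformation_def)
  then have surj: "\<exists>a. b = \<rho> a" for b
    using orthogonal_transformation_surj by (metis surjD)
  have vol: "qvol (\<rho> a) (\<rho> b) (\<rho> c) (\<rho> d) = qvol a b c d" for a b c d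
    using qvol_octK[of "qcnj u" 1 "f a" "f b" "f c" "f d"] u vol
    by (simp add: \<rho>_def inner_quat_def)
  have "\<rho> b * \<rho> a - \<rho> a * \<rho> b = \<rho> (b * a - a * b)" for a b
  proof -
    have "(\<rho> b * \<rho> a - \<rho> a * \<rho> b) \<bullet> \<rho> d = \<rho> (b * a - a * b) \<bullet> \<rho> d" for d
      using vol[of a 1 b d] by (simp only: inner) (simp add: qvol_def one)
    then have "(\<rho> b * \<rho> a - \<rho> a * \<rho> b) \<bullet> d = \<rho> (b * a - a * b) \<bullet> d" for d
      by (metis surj)
    then show ?thesis using vector_eq_rdot by blast
  qed
  moreover have "\<rho> b * \<rho> a + \<rho> a * \<rho> b = \<rho> (b * a + a * b)" for a b
    using inner[of _ 1] by (simp add: quat_anticommutator add diff scale one inner)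
  ultimately have "(\<rho> b * \<rho> a - \<rho> a * \<rho> b) + (\<rho> b * \<rho> a + \<rho> a * \<rho> b) = \<rho> (b * a - a * b) + \<rho> (b * a + a * b)" for a b
    by (simp only:)
  then have "2 *\<^sub>R (\<rho> b * \<rho> a) = 2 *\<^sub>R \<rho> (b * a)" for a b
    by (simp add: add diff scaleR_2)
  then have "\<rho> (a * b) = \<rho> a * \<rho> b" for a b
    by simp
  then obtain q where q: "q \<bullet> q = 1" "\<And>a. \<rho> a = q * a * qcnj q"
    using quat_automorphism_inner[OF lin _ one] by metis
  show thesis
  proof
    show "(u * q) \<bullet> (u * q) = 1" using u q by (simp add: inner_mult_left)
    show "f a = u * q * a * qcnj q" for a
      by (simp add: f_eq q mult.assoc)
  qed fact
qed

text \<open>On the plane \<open>L\<close> preserves the volume form, which yields \<open>p\<close>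
  and \<open>q\<close>. Being an isometry it also preserves the orthogonal complement, and there the
  mixed terms of the form tie it to the same \<open>q\<close>.\<close>

lemma cayley_auto_stabilizer:
  assumes L: "cayley_auto L" and stab: "\<And>a. snd (L (a, 0)) = 0"
  obtains p q r where "p \<bullet> p = 1" "q \<bullet> q = 1" "r \<bullet> r = 1" "L = octK p q r"
proof -
  have orth: "orthogonal_transformation L" and cay: "\<And>x y z w. cayley (L x) (L y) (L z) (L w) = cayley x y z w"
    using L unfolding cayley_auto_def by blast+
  then have lin: "linear L" and inner: "\<And>x y. L x \<bullet> L y = x \<bullet> y"
    unfolding orthogonal_transformation_def by blast+
  interpret linear L by fact
  define f where "f a = fst (L (a, 0))" for a
  define g where "g b = snd (L (0, b))" for b
  have Lf: "L (a, 0) = (f a, 0)" for a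
    using stab by (simp add: f_def prod_eq_iff)
  have f: "orthogonal_transformation f"
    unfolding orthogonal_transformation_def
  proof (intro conjI allI)
    show "linear f"
      by (rule linearI) (simp_all add: f_def flip: add scale fst_add fst_scaleR)
    show "f a \<bullet> f b = a \<bullet> b" for a b
      using inner[of "(a,0)" "(b,0)"] by (simp add: Lf)
  qed
  have Lg: "L (0, b) = (0, g b)" for b
  proof -
    obtain a where a: "f a = fst (L (0, b))"
      using orthogonal_transformation_surj[OF f] by (metis surjD)
    have "f a \<bullet> f a = L (a, 0) \<bullet> L (0, b)"
      by (simp only: Lf) (simp add: a inner_prod_def)
    also have "\<dots> = 0" by (simp only: inner) (simp add: inner_prod_def)
    finally show ?thesis
      using a by (simp add: g_def prod_eq_iff)
  qed
  have g: "orthogonal_transformation g"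
    unfolding orthogonal_transformation_def
  proof (intro conjI allI)
    show "linear g"
      by (rule linearI) (simp_all add: g_def flip: add scale snd_add snd_scaleR)
    show "g a \<bullet> g b = a \<bullet> b" for a b
      using inner[of "(0,a)" "(0,b)"] by (simp add: Lg)
  qed
  have "qvol (f a) (f b) (f c) (f d) = qvol a b c d" for a b c d
    using cay[of "(a,0)" "(b,0)" "(c,0)" "(d,0)"]
    by (simp add: Lf cayley_def qvol_coord qform_coord)
  then obtain p q where p: "p \<bullet> p = 1" and q: "q \<bullet> q = 1" and fpq: "\<And>a. f a = p * a * qcnj q"
    using orthogonal_quat_decomp[OF f] by metis
  \<comment> \<open>Forced by the desired formula \<open>g m = r * m * qcnj q\<close> at
    \<open>m = 1\<close>.\<close>
  define r where "r = g 1 * q"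
  have gi: "g a \<bullet> g b = a \<bullet> b" for a b
    using g by (simp add: orthogonal_transformation_def)
  have r: "r \<bullet> r = 1"
    using q gi[of 1 1] by (simp add: r_def inner_mult_right inner_quat_def[of 1])
  have "g m = r * m * qcnj q" for m
  proof -
    have "g m \<bullet> g c = (g 1 * (q * m * qcnj q)) \<bullet> g c" for c
    proof -
      \<comment> \<open>With 1 in the first and third slots the mixed term reduces to an inner
        product, so its invariance determines \<open>g m\<close> from \<open>g 1\<close> and
        conjugation by \<open>q\<close>.\<close>
      have "qform (f 1) (f m) (g 1) (g c) = qform 1 m 1 c"
        using cay[of "(1,0)" "(m,0)" "(0,1)" "(0,c)"]
        by (simp add: Lf Lg cayley_def) (simp add: qvol_coord qform_coord[of _ _ 0] qform_coord[of _ _ _ 0] qform_coord[of 0] qform_coord[of _ 0])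
      then have "(q * m * qcnj q) \<bullet> (qcnj (g 1) * g c) = m \<bullet> c"
        using p q gi by (simp add: qform_def fpq qcnj_mult_cancel[of p 1, simplified] inner_mult_both[of p q 1, simplified])
      then show ?thesis
        by (simp add: inner_qcnj_mult gi)
    qed
    then have "g m \<bullet> x = (g 1 * (q * m * qcnj q)) \<bullet> x" for x
      using orthogonal_transformation_surj[OF g] by (metis surjD)
    then show ?thesis
      using vector_eq_rdot by (metis r_def mult.assoc)
  qed
  then have "L x = octK p q r x" for x
    using add[of "(fst x, 0)" "(0, snd x)"] by (simp add: Lf Lg octK_def fpq)
  with p q r show thesis
    using that by blast
qed

lemma octK_mult: "octK p q r (octK p' q' r' x) = octK (p * p') (q * q') (r * r') x"
  by (simp add: octK_def qcnj_mult mult.assoc)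

text \<open>Testing on pairs \<open>(a, a)\<close> gives \<open>p * a = a * q\<close> and
  \<open>r * a = a * q\<close>. At \<open>a = 1\<close> the three units coincide; then the common
  unit is central, hence real, hence 1 or -1.\<close>

lemma octK_id_iff:
  assumes "p \<bullet> p = 1" "q \<bullet> q = 1" "r \<bullet> r = 1"
  shows "octK p q r = (\<lambda>x. x) \<longleftrightarrow> (p = 1 \<and> q = 1 \<and> r = 1) \<or> (p = - 1 \<and> q = - 1 \<and> r = - 1)"
proof
  assume *: "octK p q r = (\<lambda>x. x)"
  have 1: "p * a = a * q" and 2: "r * a = a * q" for a
  proof -
    have "p * a * qcnj q = a" "r * a * qcnj q = a"
      using fun_cong[OF *, of "(a, a)"] by (simp_all add: octK_def)
    then show "p * a = a * q" "r * a = a * q"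
      using qcnj_right_cancel[OF \<open>q \<bullet> q = 1\<close>] by metis+
  qed
  have pq: "p = q" "r = q" using 1[of 1] 2[of 1] by simp_all
  have "q * qi = qi * q" "q * qj = qj * q"
    using 1 pq by auto
  then have "q1 q = 0" "q2 q = 0" "q3 q = 0"
    by (auto simp: quat_eq_iff quat_sel_mult)
  moreover from this have "q0 q = 1 \<or> q0 q = - 1"
    using \<open>q \<bullet> q = 1\<close> by (simp add: inner_quat_def square_eq_1_iff)
  ultimately show "(p = 1 \<and> q = 1 \<and> r = 1) \<or> (p = - 1 \<and> q = - 1 \<and> r = - 1)"
    by (auto simp: pq quat_eq_iff)
qed (auto simp: octK_def)

section \<open>Alternating forms and determinants\<close>

lemma linear_on_set_sum:
  assumes V: "subspace V" and f: "linear_on_set V f" and "finite J" "\<And>j. j \<in> J \<Longrightarrow> v j \<in> V"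
  shows "f (\<Sum>j\<in>J. c j *\<^sub>R v j) = (\<Sum>j\<in>J. c j *\<^sub>R f (v j))"
  using assms(3,4)
proof (induction J)
  case empty
  have "f (0 *\<^sub>R 0 + 0 *\<^sub>R 0) = 0 *\<^sub>R f 0 + 0 *\<^sub>R f 0"
    using f subspace_0[OF V] unfolding linear_on_set_def by blast
  then show ?case by simp
next
  case (insert j J)
  have "(\<Sum>j\<in>J. c j *\<^sub>R v j) \<in> V"
    using insert by (intro subspace_sum[OF V] subspace_scale[OF V]) auto
  then have "f (c j *\<^sub>R v j + 1 *\<^sub>R (\<Sum>j\<in>J. c j *\<^sub>R v j)) = c j *\<^sub>R f (v j) + 1 *\<^sub>R f (\<Sum>j\<in>J. c j *\<^sub>R v j)"
    using f insert unfolding linear_on_set_def by blast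
  then show ?case using insert by simp
qed

lemma alternating_form_linear:
  assumes "alternating_form V m \<omega>" "set xs \<subseteq> V" "length xs = m" "i < m"
  shows "linear_on_set V (\<lambda>v. \<omega> (xs[i := v]))"
  using assms unfolding alternating_form_def by blast

lemma alternating_form_add:
  assumes "alternating_form V m \<omega>" "set xs \<subseteq> V" "length xs = m" "i < m" "v \<in> V" "w \<in> V"
  shows "\<omega> (xs[i := v + w]) = \<omega> (xs[i := v]) + \<omega> (xs[i := w])"
proof -
  have "\<omega> (xs[i := 1 *\<^sub>R v + 1 *\<^sub>R w]) = 1 *\<^sub>R \<omega> (xs[i := v]) + 1 *\<^sub>R \<omega> (xs[i := w])"
    using alternating_form_linear[OF assms(1-4)] assms(5,6) unfolding linear_on_set_def by blast
  then show ?thesis by simp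
qed

lemma alternating_form_not_distinct:
  assumes "alternating_form V m \<omega>" "set xs \<subseteq> V" "length xs = m" "\<not> distinct xs"
  shows "\<omega> xs = 0"
  using assms unfolding alternating_form_def by blast

lemma set_list_update_subset: "set xs \<subseteq> V \<Longrightarrow> v \<in> V \<Longrightarrow> set (xs[i := v]) \<subseteq> V"
  using set_update_subset_insert by fastforce

lemma alternating_form_swap:
  assumes V: "subspace V" and w: "alternating_form V m \<omega>" and xs: "set xs \<subseteq> V" "length xs = m"
    and ij: "i < m" "j < m" "i \<noteq> j"
  shows "\<omega> (xs[i := xs ! j, j := xs ! i]) = - \<omega> xs"
proof -
  let ?x = "xs ! i" and ?y = "xs ! j"
  let ?f = "\<lambda>a b. \<omega> (xs[i := a, j := b])"
  have xy: "?x \<in> V" "?y \<in> V" "?x + ?y \<in> V"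
    using xs ij V by (auto intro!: subspace_add)
  have zero: "?f a a = 0" if "a \<in> V" for a
  proof (rule alternating_form_not_distinct[OF w])
    have "xs[i := a, j := a] ! i = xs[i := a, j := a] ! j"
      using ij xs by simp
    then show "\<not> distinct (xs[i := a, j := a])"
      using ij xs(2) by (metis length_list_update nth_eq_iff_index_eq)
  qed (use that xs in \<open>simp_all add: set_list_update_subset\<close>)
  have add1: "?f (a + b) c = ?f a c + ?f b c" if "a \<in> V" "b \<in> V" "c \<in> V" for a b c
  proof -
    have "\<omega> (xs[j := c, i := a + b]) = \<omega> (xs[j := c, i := a]) + \<omega> (xs[j := c, i := b])"
      using that xs ij by (intro alternating_form_add[OF w]) (simp_all add: set_list_update_subset)
    then show ?thesis using ij by (simp add: list_update_swap)
  qed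
  have add2: "?f c (a + b) = ?f c a + ?f c b" if "a \<in> V" "b \<in> V" "c \<in> V" for a b c
    using that xs ij by (intro alternating_form_add[OF w]) (simp_all add: set_list_update_subset)
  have "0 = ?f (?x + ?y) (?x + ?y)" using zero xy by simp
  also have "\<dots> = ?f ?x ?y + ?f ?y ?x"
    unfolding add1[OF xy] add2[OF xy(1,2,1)] add2[OF xy(1,2,2)] by (simp only: zero xy add_0_left add_0_right)
  finally show ?thesis by simp
qed

lemma alternating_form_permute:
  assumes V: "subspace V" and w: "alternating_form V m \<omega>" and "\<sigma> permutes {..<m}"
    and "set xs \<subseteq> V" "length xs = m"
  shows "\<omega> (map (\<lambda>i. xs ! \<sigma> i) [0..<m]) = of_int (sign \<sigma>) * \<omega> xs"
  using assms(3) finite_lessThan assms(4,5)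
proof (induction \<sigma> arbitrary: xs rule: permutes_induct)
  case id
  then show ?case using map_nth[of xs] by simp
next
  case (swap a b p)
  let ?ys = "map (\<lambda>i. xs ! Transposition.transpose a b i) [0..<m]"
  have ys: "?ys = xs[a := xs ! b, b := xs ! a]"
    using swap by (intro nth_equalityI) (auto simp: nth_list_update Transposition.transpose_def)
  have sub: "set ?ys \<subseteq> V"
    unfolding ys using swap by (intro set_list_update_subset) auto
  have "\<omega> (map (\<lambda>i. xs ! (Transposition.transpose a b \<circ> p) i) [0..<m]) = \<omega> (map (\<lambda>i. ?ys ! p i) [0..<m])"
    using permutes_in_image[OF \<open>p permutes {..<m}\<close>] by (intro arg_cong[where f = \<omega>] map_cong) auto
  also have "\<dots> = of_int (sign p) * \<omega> ?ys"
    using sub by (intro swap) auto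
  also have "\<omega> ?ys = - \<omega> xs"
    unfolding ys using swap by (intro alternating_form_swap[OF V w]) auto
  also have "of_int (sign p) * - \<omega> xs = of_int (sign (Transposition.transpose a b \<circ> p)) * \<omega> xs"
    by (subst sign_compose) (use swap in \<open>auto simp: permutation_swap_id sign_swap_id
        intro: permutes_imp_permutation[of "{..<m}"]\<close>)
  finally show ?case .
qed

text \<open>The entries from \<open>n\<close> on are arbitrary vectors \<open>y\<close> so that the
  induction can expand one more entry: the new entry is first replaced by \<open>xs ! j\<close>
  inside \<open>y\<close>, and the induction hypothesis is applied to the altered
  \<open>y\<close>.\<close>

lemma alternating_form_expand_rows:
  assumes V: "subspace V" and w: "alternating_form V m \<omega>"
    and xs: "set xs \<subseteq> V" "length xs = m" and "n \<le> m" "\<And>i. i < m \<Longrightarrow> y i \<in> V"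
  shows "\<omega> (map (\<lambda>i. if i < n then (\<Sum>j<m. a i j *\<^sub>R xs ! j) else y i) [0..<m]) =
    (\<Sum>f\<in>{..<n} \<rightarrow>\<^sub>E {..<m}. (\<Prod>i<n. a i (f i)) * \<omega> (map (\<lambda>i. if i < n then xs ! f i else y i) [0..<m]))"
  using assms(5,6)
proof (induction n arbitrary: y)
  case 0
  then show ?case by simp
next
  case (Suc n)
  let ?z = "\<lambda>i. \<Sum>j<m. a i j *\<^sub>R xs ! j"
  let ?L = "map (\<lambda>i. if i < n then ?z i else y i) [0..<m]"
  have xV: "xs ! j \<in> V" if "j < m" for j
    using that xs by auto
  have zV: "?z i \<in> V" for i
    using xV by (intro subspace_sum[OF V] subspace_scale[OF V]) auto
  have LV: "set ?L \<subseteq> V" using zV Suc by auto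
  have upd: "map (\<lambda>i. if i < Suc n then ?z i else y i) [0..<m] = ?L[n := ?z n]"
    using Suc by (intro nth_equalityI) (auto simp: nth_list_update less_Suc_eq)
  have "\<omega> (map (\<lambda>i. if i < Suc n then ?z i else y i) [0..<m]) = (\<Sum>j<m. a n j *\<^sub>R \<omega> (?L[n := xs ! j]))"
    unfolding upd using Suc.prems LV xV
    by (intro linear_on_set_sum[OF V alternating_form_linear[OF w]]) auto
  also have "\<dots> = (\<Sum>j<m. \<Sum>f\<in>{..<n} \<rightarrow>\<^sub>E {..<m}. a n j * ((\<Prod>i<n. a i (f i)) *
      \<omega> (map (\<lambda>i. if i < n then xs ! f i else (y(n := xs ! j)) i) [0..<m])))"
  proof (rule sum.cong)
    fix j assume "j \<in> {..<m}"
    then have j: "j < m" by simp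
    have "?L[n := xs ! j] = map (\<lambda>i. if i < n then ?z i else (y(n := xs ! j)) i) [0..<m]"
      using Suc.prems by (intro nth_equalityI) (auto simp: nth_list_update)
    moreover have "(y(n := xs ! j)) i \<in> V" if "i < m" for i
      using that j xV Suc.prems by auto
    ultimately show "a n j *\<^sub>R \<omega> (?L[n := xs ! j]) = (\<Sum>f\<in>{..<n} \<rightarrow>\<^sub>E {..<m}. a n j * ((\<Prod>i<n. a i (f i)) *
      \<omega> (map (\<lambda>i. if i < n then xs ! f i else (y(n := xs ! j)) i) [0..<m])))"
      using Suc.IH[of "y(n := xs ! j)"] Suc.prems by (simp add: sum_distrib_left)
  qed simp
  also have "\<dots> = (\<Sum>(j, f)\<in>{..<m} \<times> ({..<n} \<rightarrow>\<^sub>E {..<m}). (\<Prod>i<Suc n. a i ((f(n := j)) i)) *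
      \<omega> (map (\<lambda>i. if i < Suc n then xs ! ((f(n := j)) i) else y i) [0..<m]))"
    unfolding sum.cartesian_product
  proof (rule sum.cong, simp, clarify)
    fix j f
    have "map (\<lambda>i. if i < n then xs ! f i else (y(n := xs ! j)) i) [0..<m] =
        map (\<lambda>i. if i < Suc n then xs ! ((f(n := j)) i) else y i) [0..<m]"
      by (auto simp: less_Suc_eq)
    moreover have "(\<Prod>i<Suc n. a i ((f(n := j)) i)) = a n j * (\<Prod>i<n. a i (f i))"
      by simp
    ultimately show "a n j * ((\<Prod>i<n. a i (f i)) * \<omega> (map (\<lambda>i. if i < n then xs ! f i else (y(n := xs ! j)) i) [0..<m]))
       = (\<Prod>i<Suc n. a i ((f(n := j)) i)) * \<omega> (map (\<lambda>i. if i < Suc n then xs ! ((f(n := j)) i) else y i) [0..<m])"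
      by (simp only: mult.assoc)
  qed
  also have "\<dots> = (\<Sum>f\<in>(\<lambda>(j, f). f(n := j)) ` ({..<m} \<times> ({..<n} \<rightarrow>\<^sub>E {..<m})). (\<Prod>i<Suc n. a i (f i)) *
      \<omega> (map (\<lambda>i. if i < Suc n then xs ! f i else y i) [0..<m]))"
    by (subst sum.reindex[OF inj_combinator]) (simp_all only: lessThan_iff less_irrefl not_False_eq_True o_def case_prod_unfold)
  also have "(\<lambda>(j, f). f(n := j)) ` ({..<m} \<times> ({..<n} \<rightarrow>\<^sub>E {..<m})) = {..<Suc n} \<rightarrow>\<^sub>E {..<m}"
    unfolding lessThan_Suc PiE_insert_eq ..
  finally show ?case .
qed

text \<open>Multilinear expansion runs over all index functions. Non-injective ones repeat an entry
  and contribute nothing; the others are permutations and contribute their signs. This links the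
  determinant in \<open>same_orientation\<close> to values of forms.\<close>

theorem alternating_form_lincomb:
  assumes V: "subspace V" and w: "alternating_form V m \<omega>"
    and xs: "set xs \<subseteq> V" "length xs = m"
  shows "\<omega> (map (\<lambda>i. \<Sum>j<m. a i j *\<^sub>R xs ! j) [0..<m]) = leibniz_det m a * \<omega> xs"
proof -
  let ?P = "{\<sigma>. \<sigma> permutes {..<m}}"
  let ?F = "{..<m} \<rightarrow>\<^sub>E {..<m}"
  let ?t = "\<lambda>f. (\<Prod>i<m. a i (f i)) * \<omega> (map (\<lambda>i. xs ! f i) [0..<m])"
  have "\<omega> (map (\<lambda>i. \<Sum>j<m. a i j *\<^sub>R xs ! j) [0..<m]) =
      \<omega> (map (\<lambda>i. if i < m then (\<Sum>j<m. a i j *\<^sub>R xs ! j) else 0) [0..<m])"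
    by (intro arg_cong[where f = \<omega>] map_cong) auto
  also have "\<dots> = (\<Sum>f\<in>?F. (\<Prod>i<m. a i (f i)) * \<omega> (map (\<lambda>i. if i < m then xs ! f i else 0) [0..<m]))"
    using subspace_0[OF V] by (intro alternating_form_expand_rows[OF V w xs]) auto
  also have "\<dots> = sum ?t ?F"
    by (intro sum.cong refl arg_cong2[where f = "(*)"] arg_cong[where f = \<omega>] map_cong) auto
  also have "\<dots> = sum ?t {f \<in> ?F. inj_on f {..<m}}"
  proof (rule sum.mono_neutral_right)
    show "\<forall>f\<in>?F - {f \<in> ?F. inj_on f {..<m}}. ?t f = 0"
    proof
      fix f assume f: "f \<in> ?F - {f \<in> ?F. inj_on f {..<m}}"
      have "\<not> distinct (map (\<lambda>i. xs ! f i) [0..<m])"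
        using f by (auto simp: distinct_map inj_on_def atLeast0LessThan)
      moreover have "set (map (\<lambda>i. xs ! f i) [0..<m]) \<subseteq> V"
        using f xs by (auto simp: PiE_def Pi_def)
      ultimately show "?t f = 0"
        using alternating_form_not_distinct[OF w] by simp
    qed
  qed (auto intro!: finite_PiE)
  also have "\<dots> = (\<Sum>\<sigma>\<in>?P. ?t \<sigma>)"
  proof (rule sum.reindex_cong[where l = "\<lambda>\<sigma>. restrict \<sigma> {..<m}"])
    show "inj_on (\<lambda>\<sigma>. restrict \<sigma> {..<m}) ?P"
    proof (rule inj_onI)
      fix \<sigma> \<tau> assume "\<sigma> \<in> ?P" "\<tau> \<in> ?P" and eq: "restrict \<sigma> {..<m} = restrict \<tau> {..<m}"
      then have "\<sigma> i = \<tau> i" for i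
      proof (cases "i < m")
        case True
        then show ?thesis using fun_cong[OF eq, of i] by simp
      qed (auto simp: permutes_def)
      then show "\<sigma> = \<tau>" by blast
    qed
    show "{f \<in> ?F. inj_on f {..<m}} = (\<lambda>\<sigma>. restrict \<sigma> {..<m}) ` ?P"
    proof (intro equalityI subsetI)
      fix f assume "f \<in> {f \<in> ?F. inj_on f {..<m}}"
      then have f: "f \<in> ?F" "inj_on f {..<m}" by auto
      \<comment> \<open>Functions in \<open>?F\<close> are undefined outside the index range, while
        a permutation of that range is the identity there; \<open>?s\<close> passes from one
        convention to the other.\<close>
      let ?s = "\<lambda>i. if i < m then f i else i"
      have "f ` {..<m} = {..<m}"
        using f by (intro endo_inj_surj) auto
      then have "bij_betw ?s {..<m} {..<m}"
        using f(2) by (auto simp: bij_betw_def inj_on_def)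
      then have "?s permutes {..<m}"
        by (rule bij_imp_permutes) auto
      moreover have "f = restrict ?s {..<m}"
        using f(1) by (auto simp: restrict_def PiE_def extensional_def)
      ultimately show "f \<in> (\<lambda>\<sigma>. restrict \<sigma> {..<m}) ` ?P" by blast
    next
      fix f assume "f \<in> (\<lambda>\<sigma>. restrict \<sigma> {..<m}) ` ?P"
      then show "f \<in> {f \<in> ?F. inj_on f {..<m}}"
        by (auto simp: permutes_in_image[of _ "{..<m}", simplified] permutes_inj_on inj_on_restrict_eq split: if_splits)
    qed
    show "?t (restrict \<sigma> {..<m}) = ?t \<sigma>" for \<sigma>
      by (intro arg_cong2[where f = "(*)"] arg_cong[where f = \<omega>] map_cong prod.cong) auto
  qed
  also have "\<dots> = leibniz_det m a * \<omega> xs"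
    unfolding leibniz_det_def sum_distrib_right
    by (intro sum.cong) (auto simp: alternating_form_permute[OF V w _ xs])
  finally show ?thesis .
qed

section \<open>Properties of the Leibniz determinant\<close>

lemma leibniz_det_linear:
  assumes "i < m"
  shows "leibniz_det m (a(i := \<lambda>j. r * u j + s * v j)) = r * leibniz_det m (a(i := u)) + s * leibniz_det m (a(i := v))"
proof -
  have "(\<Prod>k<m. (a(i := w)) k (\<sigma> k)) = w (\<sigma> i) * (\<Prod>k\<in>{..<m} - {i}. a k (\<sigma> k))" for w :: "nat \<Rightarrow> real" and \<sigma>
    using assms by (simp add: prod.remove[of _ i])
  then show ?thesis
    unfolding leibniz_det_def
    by (simp add: sum_distrib_left algebra_simps flip: sum.distrib)
qed

lemma leibniz_det_equal_rows:
  assumes "p < m" "q < m" "p \<noteq> q" "a p = a q"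
  shows "leibniz_det m a = 0"
proof -
  let ?t = "Transposition.transpose p q"
  have t: "?t permutes {..<m}" using assms by (intro permutes_swap_id) auto
  have "leibniz_det m a = (\<Sum>\<sigma> | \<sigma> permutes {..<m}. of_int (sign (\<sigma> \<circ> ?t)) * (\<Prod>i<m. a i ((\<sigma> \<circ> ?t) i)))"
    unfolding leibniz_det_def by (rule sum_permutations_compose_right[OF t])
  also have "\<dots> = (\<Sum>\<sigma> | \<sigma> permutes {..<m}. - (of_int (sign \<sigma>) * (\<Prod>i<m. a i (\<sigma> i))))"
  proof (intro sum.cong refl)
    fix \<sigma> assume "\<sigma> \<in> {\<sigma>. \<sigma> permutes {..<m}}"
    then have "sign (\<sigma> \<circ> ?t) = - sign \<sigma>"
      using assms by (simp add: sign_compose permutes_imp_permutation[of "{..<m}"] permutation_swap_id sign_swap_id)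
    moreover have "(\<Prod>i<m. a i ((\<sigma> \<circ> ?t) i)) = (\<Prod>i<m. a (?t i) ((\<sigma> \<circ> ?t) i))"
      using assms(4) by (intro prod.cong) (auto simp: Transposition.transpose_def)
    moreover have "\<dots> = (\<Prod>i<m. a i (\<sigma> i))"
      using prod.permute[OF t, of "\<lambda>i. a i (\<sigma> i)"] by (simp add: o_def)
    ultimately show "of_int (sign (\<sigma> \<circ> ?t)) * (\<Prod>i<m. a i ((\<sigma> \<circ> ?t) i)) = - (of_int (sign \<sigma>) * (\<Prod>i<m. a i (\<sigma> i)))"
      by simp
  qed
  also have "\<dots> = - leibniz_det m a"
    by (simp add: leibniz_det_def sum_negf)
  finally show ?thesis by simp
qed

lemma leibniz_det_cong:
  assumes "\<And>i j. i < m \<Longrightarrow> j < m \<Longrightarrow> a i j = b i j"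
  shows "leibniz_det m a = leibniz_det m b"
  unfolding leibniz_det_def using assms
  by (intro sum.cong refl arg_cong2[where f = "(*)"] prod.cong) (auto simp: permutes_in_image[of _ "{..<m}", simplified])

text \<open>As an alternating form in its rows, which are vectors in the space of real sequences,
  the determinant itself falls under \<open>alternating_form_lincomb\<close>; multiplicativity is
  then the instance with this form.\<close>

lemma alternating_leibniz_det:
  "alternating_form (UNIV :: (nat \<Rightarrow> real) set) m (\<lambda>xs. leibniz_det m (\<lambda>i j. (xs ! i) j))"
  unfolding alternating_form_def
proof (intro conjI allI impI)
  fix xs :: "(nat \<Rightarrow> real) list" and i assume xs: "length xs = m" and i: "i < m"
  have "leibniz_det m (\<lambda>k j. (xs[i := v] ! k) j) = leibniz_det m ((\<lambda>k. xs ! k)(i := v))" for v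
    using xs i by (intro leibniz_det_cong) (auto simp: nth_list_update)
  then show "linear_on_set UNIV (\<lambda>v. leibniz_det m (\<lambda>k j. (xs[i := v] ! k) j))"
    unfolding linear_on_set_def using leibniz_det_linear[OF i]
    by (simp add: plus_fun_def scaleR_fun_def)
next
  fix xs :: "(nat \<Rightarrow> real) list" assume "length xs = m" "\<not> distinct xs"
  then obtain p q where "p < m" "q < m" "p \<noteq> q" "xs ! p = xs ! q"
    by (auto simp: distinct_conv_nth)
  then show "leibniz_det m (\<lambda>i j. (xs ! i) j) = 0"
    by (intro leibniz_det_equal_rows[of p m q]) auto
qed

lemma sum_fun_apply: "(\<Sum>j\<in>J. f j) x = (\<Sum>j\<in>J. f j x)" for f :: "'a \<Rightarrow> 'b \<Rightarrow> 'c::comm_monoid_add"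
  by (induction J rule: infinite_finite_induct) (auto simp: zero_fun_def plus_fun_def)

lemma leibniz_det_mult: "leibniz_det m (\<lambda>i k. \<Sum>j<m. a i j * b j k) = leibniz_det m a * leibniz_det m b"
proof -
  let ?w = "\<lambda>xs. leibniz_det m (\<lambda>i j. (xs ! i) j)"
  let ?b = "map b [0..<m]"
  have "?w (map (\<lambda>i. \<Sum>j<m. a i j *\<^sub>R ?b ! j) [0..<m]) = leibniz_det m a * ?w ?b"
    by (intro alternating_form_lincomb[OF subspace_UNIV alternating_leibniz_det]) auto
  moreover have "?w (map (\<lambda>i. \<Sum>j<m. a i j *\<^sub>R ?b ! j) [0..<m]) = leibniz_det m (\<lambda>i k. \<Sum>j<m. a i j * b j k)"
    by (intro leibniz_det_cong) (simp add: sum_fun_apply scaleR_fun_def)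
  moreover have "?w ?b = leibniz_det m b"
    by (intro leibniz_det_cong) simp
  ultimately show ?thesis by simp
qed

lemma leibniz_det_one: "leibniz_det m (\<lambda>i j. if i = j then 1 else 0) = 1"
proof -
  have "leibniz_det m (\<lambda>i j. if i = j then 1 else 0) = (\<Sum>\<sigma>\<in>{id}. of_int (sign \<sigma>) * (\<Prod>i<m. if i = \<sigma> i then 1 else 0))"
    unfolding leibniz_det_def
  proof (rule sum.mono_neutral_right)
    show "\<forall>\<sigma>\<in>{\<sigma>. \<sigma> permutes {..<m}} - {id}. of_int (sign \<sigma>) * (\<Prod>i<m. if i = \<sigma> i then 1 else 0) = (0::real)"
    proof
      fix \<sigma> assume s: "\<sigma> \<in> {\<sigma>. \<sigma> permutes {..<m}} - {id}"
      then obtain i where "\<sigma> i \<noteq> i" by (auto simp: fun_eq_iff)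
      with s have "i < m" by (auto simp: permutes_def)
      with \<open>\<sigma> i \<noteq> i\<close> show "of_int (sign \<sigma>) * (\<Prod>i<m. if i = \<sigma> i then 1 else 0) = (0::real)"
        by (auto intro!: prod_zero bexI[of _ i])
    qed
  qed (auto simp: permutes_id finite_permutations)
  then show ?thesis by simp
qed

lemma leibniz_det_transpose: "leibniz_det m (\<lambda>i j. a j i) = leibniz_det m a"
proof -
  have "leibniz_det m (\<lambda>i j. a j i) = (\<Sum>\<sigma> | \<sigma> permutes {..<m}. of_int (sign (inv_into UNIV \<sigma>)) * (\<Prod>i<m. a (inv_into UNIV \<sigma> i) i))"
    unfolding leibniz_det_def by (rule sum_permutations_inverse)
  also have "\<dots> = leibniz_det m a"
    unfolding leibniz_det_def
  proof (intro sum.cong refl arg_cong2[where f = "(*)"])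
    fix \<sigma> assume s: "\<sigma> \<in> {\<sigma>. \<sigma> permutes {..<m}}"
    then show "real_of_int (sign (inv_into UNIV \<sigma>)) = of_int (sign \<sigma>)"
      by (simp add: sign_inverse permutes_imp_permutation[of "{..<m}"])
    have "(\<Prod>i<m. a (inv_into UNIV \<sigma> i) i) = (\<Prod>i<m. a (inv_into UNIV \<sigma> (\<sigma> i)) (\<sigma> i))"
      using prod.permute[of \<sigma> "{..<m}" "\<lambda>i. a (inv_into UNIV \<sigma> i) i"] s by (simp add: o_def)
    then show "(\<Prod>i<m. a (inv_into UNIV \<sigma> i) i) = (\<Prod>i<m. a i (\<sigma> i))"
      using s by (simp add: permutes_inverses)
  qed
  finally show ?thesis .
qed

section \<open>Orientation of frames\<close>

lemma frame_coefficients: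
  assumes xs: "distinct xs" "independent (set xs)" and "(\<Sum>j<length xs. c j *\<^sub>R xs ! j) = 0" "j < length xs"
  shows "c j = 0"
proof -
  define u where "u = c \<circ> the_inv_into {..<length xs} ((!) xs)"
  have bij: "bij_betw ((!) xs) {..<length xs} (set xs)"
    using xs(1) by (intro bij_betw_nth) auto
  then have u: "u (xs ! j) = c j" if "j < length xs" for j
    using that by (simp add: u_def the_inv_into_f_f bij_betw_def)
  have "(\<Sum>v\<in>set xs. u v *\<^sub>R v) = (\<Sum>j<length xs. u (xs ! j) *\<^sub>R xs ! j)"
    by (rule sum.reindex_bij_betw[OF bij, symmetric])
  also have "\<dots> = 0" using assms(3) u by simp
  finally have "\<forall>v\<in>set xs. u v = 0"
    using xs(2) dependent_finite[of "set xs"] by blast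
  then have "u (xs ! j) = 0"
    using assms(4) by simp
  with u assms(4) show ?thesis by simp
qed

text \<open>Independence indexed by positions also rules out repetitions, since equal entries at two
  positions satisfy the relation with coefficients 1 and -1. Independence of the underlying set
  alone would not.\<close>

lemma frameI:
  assumes "\<And>c j. (\<Sum>j<length xs. c j *\<^sub>R xs ! j) = 0 \<Longrightarrow> j < length xs \<Longrightarrow> c j = 0"
  shows "distinct xs \<and> independent (set xs)"
proof
  show d: "distinct xs"
    unfolding distinct_conv_nth
  proof (intro allI impI notI)
    fix i j assume ij: "i < length xs" "j < length xs" "i \<noteq> j" "xs ! i = xs ! j"
    have "(\<Sum>k<length xs. (if k = i then 1 else if k = j then - 1 else 0) *\<^sub>R xs ! k)
       = (\<Sum>k\<in>{i, j}. (if k = i then 1 else if k = j then - 1 else 0) *\<^sub>R xs ! k)"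
      using ij by (intro sum.mono_neutral_right) auto
    also have "\<dots> = 0" using ij by simp
    finally show False
      using assms[of "\<lambda>k. if k = i then 1 else if k = j then - 1 else 0" i] ij by simp
  qed
  have bij: "bij_betw ((!) xs) {..<length xs} (set xs)"
    using d by (intro bij_betw_nth) auto
  show "independent (set xs)"
  proof (subst dependent_finite)
    show "\<not> (\<exists>u. (\<exists>v\<in>set xs. u v \<noteq> 0) \<and> (\<Sum>v\<in>set xs. u v *\<^sub>R v) = 0)"
      using assms[of "\<lambda>j. u (xs ! j)" for u] sum.reindex_bij_betw[OF bij, of "\<lambda>v. u v *\<^sub>R v" for u]
      by (auto simp: in_set_conv_nth)
  qed simp
qed

lemma span_list:
  assumes "v \<in> span (set xs)" "distinct xs"
  obtains c where "v = (\<Sum>j<length xs. c j *\<^sub>R xs ! j)"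
proof -
  obtain u where u: "v = (\<Sum>x\<in>set xs. u x *\<^sub>R x)"
    using assms(1) by (auto simp: span_finite)
  have "bij_betw ((!) xs) {..<length xs} (set xs)"
    using assms(2) by (intro bij_betw_nth) auto
  from sum.reindex_bij_betw[OF this, of "\<lambda>x. u x *\<^sub>R x"] u show thesis
    by (intro that[of "\<lambda>j. u (xs ! j)"]) simp
qed

lemma lincomb_compose:
  fixes xs :: "'v::real_vector list"
  assumes "\<And>i. i < m \<Longrightarrow> ys ! i = (\<Sum>j<m. a i j *\<^sub>R xs ! j)"
  shows "(\<Sum>i<m. b k i *\<^sub>R ys ! i) = (\<Sum>j<m. (\<Sum>i<m. b k i * a i j) *\<^sub>R xs ! j)"
proof -
  have "(\<Sum>i<m. b k i *\<^sub>R ys ! i) = (\<Sum>i<m. \<Sum>j<m. (b k i * a i j) *\<^sub>R xs ! j)"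
    using assms by (simp add: scaleR_sum_right)
  also have "\<dots> = (\<Sum>j<m. \<Sum>i<m. (b k i * a i j) *\<^sub>R xs ! j)"
    by (rule sum.swap)
  finally show ?thesis by (simp add: scaleR_sum_left)
qed

lemma same_orientation_refl: "same_orientation xs xs"
  unfolding same_orientation_def
proof (intro conjI exI allI impI)
  show "leibniz_det (length xs) (\<lambda>i j. if i = j then 1 else 0) > 0"
    by (simp add: leibniz_det_one)
qed (simp_all add: if_distrib[of "\<lambda>c. c *\<^sub>R _"] cong: if_cong)

lemma same_orientation_trans:
  assumes "same_orientation xs ys" "same_orientation ys zs"
  shows "same_orientation xs zs"
proof -
  let ?m = "length xs"
  obtain a b where a: "leibniz_det ?m a > 0" "\<And>i. i < ?m \<Longrightarrow> ys ! i = (\<Sum>j<?m. a i j *\<^sub>R xs ! j)"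
    and b: "leibniz_det ?m b > 0" "\<And>i. i < ?m \<Longrightarrow> zs ! i = (\<Sum>j<?m. b i j *\<^sub>R ys ! j)"
    and "length ys = ?m" "length zs = ?m"
    using assms unfolding same_orientation_def by auto
  moreover have "zs ! k = (\<Sum>j<?m. (\<Sum>i<?m. b k i * a i j) *\<^sub>R xs ! j)" if "k < ?m" for k
    using b(2)[OF that] lincomb_compose[OF a(2)] by simp
  moreover have "leibniz_det ?m (\<lambda>k j. \<Sum>i<?m. b k i * a i j) > 0"
    using a(1) b(1) by (simp add: leibniz_det_mult)
  ultimately show ?thesis
    unfolding same_orientation_def by blast
qed

text \<open>The spans agree because a vector outside the smaller one would enlarge an independent
  set beyond the size of a spanning set. Uniqueness of coefficients makes the product of the two
  matrices the identity, whence the relation between the determinants.\<close>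

lemma frame_change:
  assumes "xs \<in> frames V m" "ys \<in> frames V m" and "set ys \<subseteq> span (set xs)"
  obtains a b where "\<And>i. i < m \<Longrightarrow> ys ! i = (\<Sum>j<m. a i j *\<^sub>R xs ! j)"
    "\<And>i. i < m \<Longrightarrow> xs ! i = (\<Sum>j<m. b i j *\<^sub>R ys ! j)" "leibniz_det m b * leibniz_det m a = 1"
proof -
  have xs: "length xs = m" "distinct xs" "independent (set xs)"
    and ys: "length ys = m" "distinct ys" "independent (set ys)"
    using assms by (auto simp: frames_def)
  have "x \<in> span (set ys)" if "x \<in> set xs" for x
  proof (rule ccontr)
    assume x: "x \<notin> span (set ys)"
    then have "independent (insert x (set ys))"
      using ys by (simp add: independent_insert span_base)
    moreover have "insert x (set ys) \<subseteq> span (set xs)"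
      using that assms(3) by (auto intro: span_base)
    ultimately have "card (insert x (set ys)) \<le> card (set xs)"
      using independent_span_bound[of "set xs"] by auto
    moreover have "x \<notin> set ys" using x span_base by blast
    ultimately show False using xs ys by (simp add: distinct_card)
  qed
  then have "\<forall>i. \<exists>c. i < m \<longrightarrow> xs ! i = (\<Sum>j<m. c j *\<^sub>R ys ! j)"
    using span_list[OF _ ys(2)] ys(1) xs(1) by (metis nth_mem)
  then obtain b where b: "\<And>i. i < m \<Longrightarrow> xs ! i = (\<Sum>j<m. b i j *\<^sub>R ys ! j)"
    by metis
  have "\<forall>i. \<exists>c. i < m \<longrightarrow> ys ! i = (\<Sum>j<m. c j *\<^sub>R xs ! j)"
    using span_list[OF _ xs(2)] ys(1) xs(1) assms(3) by (metis nth_mem subsetD)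
  then obtain a where a: "\<And>i. i < m \<Longrightarrow> ys ! i = (\<Sum>j<m. a i j *\<^sub>R xs ! j)"
    by metis
  have "(\<Sum>i<m. b k i * a i j) = (if k = j then 1 else 0)" if "k < m" "j < m" for k j
  proof -
    have "(\<Sum>j<length xs. ((\<Sum>i<m. b k i * a i j) - (if k = j then 1 else 0)) *\<^sub>R xs ! j) =
        (\<Sum>j<m. (\<Sum>i<m. b k i * a i j) *\<^sub>R xs ! j) - (\<Sum>j<m. (if k = j then 1 else 0) *\<^sub>R xs ! j)"
      by (simp add: xs(1) scaleR_diff_left sum_subtractf)
    also have "\<dots> = (\<Sum>i<m. b k i *\<^sub>R ys ! i) - xs ! k"
      using that lincomb_compose[OF a, of b k] by (simp add: if_distrib[of "\<lambda>c. c *\<^sub>R _"] cong: if_cong)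
    also have "\<dots> = 0" using b that by simp
    finally have "(\<Sum>i<m. b k i * a i j) - (if k = j then 1 else 0) = 0"
      using frame_coefficients[OF xs(2,3), of "\<lambda>j. (\<Sum>i<m. b k i * a i j) - (if k = j then 1 else 0)"] that xs(1) by blast
    then show ?thesis by simp
  qed
  then have "leibniz_det m (\<lambda>k j. \<Sum>i<m. b k i * a i j) = leibniz_det m (\<lambda>i j. if i = j then 1 else 0)"
    by (intro leibniz_det_cong) auto
  then have "leibniz_det m b * leibniz_det m a = 1"
    by (simp add: leibniz_det_mult leibniz_det_one)
  with a b show thesis by (rule that)
qed

lemma lincomb_in_span: "(\<Sum>j<length xs. c j *\<^sub>R xs ! j) \<in> span (set xs)"
  by (intro span_sum span_scale span_base) auto

lemma same_orientation_span:
  assumes "same_orientation xs ys"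
  shows "set ys \<subseteq> span (set xs)"
  using assms lincomb_in_span[of _ xs] unfolding same_orientation_def by (auto simp: in_set_conv_nth)

text \<open>Coefficients relative to a frame are unique, so the given matrix of positive determinant
  is the very matrix that \<open>frame_change\<close> inverts.\<close>

lemma same_orientation_sym:
  assumes "xs \<in> frames V m" "ys \<in> frames V m" "same_orientation xs ys"
  shows "same_orientation ys xs"
proof -
  obtain a where a: "leibniz_det m a > 0" "\<And>i. i < m \<Longrightarrow> ys ! i = (\<Sum>j<m. a i j *\<^sub>R xs ! j)"
    using assms by (auto simp: same_orientation_def frames_def)
  obtain a' b where a': "\<And>i. i < m \<Longrightarrow> ys ! i = (\<Sum>j<m. a' i j *\<^sub>R xs ! j)"
    and b: "\<And>i. i < m \<Longrightarrow> xs ! i = (\<Sum>j<m. b i j *\<^sub>R ys ! j)" and d: "leibniz_det m b * leibniz_det m a' = 1"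
    using frame_change[OF assms(1,2) same_orientation_span[OF assms(3)]] by metis
  have xs: "length xs = m" "distinct xs" "independent (set xs)" "length ys = m"
    using assms by (auto simp: frames_def)
  have "a i j - a' i j = 0" if "i < m" "j < m" for i j
  proof (rule frame_coefficients[OF xs(2,3)])
    show "(\<Sum>j<length xs. (a i j - a' i j) *\<^sub>R xs ! j) = 0"
      using a(2) a' that by (simp add: xs(1) scaleR_diff_left sum_subtractf)
  qed (use that xs in auto)
  then have "leibniz_det m a = leibniz_det m a'"
    by (intro leibniz_det_cong) auto
  with a d have "leibniz_det m b > 0"
    by (metis zero_less_mult_pos2 zero_less_one)
  with b xs show ?thesis
    by (auto simp: same_orientation_def)
qed

section \<open>Oriented planes\<close>

definition plane_of :: "'v::real_vector set \<Rightarrow> 'v list \<Rightarrow> 'v list set" where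
  "plane_of V xs = {ys \<in> frames V (length xs). same_orientation xs ys}"

lemma oriented_planes_eq: "oriented_planes V m = plane_of V ` frames V m"
  unfolding oriented_planes_def quotient_def plane_of_def by (auto simp: frames_def)

lemma plane_of_self: "xs \<in> frames V m \<Longrightarrow> xs \<in> plane_of V xs"
  by (auto simp: plane_of_def frames_def same_orientation_refl)

lemma plane_of_eq_iff:
  assumes "xs \<in> frames V m" "ys \<in> frames V m"
  shows "plane_of V xs = plane_of V ys \<longleftrightarrow> same_orientation xs ys"
proof
  assume "plane_of V xs = plane_of V ys"
  then have "ys \<in> plane_of V xs"
    using plane_of_self[OF assms(2)] by (simp only:)
  then show "same_orientation xs ys" by (simp add: plane_of_def)
next
  assume "same_orientation xs ys"
  moreover from this have "same_orientation ys xs"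
    using same_orientation_sym assms by blast
  moreover have "length xs = length ys" using assms by (simp add: frames_def)
  ultimately show "plane_of V xs = plane_of V ys"
    using same_orientation_trans by (auto simp: plane_of_def)
qed

lemma orthonormal_frames:
  assumes V: "subspace V" and g: "inner_product_on V g" and xs: "set xs \<subseteq> V" "orthonormal g xs"
  shows "xs \<in> frames V (length xs)"
proof -
  have "c i = 0" if 0: "(\<Sum>j<length xs. c j *\<^sub>R xs ! j) = 0" and i: "i < length xs" for c i
  proof -
    have lin: "linear_on_set V (g (xs ! i))"
      using g subsetD[OF xs(1) nth_mem[OF i]] by (simp add: inner_product_on_def)
    have "g (xs ! i) (\<Sum>j<length xs. c j *\<^sub>R xs ! j) = (\<Sum>j<length xs. c j *\<^sub>R g (xs ! i) (xs ! j))"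
      using xs by (intro linear_on_set_sum[OF V lin]) auto
    also have "\<dots> = (\<Sum>j<length xs. if j = i then c j else 0)"
      using xs i by (intro sum.cong) (auto simp: orthonormal_def)
    also have "\<dots> = c i" using i by simp
    also have "g (xs ! i) (\<Sum>j<length xs. c j *\<^sub>R xs ! j) = 0"
      unfolding 0 using linear_on_set_sum[OF V lin, of "{}"] by simp
    finally show ?thesis by simp
  qed
  then show ?thesis
    using frameI[of xs] xs(1) unfolding frames_def by blast
qed

lemma alternating_form_same_orientation:
  assumes V: "subspace V" and w: "alternating_form V m \<omega>" and xs: "xs \<in> frames V m"
    and ys: "\<And>i. i < m \<Longrightarrow> ys ! i = (\<Sum>j<m. a i j *\<^sub>R xs ! j)" "length ys = m"
  shows "\<omega> ys = leibniz_det m a * \<omega> xs"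
proof -
  have "ys = map (\<lambda>i. \<Sum>j<m. a i j *\<^sub>R xs ! j) [0..<m]"
    using ys by (intro nth_equalityI) auto
  then show ?thesis
    using alternating_form_lincomb[OF V w, of xs] xs by (simp add: frames_def)
qed

text \<open>The coefficient matrix times its transpose is the matrix of inner products of
  \<open>ys\<close>, that is, the identity.\<close>

lemma orthonormal_change_det:
  assumes V: "subspace V" and g: "inner_product_on V g"
    and xs: "set xs \<subseteq> V" "orthonormal g xs" "length xs = m" and ys: "orthonormal g ys" "length ys = m"
    and a: "\<And>i. i < m \<Longrightarrow> ys ! i = (\<Sum>j<m. a i j *\<^sub>R xs ! j)"
  shows "leibniz_det m a * leibniz_det m a = 1"
proof -
  have xV: "xs ! i \<in> V" if "i < m" for i using that xs by auto
  have yV: "ys ! i \<in> V" if "i < m" for i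
    unfolding a[OF that] using xV by (intro subspace_sum[OF V] subspace_scale[OF V]) auto
  have lin: "linear_on_set V (g v)" if "v \<in> V" for v
    using g that by (simp add: inner_product_on_def)
  have sym: "g v w = g w v" if "v \<in> V" "w \<in> V" for v w
    using g that by (simp add: inner_product_on_def)
  have "(\<Sum>k<m. a i k * a j k) = (if i = j then 1 else 0)" if ij: "i < m" "j < m" for i j
  proof -
    have 1: "g (ys ! i) (xs ! k) = a i k" if "k < m" for k
    proof -
      have "g (ys ! i) (xs ! k) = g (xs ! k) (\<Sum>l<m. a i l *\<^sub>R xs ! l)"
        using sym xV yV that ij a by metis
      also have "\<dots> = (\<Sum>l<m. a i l *\<^sub>R g (xs ! k) (xs ! l))"
        using xV that by (intro linear_on_set_sum[OF V lin]) auto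
      also have "\<dots> = (\<Sum>l<m. if l = k then a i l else 0)"
        using xs(2,3) that by (intro sum.cong) (auto simp: orthonormal_def)
      finally show ?thesis using that by simp
    qed
    have "g (ys ! i) (ys ! j) = (\<Sum>k<m. a j k *\<^sub>R g (ys ! i) (xs ! k))"
      unfolding a[OF ij(2)] using xV yV ij by (intro linear_on_set_sum[OF V lin]) auto
    then show ?thesis
      using ys ij 1 by (simp add: orthonormal_def mult.commute)
  qed
  then have "leibniz_det m (\<lambda>i j. \<Sum>k<m. a i k * a j k) = leibniz_det m (\<lambda>i j. if i = j then 1 else 0)"
    by (intro leibniz_det_cong) auto
  moreover have "leibniz_det m (\<lambda>i j. \<Sum>k<m. a i k * a j k) = leibniz_det m a * leibniz_det m a"
    using leibniz_det_mult[of m a "\<lambda>k j. a j k"] by (simp only: leibniz_det_transpose[of m a])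
  ultimately show ?thesis by (simp add: leibniz_det_one)
qed

lemma length_four_cases:
  assumes "length xs = 4"
  obtains a b c d where "xs = [a, b, c, d]"
  using assms by (auto simp: numeral_eq_Suc length_Suc_conv)

section \<open>Isometries with the model\<close>

text \<open>Such maps stand for adapted frames, the frame being the image of the standard basis.
  Automorphisms of the model act by precomposition and elements of the group on \<open>V\<close> by
  postcomposition.\<close>

definition cayley_iso ::
    "'v::real_vector set \<Rightarrow> ('v \<Rightarrow> 'v \<Rightarrow> real) \<Rightarrow> ('v list \<Rightarrow> real) \<Rightarrow> (oct \<Rightarrow> 'v) \<Rightarrow> bool" where
  "cayley_iso V g \<phi> T \<longleftrightarrow> linear T \<and> bij_betw T UNIV V \<and> (\<forall>x y. g (T x) (T y) = x \<bullet> y) \<and>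
     (\<forall>x y z w. \<phi> [T x, T y, T z, T w] = cayley x y z w)"

lemma cayley_iso_comp:
  assumes "cayley_iso V g \<phi> T" "cayley_auto M"
  shows "cayley_iso V g \<phi> (T \<circ> M)"
proof -
  have M: "linear M" "bij M" "\<And>x y. M x \<bullet> M y = x \<bullet> y"
    using assms(2) orthogonal_transformation_bij unfolding cayley_auto_def orthogonal_transformation_def by blast+
  have "bij_betw (T \<circ> M) UNIV V"
    using assms(1) M(2) by (auto simp: cayley_iso_def intro: bij_betw_trans)
  moreover have "linear (T \<circ> M)"
    using assms(1) M(1) by (auto simp: cayley_iso_def intro: linear_compose)
  ultimately show ?thesis
    using assms M(3) unfolding cayley_iso_def cayley_auto_def o_def by metis
qed

definition std4 :: "oct list" where "std4 = [(1,0), (qi,0), (qj,0), (qk,0)]"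

lemma length_std4 [simp]: "length std4 = 4" by (simp add: std4_def)

locale cayley_space =
  fixes V :: "'v::real_vector set" and g \<phi>
  assumes g: "inner_product_on V g" and alt: "alternating_form V 4 \<phi>"
    and subV: "subspace V" and ex_iso: "\<exists>T. cayley_iso V g \<phi> T"
begin

abbreviation iso :: "(oct \<Rightarrow> 'v) \<Rightarrow> bool" where "iso \<equiv> cayley_iso V g \<phi>"

lemma isoD:
  assumes "iso T"
  shows "linear T" "bij_betw T UNIV V" "inj T" "range T = V" "\<And>x. T x \<in> V"
    "\<And>x y. g (T x) (T y) = x \<bullet> y" "\<And>x y z w. \<phi> [T x, T y, T z, T w] = cayley x y z w"
  using assms by (auto simp: cayley_iso_def bij_betw_def)

lemma iso_inv:
  assumes "iso T"
  shows "v \<in> V \<Longrightarrow> T (inv_into UNIV T v) = v" "inv_into UNIV T (T x) = x"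
  using isoD(3,4)[OF assms] by (auto simp: f_inv_into_f)

lemma orthonormal_map:
  assumes "iso T"
  shows "orthonormal g (map T us) \<longleftrightarrow> orthonormal (\<bullet>) us"
  using isoD(6)[OF assms] by (auto simp: orthonormal_def)

lemma lift_list:
  assumes "iso T" "set xs \<subseteq> V"
  obtains us where "xs = map T us"
proof
  have "map (T \<circ> inv_into UNIV T) xs = xs"
    using assms(2) iso_inv(1)[OF assms(1)] by (intro map_idI) auto
  then show "xs = map T (map (inv_into UNIV T) xs)" by simp
qed

text \<open>Guarantees that the choice in \<open>plane_value\<close> has something to choose from.
  The orthonormal basis is found in the Euclidean model and carried over by an isomorphism.\<close>

lemma exists_orthonormal:
  assumes "xs \<in> frames V 4"
  obtains ys where "ys \<in> frames V 4" "orthonormal g ys" "same_orientation xs ys"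
proof -
  obtain T where T: "iso T" using ex_iso by blast
  have xs: "set xs \<subseteq> V" "length xs = 4" "distinct xs" "independent (set xs)"
    using assms by (auto simp: frames_def)
  obtain us where us: "xs = map T us" using lift_list[OF T xs(1)] .
  have "c j = 0" if "(\<Sum>j<length us. c j *\<^sub>R us ! j) = 0" "j < length us" for c j
  proof (rule frame_coefficients[OF xs(3,4)])
    have "(\<Sum>j<length us. c j *\<^sub>R T (us ! j)) = T (\<Sum>j<length us. c j *\<^sub>R us ! j)"
      using isoD(1)[OF T] by (simp add: linear_sum linear_scale)
    then show "(\<Sum>j<length xs. c j *\<^sub>R xs ! j) = 0"
      using that linear_0[OF isoD(1)[OF T]] by (simp add: us)
  qed (use that us in simp)
  then have indep: "independent (set us)" and "distinct us"
    using frameI[of us] by blast+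
  have "dim (span (set us)) = 4"
    using indep \<open>distinct us\<close> xs(2) us by (simp add: dim_eq_card_independent distinct_card)
  then obtain B where B: "B \<subseteq> span (set us)" "pairwise orthogonal B" "\<And>x. x \<in> B \<Longrightarrow> norm x = 1"
      "independent B" "card B = 4"
    using orthonormal_basis_subspace[OF subspace_span, of "set us"] by metis
  then obtain bs where bs: "set bs = B" "distinct bs" "length bs = 4"
    using finite_distinct_list[of B] by (metis card.infinite distinct_card zero_neq_numeral)
  have bs_orth: "orthonormal (\<bullet>) bs"
    unfolding orthonormal_def
  proof (intro allI impI)
    fix i j assume ij: "i < length bs" "j < length bs"
    show "bs ! i \<bullet> bs ! j = (if i = j then 1 else 0)"
    proof (cases "i = j")
      case True
      then show ?thesis using B(3)[of "bs ! i"] ij bs(1) nth_mem[of i bs] by (auto simp: norm_eq_1)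
    next
      case False
      then have "bs ! i \<noteq> bs ! j" using bs(2) ij nth_eq_iff_index_eq by blast
      then show ?thesis using B(2) ij bs(1) False by (auto simp: pairwise_def orthogonal_def)
    qed
  qed
  define ys where "ys = map T bs"
  have ys: "orthonormal g ys" "set ys \<subseteq> V" "length ys = 4"
    using bs_orth isoD(5)[OF T] bs(3) by (auto simp: ys_def orthonormal_map[OF T])
  then have ysf: "ys \<in> frames V 4"
    using orthonormal_frames[OF subV g ys(2,1)] by simp
  have "set ys \<subseteq> span (set xs)"
    using B(1) bs(1) linear_span_image[OF isoD(1)[OF T]] by (auto simp: ys_def us)
  then obtain a b where a: "\<And>i. i < 4 \<Longrightarrow> ys ! i = (\<Sum>j<4. a i j *\<^sub>R xs ! j)"
    and ab: "leibniz_det 4 b * leibniz_det 4 a = 1"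
    using frame_change[OF assms ysf] by metis
  show thesis
  proof (cases "leibniz_det 4 a > 0")
    case True
    then show thesis
      using a xs ys by (intro that[OF ysf ys(1)]) (auto simp: same_orientation_def)
  next
    case False
    \<comment> \<open>The determinant is nonzero because \<open>ab\<close> makes it invertible, so
      here it is negative; reversing one vector corrects the orientation and keeps
      orthonormality.\<close>
    define zs where "zs = ys[0 := - ys ! 0]"
    define a' where "a' = a(0 := \<lambda>j. - a 0 j)"
    have "leibniz_det 4 a' = - leibniz_det 4 a"
      using leibniz_det_linear[of 0 4 a "-1" "a 0" 0 "a 0"] by (simp add: a'_def)
    then have "leibniz_det 4 a' > 0"
      using False ab by (metis linorder_neqE_linordered_idom mult_zero_right neg_0_less_iff_less zero_neq_one)
    moreover have "zs ! i = (\<Sum>j<4. a' i j *\<^sub>R xs ! j)" if "i < 4" for i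
      using a[OF that] ys(3) that by (auto simp: zs_def a'_def nth_list_update sum_negf)
    moreover have len: "length zs = 4" using ys by (simp add: zs_def)
    ultimately have so: "same_orientation xs zs"
      using xs by (auto simp: same_orientation_def)
    define cs where "cs = bs[0 := - bs ! 0]"
    have zs_cs: "zs = map T cs"
      using linear_neg[OF isoD(1)[OF T]] bs(3) by (simp add: zs_def cs_def ys_def map_update)
    have "orthonormal (\<bullet>) cs"
      using bs_orth bs(3) by (auto simp: orthonormal_def cs_def nth_list_update)
    then have "orthonormal g zs" by (simp add: zs_cs orthonormal_map[OF T])
    moreover from this have "zs \<in> frames V 4"
      using orthonormal_frames[OF subV g, of zs] len isoD(5)[OF T]
      by (simp add: zs_cs image_subset_iff)
    ultimately show thesis using so by (intro that)
  qed
qed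

text \<open>The change matrix has determinant of square 1 and of positive sign, hence 1. Therefore
  \<open>plane_value\<close> does not depend on the basis that is chosen.\<close>

lemma form_same_orientation:
  assumes "xs \<in> frames V 4" "orthonormal g xs" "ys \<in> frames V 4" "orthonormal g ys" "same_orientation xs ys"
  shows "\<phi> ys = \<phi> xs"
proof -
  have len: "length xs = 4" "length ys = 4" "set xs \<subseteq> V" using assms by (auto simp: frames_def)
  obtain a where a: "leibniz_det 4 a > 0" "\<And>i. i < 4 \<Longrightarrow> ys ! i = (\<Sum>j<4. a i j *\<^sub>R xs ! j)"
    using assms(5) len by (auto simp: same_orientation_def)
  have "leibniz_det 4 a * leibniz_det 4 a = 1"
    using len by (intro orthonormal_change_det[OF subV g _ assms(2) _ assms(4)] a) auto
  with a(1) have "leibniz_det 4 a = 1"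
    by (simp add: square_eq_1_iff)
  then show ?thesis
    using alternating_form_same_orientation[OF subV alt assms(1) a(2) len(2)] by simp
qed

lemma plane_value_eq:
  assumes "xs \<in> frames V 4" "orthonormal g xs"
  shows "plane_value g \<phi> (plane_of V xs) = \<phi> xs"
proof -
  let ?ys = "SOME ys. ys \<in> plane_of V xs \<and> orthonormal g ys"
  have "?ys \<in> plane_of V xs \<and> orthonormal g ?ys"
    using plane_of_self[OF assms(1)] assms(2) by (intro someI) blast
  then show ?thesis
    using assms form_same_orientation[OF assms, of ?ys]
    by (auto simp: plane_value_def plane_of_def frames_def)
qed

lemma plane_orthonormal:
  assumes "\<xi> \<in> oriented_planes V 4"
  obtains xs where "xs \<in> frames V 4" "orthonormal g xs" "\<xi> = plane_of V xs"
proof -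
  obtain xs where xs: "xs \<in> frames V 4" "\<xi> = plane_of V xs"
    using assms by (auto simp: oriented_planes_eq)
  obtain ys where "ys \<in> frames V 4" "orthonormal g ys" "same_orientation xs ys"
    using exists_orthonormal[OF xs(1)] .
  then show thesis
    using that plane_of_eq_iff[OF xs(1)] xs(2) by metis
qed

lemma orthonormal_oct4:
  "orthonormal (\<bullet>) [a, b, c, d :: oct] \<longleftrightarrow> a \<bullet> a = 1 \<and> b \<bullet> b = 1 \<and> c \<bullet> c = 1 \<and> d \<bullet> d = 1 \<and>
     a \<bullet> b = 0 \<and> a \<bullet> c = 0 \<and> a \<bullet> d = 0 \<and> b \<bullet> c = 0 \<and> b \<bullet> d = 0 \<and> c \<bullet> d = 0"
  by (auto simp: orthonormal_def numeral_eq_Suc All_less_Suc inner_commute)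

lemma calibration:
  assumes "\<xi> \<in> oriented_planes V 4"
  shows "plane_value g \<phi> \<xi> \<le> 1"
proof -
  obtain T where T: "iso T" using ex_iso by blast
  obtain xs where xs: "xs \<in> frames V 4" "orthonormal g xs" "\<xi> = plane_of V xs"
    using plane_orthonormal[OF assms] .
  obtain us where us: "xs = map T us"
    using lift_list[OF T] xs(1) by (auto simp: frames_def)
  with xs(1) have "length us = 4" by (simp add: frames_def)
  then obtain a b c d where [simp]: "us = [a, b, c, d]" by (rule length_four_cases)
  have "orthonormal (\<bullet>) [a, b, c, d]"
    using xs(2) unfolding us orthonormal_map[OF T] by simp
  then show ?thesis
    using plane_value_eq[OF xs(1,2)] isoD(7)[OF T] cayley_le_1(1) xs(3)
    by (simp add: us orthonormal_oct4)
qed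

lemma std4_frame:
  assumes "iso T"
  shows "map T std4 \<in> frames V 4" "orthonormal g (map T std4)" "\<phi> (map T std4) = 1"
proof -
  show *: "orthonormal g (map T std4)"
    unfolding orthonormal_map[OF assms] by (simp add: std4_def orthonormal_oct4 inner_quat_def)
  show "map T std4 \<in> frames V 4"
    using orthonormal_frames[OF subV g _ *] isoD(5)[OF assms] by (simp add: image_subset_iff)
  show "\<phi> (map T std4) = 1"
    by (simp add: std4_def isoD(7)[OF assms] cayley_def qvol_coord qform_coord)
qed

abbreviation contact :: "'v list set set" where
  "contact \<equiv> {\<xi> \<in> oriented_planes V 4. plane_value g \<phi> \<xi> = 1}"

text \<open>On a contact plane the form takes the value 1 on any positive orthonormal frame, and
  \<open>cayley_frame_transport\<close> extends that frame to an adapted one. All contact planes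
  thus come from the one plane spanned by \<open>std4\<close>, which makes transitivity a matter of
  composing isomorphisms.\<close>

lemma contact_eq: "contact = (\<lambda>T. plane_of V (map T std4)) ` Collect iso"
proof (intro equalityI subsetI)
  fix \<xi> assume "\<xi> \<in> contact"
  then have \<xi>: "\<xi> \<in> oriented_planes V 4" "plane_value g \<phi> \<xi> = 1" by auto
  obtain T where T: "iso T" using ex_iso by blast
  obtain xs where xs: "xs \<in> frames V 4" "orthonormal g xs" "\<xi> = plane_of V xs"
    using plane_orthonormal[OF \<xi>(1)] .
  obtain us where us: "xs = map T us"
    using lift_list[OF T] xs(1) by (auto simp: frames_def)
  with xs(1) have "length us = 4" by (simp add: frames_def)
  then obtain a b c d where [simp]: "us = [a, b, c, d]" by (rule length_four_cases)
  have o: "orthonormal (\<bullet>) [a, b, c, d]"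
    using xs(2) unfolding us orthonormal_map[OF T] by simp
  have "cayley a b c d = 1"
    using plane_value_eq[OF xs(1,2)] isoD(7)[OF T] \<xi>(2) xs(3) by (simp add: us)
  with o obtain L where "cayley_auto L" "L (1,0) = a" "L (qi,0) = b" "L (qj,0) = c" "L (qk,0) = d"
    using cayley_frame_transport[of a b c d] by (auto simp: orthonormal_oct4)
  then have "iso (T \<circ> L)" "map (T \<circ> L) std4 = xs"
    using cayley_iso_comp[OF T] by (simp_all add: std4_def us)
  then show "\<xi> \<in> (\<lambda>T. plane_of V (map T std4)) ` Collect iso"
    using xs(3) by (intro image_eqI[of _ _ "T \<circ> L"]) auto
next
  fix \<xi> assume "\<xi> \<in> (\<lambda>T. plane_of V (map T std4)) ` Collect iso"
  then obtain T where T: "iso T" "\<xi> = plane_of V (map T std4)" by auto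
  then show "\<xi> \<in> contact"
    using std4_frame[OF T(1)] plane_value_eq by (auto simp: oriented_planes_eq)
qed

end

section \<open>Self-duality and orientation\<close>

text \<open>Parseval's identity collapses the double expansion of \<open>b u u\<close> in the
  standard basis to its diagonal. It serves to replace the unspecified orthonormal basis in
  \<open>hodge_star\<close> by the standard one.\<close>

lemma orthonormal_trace:
  fixes b :: "'a::euclidean_space \<Rightarrow> 'a \<Rightarrow> real"
  assumes b: "bilinear b" and U: "finite U" "span U = UNIV" "pairwise orthogonal U" "\<And>u. u \<in> U \<Longrightarrow> norm u = 1"
  shows "(\<Sum>u\<in>U. b u u) = (\<Sum>e\<in>Basis. b e e)"
proof -
  have expand: "(\<Sum>u\<in>U. (x \<bullet> u) *\<^sub>R u) = x" for x
    using U by (intro orthonormal_basis_expand) auto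
  have parseval: "(\<Sum>u\<in>U. (u \<bullet> x) * (u \<bullet> y)) = x \<bullet> y" for x y
  proof -
    have "x \<bullet> y = (\<Sum>u\<in>U. (x \<bullet> u) *\<^sub>R u) \<bullet> y" by (simp only: expand)
    then have "x \<bullet> y = (\<Sum>u\<in>U. (x \<bullet> u) * (u \<bullet> y))" by (simp add: inner_sum_left)
    also have "\<dots> = (\<Sum>u\<in>U. (u \<bullet> x) * (u \<bullet> y))" by (simp only: inner_commute[of x])
    finally show ?thesis ..
  qed
  have "b u u = (\<Sum>d\<in>Basis. \<Sum>e\<in>Basis. (u \<bullet> d) * (u \<bullet> e) * b d e)" for u
  proof -
    have "b u u = b (\<Sum>d\<in>Basis. (u \<bullet> d) *\<^sub>R d) (\<Sum>e\<in>Basis. (u \<bullet> e) *\<^sub>R e)"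
      by (simp add: euclidean_representation)
    also have "\<dots> = (\<Sum>(d, e)\<in>Basis \<times> Basis. b ((u \<bullet> d) *\<^sub>R d) ((u \<bullet> e) *\<^sub>R e))"
      by (rule bilinear_sum[OF b])
    also have "\<dots> = (\<Sum>d\<in>Basis. \<Sum>e\<in>Basis. (u \<bullet> d) * (u \<bullet> e) * b d e)"
      using b by (simp add: sum.cartesian_product bilinear_lmul bilinear_rmul mult.assoc)
    finally show ?thesis .
  qed
  then have "(\<Sum>u\<in>U. b u u) = (\<Sum>u\<in>U. \<Sum>d\<in>Basis. \<Sum>e\<in>Basis. (u \<bullet> d) * (u \<bullet> e) * b d e)"
    by simp
  also have "\<dots> = (\<Sum>d\<in>Basis. \<Sum>e\<in>Basis. \<Sum>u\<in>U. (u \<bullet> d) * (u \<bullet> e) * b d e)"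
    by (subst sum.swap) (intro sum.cong refl sum.swap)
  also have "\<dots> = (\<Sum>d\<in>Basis. \<Sum>e\<in>Basis. (d \<bullet> e) * b d e)"
    by (simp only: parseval flip: sum_distrib_right)
  also have "\<dots> = (\<Sum>d\<in>Basis. \<Sum>e\<in>Basis. if e = d then b d e else 0)"
    by (intro sum.cong refl) (auto simp: inner_Basis)
  finally show ?thesis by simp
qed

lemma sum_lists_four:
  assumes "finite S"
  shows "(\<Sum>I | set I \<subseteq> S \<and> length I = 4. f I) = (\<Sum>a\<in>S. \<Sum>b\<in>S. \<Sum>c\<in>S. \<Sum>d\<in>S. f [a, b, c, d])"
proof -
  have "(\<Sum>a\<in>S. \<Sum>b\<in>S. \<Sum>c\<in>S. \<Sum>d\<in>S. f [a, b, c, d]) = (\<Sum>(a, b, c, d)\<in>S \<times> S \<times> S \<times> S. f [a, b, c, d])"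
    by (simp add: sum.cartesian_product)
  also have "\<dots> = (\<Sum>I | set I \<subseteq> S \<and> length I = 4. f I)"
  proof (rule sum.reindex_bij_witness[of _ "\<lambda>I. (I ! 0, I ! 1, I ! 2, I ! 3)" "\<lambda>(a, b, c, d). [a, b, c, d]"])
    fix I assume I: "I \<in> {I. set I \<subseteq> S \<and> length I = 4}"
    then obtain a b c d where "I = [a, b, c, d]" using length_four_cases by blast
    with I show "(case (I ! 0, I ! 1, I ! 2, I ! 3) of (a, b, c, d) \<Rightarrow> [a, b, c, d]) = I"
      "(I ! 0, I ! 1, I ! 2, I ! 3) \<in> S \<times> S \<times> S \<times> S"
      by auto
  qed auto
  finally show ?thesis ..
qed

lemma sum_change_four:
  fixes G :: "'a \<Rightarrow> 'a \<Rightarrow> 'a \<Rightarrow> 'a \<Rightarrow> real"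
  assumes "\<And>b c d. (\<Sum>a\<in>U. G a b c d) = (\<Sum>a\<in>B. G a b c d)" "\<And>a c d. (\<Sum>b\<in>U. G a b c d) = (\<Sum>b\<in>B. G a b c d)"
    "\<And>a b d. (\<Sum>c\<in>U. G a b c d) = (\<Sum>c\<in>B. G a b c d)" "\<And>a b c. (\<Sum>d\<in>U. G a b c d) = (\<Sum>d\<in>B. G a b c d)"
  shows "(\<Sum>a\<in>U. \<Sum>b\<in>U. \<Sum>c\<in>U. \<Sum>d\<in>U. G a b c d) = (\<Sum>a\<in>B. \<Sum>b\<in>B. \<Sum>c\<in>B. \<Sum>d\<in>B. G a b c d)"
proof -
  have two: "(\<Sum>x\<in>U. \<Sum>y\<in>U. H x y) = (\<Sum>x\<in>B. \<Sum>y\<in>B. H x y)"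
    if "\<And>y. (\<Sum>x\<in>U. H x y) = (\<Sum>x\<in>B. H x y)" "\<And>x. (\<Sum>y\<in>U. H x y) = (\<Sum>y\<in>B. H x y)"
    for H :: "'a \<Rightarrow> 'a \<Rightarrow> real"
    unfolding that(2) by (subst (1 2) sum.swap) (simp only: that(1))
  have inner: "(\<Sum>c\<in>U. \<Sum>d\<in>U. G a b c d) = (\<Sum>c\<in>B. \<Sum>d\<in>B. G a b c d)" for a b
    by (intro two assms)
  have pull: "(\<Sum>x\<in>X. \<Sum>c\<in>B. \<Sum>d\<in>B. F x c d) = (\<Sum>c\<in>B. \<Sum>d\<in>B. \<Sum>x\<in>X. F x c d)"
    for X and F :: "'a \<Rightarrow> 'a \<Rightarrow> 'a \<Rightarrow> real"
    by (subst sum.swap) (intro sum.cong refl sum.swap)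
  have outer: "(\<Sum>x\<in>U. \<Sum>c\<in>B. \<Sum>d\<in>B. F x c d) = (\<Sum>x\<in>B. \<Sum>c\<in>B. \<Sum>d\<in>B. F x c d)"
    if "\<And>c d. (\<Sum>x\<in>U. F x c d) = (\<Sum>x\<in>B. F x c d)" for F :: "'a \<Rightarrow> 'a \<Rightarrow> 'a \<Rightarrow> real"
    using pull[of F U] pull[of F B] that by simp
  show ?thesis
    unfolding inner by (rule two; rule outer; rule assms)
qed

text \<open>Terms with a repeated index vanish and the other 4! = 24 are equal; this factor cancels
  the factorial in \<open>hodge_star\<close>.\<close>

lemma sum_symmetric_four:
  fixes G :: "'a \<Rightarrow> 'a \<Rightarrow> 'a \<Rightarrow> 'a \<Rightarrow> real"
  assumes s: "\<And>a b c d. G b a c d = G a b c d" "\<And>a b c d. G a c b d = G a b c d" "\<And>a b c d. G a b d c = G a b c d"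
    and z: "\<And>a c d. G a a c d = 0" and d: "distinct [p, q, r, s]"
  shows "(\<Sum>a\<in>{p,q,r,s}. \<Sum>b\<in>{p,q,r,s}. \<Sum>c\<in>{p,q,r,s}. \<Sum>d\<in>{p,q,r,s}. G a b c d) = 24 * G p q r s"
proof -
  have z': "G c a a d = 0" "G c d a a = 0" for a c d
    using s z by metis+
  have r: "G q p c d = G p q c d" "G r p c d = G p r c d" "G s p c d = G p s c d"
    "G r q c d = G q r c d" "G s q c d = G q s c d" "G s r c d = G r s c d"
    "G c q p d = G c p q d" "G c r p d = G c p r d" "G c s p d = G c p s d"
    "G c r q d = G c q r d" "G c s q d = G c q s d" "G c s r d = G c r s d"
    "G c d q p = G c d p q" "G c d r p = G c d p r" "G c d s p = G c d p s"
    "G c d r q = G c d q r" "G c d s q = G c d q s" "G c d s r = G c d r s" for c d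
    using s by metis+
  have sum: "(\<Sum>a\<in>{p,q,r,s}. f a) = f p + (f q + (f r + f s))" for f :: "'a \<Rightarrow> real"
    using d by simp
  show ?thesis
    unfolding sum by (simp add: r z z')
qed

definition std8 :: "oct list" where "std8 = std4 @ [(0,1), (0,qi), (0,qj), (0,qk)]"

lemma length_std8 [simp]: "length std8 = 8" by (simp add: std8_def)

lemma set_std8: "set std8 = Basis" by (auto simp: std8_def std4_def Basis_oct)

lemma orthonormal_std8: "orthonormal (\<bullet>) std8"
proof -
  have "distinct std8" by (simp add: std8_def std4_def)
  then show ?thesis
    using nth_mem[of _ std8] by (auto simp: orthonormal_def inner_Basis set_std8 nth_eq_iff_index_eq)
qed

locale oriented_cayley_space = cayley_space +
  fixes vol
  assumes alt_vol: "alternating_form V 8 vol"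
    and vol_unit: "\<And>E. orthonormal_basis V g E \<Longrightarrow> \<bar>vol E\<bar> = 1"
    and self_dual: "\<And>xs. set xs \<subseteq> V \<Longrightarrow> length xs = 4 \<Longrightarrow> hodge_star V g vol 4 \<phi> xs = \<phi> xs"
begin

lemma basis_std8: "iso T \<Longrightarrow> orthonormal_basis V g (map T std8)"
  using isoD(4,5)[of T] linear_span_image[OF isoD(1), of T "Basis"]
  by (simp add: orthonormal_basis_def orthonormal_map orthonormal_std8 set_std8 image_subset_iff)

lemma basis_lift:
  assumes T: "iso T" and E: "orthonormal_basis V g E"
  obtains us where "E = map T us" "orthonormal (\<bullet>) us" "distinct us" "span (set us) = UNIV" "length us = 8"
proof -
  obtain us where us: "E = map T us"
    using lift_list[OF T] E by (auto simp: orthonormal_basis_def)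
  have o: "orthonormal (\<bullet>) us"
    using E orthonormal_map[OF T] by (simp add: orthonormal_basis_def us)
  have "E \<in> frames V (length E)"
    using E by (intro orthonormal_frames[OF subV g]) (auto simp: orthonormal_basis_def)
  then have d: "distinct us" by (auto simp: frames_def us distinct_map)
  have "T ` span (set us) = range T"
    using E linear_span_image[OF isoD(1)[OF T], of "set us"] isoD(4)[OF T]
    by (simp add: orthonormal_basis_def us)
  then have s: "span (set us) = UNIV"
    using isoD(3)[OF T] by (metis inj_image_eq_iff)
  have "inner_product_on UNIV ((\<bullet>) :: oct \<Rightarrow> oct \<Rightarrow> real)"
    by (auto simp: inner_product_on_def linear_on_set_def inner_add_right inner_commute simp del: inner_Pair split_paired_All)
  then have "us \<in> frames UNIV (length us)"
    using o by (intro orthonormal_frames) auto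
  then have "card (set us) = dim (UNIV :: oct set)"
    using s basis_card_eq_dim[of "set us" UNIV] by (simp add: frames_def)
  then have "length us = 8" using d distinct_card by fastforce
  with us o d s show thesis by (rule that)
qed

lemma linear_vol:
  assumes "iso T" "set ys \<subseteq> V" "length ys = 8" "i < 8"
  shows "linear (\<lambda>a. vol (ys[i := T a]))"
proof (rule linearI)
  have lin: "linear_on_set V (\<lambda>v. vol (ys[i := v]))"
    using alternating_form_linear[OF alt_vol assms(2-4)] .
  note T = isoD(1,5)[OF assms(1)]
  show "vol (ys[i := T (a + b)]) = vol (ys[i := T a]) + vol (ys[i := T b])" for a b
    using alternating_form_add[OF alt_vol assms(2-4)] T by (simp add: linear_add)
  show "vol (ys[i := T (r *\<^sub>R a)]) = r *\<^sub>R vol (ys[i := T a])" for r a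
    using linear_on_set_sum[OF subV lin, of "{0::nat}" "\<lambda>_. T a" "\<lambda>_. r"] T by (simp add: linear_scale)
qed

text \<open>Self-duality is evaluated on the last four vectors of the adapted frame, where the form
  is 1. In the sum for the star, the volume form vanishes as soon as one of these vectors is
  repeated, so only arrangements of the first four survive, and their sum is 24 times the volume of
  the frame.\<close>

lemma vol_std8:
  assumes T: "iso T"
  shows "vol (map T std8) = 1"
proof -
  define E where "E = (SOME E. orthonormal_basis V g E)"
  have E: "orthonormal_basis V g E"
    unfolding E_def using basis_std8[OF T] by (rule someI)
  obtain us where us: "E = map T us" "orthonormal (\<bullet>) us" "distinct us" "span (set us) = UNIV"
    using basis_lift[OF T E] .
  define xs where "xs = map T [(0,1), (0,qi), (0,qj), (0,qk)]"
  have xs: "set xs \<subseteq> V" "length xs = 4"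
    using isoD(5)[OF T] by (simp_all add: xs_def)
  define v where "v a b c d = vol ([T a, T b, T c, T d] @ xs)" for a b c d
  define G where "G a b c d = cayley a b c d * v a b c d" for a b c d
  have lin: "linear (\<lambda>a. v a b c d)" "linear (\<lambda>b. v a b c d)" "linear (\<lambda>c. v a b c d)" "linear (\<lambda>d. v a b c d)" for a b c d
    using linear_vol[OF T, of "[T a, T b, T c, T d] @ xs" 0] linear_vol[OF T, of "[T a, T b, T c, T d] @ xs" 1]
      linear_vol[OF T, of "[T a, T b, T c, T d] @ xs" 2] linear_vol[OF T, of "[T a, T b, T c, T d] @ xs" 3]
      xs isoD(5)[OF T]
    by (simp_all add: v_def)
  have o: "u \<bullet> w = (if u = w then 1 else 0)" if uw: "u \<in> set us" "w \<in> set us" for u w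
  proof -
    obtain i j where "u = us ! i" "i < length us" "w = us ! j" "j < length us"
      using uw by (metis in_set_conv_nth)
    then show ?thesis using us(2,3) by (simp add: orthonormal_def nth_eq_iff_index_eq)
  qed
  have U: "finite (set us)" "span (set us) = UNIV" "pairwise orthogonal (set us)" "\<And>u. u \<in> set us \<Longrightarrow> norm u = 1"
    using us(4) by (simp_all add: pairwise_def orthogonal_def o norm_eq_1)
  have bil: "bilinear (\<lambda>x y. f x * h y)" if "linear f" "linear h" for f h :: "oct \<Rightarrow> real"
    using that unfolding bilinear_def
    by (intro conjI allI linearI) (simp_all add: linear_add linear_scale algebra_simps)
  have swap: "v b a c d = - v a b c d" "v a c b d = - v a b c d" "v a b d c = - v a b c d" for a b c d
  proof -
    have sub: "set ([T a, T b, T c, T d] @ xs) \<subseteq> V" "length ([T a, T b, T c, T d] @ xs) = 8"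
      using xs isoD(5)[OF T] by simp_all
    show "v b a c d = - v a b c d" "v a c b d = - v a b c d" "v a b d c = - v a b c d"
      using alternating_form_swap[OF subV alt_vol sub, of 0 1] alternating_form_swap[OF subV alt_vol sub, of 1 2]
        alternating_form_swap[OF subV alt_vol sub, of 2 3]
      by (simp_all add: v_def numeral_eq_Suc)
  qed
  have zero: "v a b c d = 0" if "a \<in> {(0,1), (0,qi), (0,qj), (0,qk)}" for a b c d
    unfolding v_def using that xs isoD(5)[OF T]
    by (intro alternating_form_not_distinct[OF alt_vol]) (auto simp: xs_def)
  have zeros: "v a b c d = 0" "v b a c d = 0" "v b c a d = 0" "v b c d a = 0"
    if "a \<in> {(0,1), (0,qi), (0,qj), (0,qk)}" for a b c d
    using zero[OF that] swap by (metis neg_equal_0_iff_equal)+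
  let ?B = "{(1,0), (qi,0), (qj,0), (qk,0)} :: oct set"
  have red: "(\<Sum>a\<in>Basis. f a) = (\<Sum>a\<in>?B. f a)" if "\<And>a. a \<in> {(0,1), (0,qi), (0,qj), (0,qk)} \<Longrightarrow> f a = 0"
    for f :: "oct \<Rightarrow> real"
    using that by (intro sum.mono_neutral_right) (auto simp: Basis_oct)
  have "1 = \<phi> xs"
    by (simp add: xs_def isoD(7)[OF T] cayley_def qvol_coord qform_coord)
  also have "\<dots> = hodge_star V g vol 4 \<phi> xs"
    using self_dual[OF xs] ..
  also have "\<dots> = (\<Sum>I | set I \<subseteq> set E \<and> length I = 4. \<phi> I * vol (I @ xs)) / 24"
    unfolding hodge_star_def Let_def E_def[symmetric] by (simp add: fact_numeral)
  also have "(\<Sum>I | set I \<subseteq> set E \<and> length I = 4. \<phi> I * vol (I @ xs)) =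
      (\<Sum>a\<in>set us. \<Sum>b\<in>set us. \<Sum>c\<in>set us. \<Sum>d\<in>set us. G a b c d)"
    using inj_on_subset[OF isoD(3)[OF T] subset_UNIV]
    by (simp add: us(1) sum_lists_four sum.reindex G_def v_def isoD(7)[OF T])
  \<comment> \<open>The basis is exchanged slot by slot: in each slot both the form and the volume
    are linear, so the sum over that slot is the trace of a bilinear form.\<close>
  also have "\<dots> = (\<Sum>a\<in>Basis. \<Sum>b\<in>Basis. \<Sum>c\<in>Basis. \<Sum>d\<in>Basis. G a b c d)"
    unfolding G_def by (intro sum_change_four orthonormal_trace[OF bil U] linear_cayley_args lin)
  also have "\<dots> = (\<Sum>a\<in>?B. \<Sum>b\<in>?B. \<Sum>c\<in>?B. \<Sum>d\<in>?B. G a b c d)"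
    by (subst (1 2 3 4) red) (auto simp: G_def zeros)
  also have "\<dots> = 24 * G (1,0) (qi,0) (qj,0) (qk,0)"
  proof (rule sum_symmetric_four)
    show "G b a c d = G a b c d" "G a c b d = G a b c d" "G a b d c = G a b c d" "G a a c d = 0" for a b c d
      unfolding G_def using swap cayley_swap by (metis minus_mult_minus, metis minus_mult_minus, metis minus_mult_minus) simp
  qed simp
  also have "G (1,0) (qi,0) (qj,0) (qk,0) = vol (map T std8)"
    by (simp add: G_def v_def xs_def std8_def std4_def cayley_def qvol_coord qform_coord)
  finally show ?thesis by simp
qed

end

section \<open>The group action on contact planes\<close>

lemma linear_on_set_lincomb:
  assumes "subspace V" "linear_on_set V L" "set xs \<subseteq> V"
  shows "L (\<Sum>j<length xs. c j *\<^sub>R xs ! j) = (\<Sum>j<length xs. c j *\<^sub>R L (xs ! j))"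
  using assms by (intro linear_on_set_sum[OF assms(1)]) auto

context oriented_cayley_space
begin

abbreviation G where "G \<equiv> spin7_group V g \<phi>"

text \<open>The frames of \<open>T\<close> and \<open>L \<circ> T\<close> both have volume 1, and
  \<open>E\<close> and its image have the same coefficients relative to them. Hence \<open>L\<close>
  preserves the volume of \<open>E\<close>, so its matrix relative to \<open>E\<close> has
  determinant 1.\<close>

lemma orientation_preserving:
  assumes T: "iso T" and LT: "iso (L \<circ> T)" and lin: "linear_on_set V L" and E: "orthonormal_basis V g E"
  shows "same_orientation E (map L E)"
proof -
  have EV: "set E \<subseteq> V" "orthonormal g E" "span (set E) = V"
    using E by (auto simp: orthonormal_basis_def)
  obtain us where us: "E = map T us" "length us = 8"
    using basis_lift[OF T E] .
  then have len: "length E = 8" by simp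
  have Ef: "E \<in> frames V 8" using orthonormal_frames[OF subV g EV(1,2)] len by simp
  let ?F = "map T std8"
  have F: "orthonormal_basis V g ?F" by (rule basis_std8[OF T])
  then have Ff: "?F \<in> frames V 8" and FV: "set ?F \<subseteq> V"
    using orthonormal_frames[OF subV g, of ?F] by (auto simp: orthonormal_basis_def)
  have LV: "L v \<in> V" if "v \<in> V" for v
    using isoD(5)[OF LT] iso_inv(1)[OF T that] by (metis comp_apply)
  have "set (map L E) \<subseteq> span (set E)"
    using EV LV by auto
  then have "L (E ! i) \<in> span (set E)" if "i < 8" for i
    using that len by auto
  moreover have "distinct E" using Ef by (simp add: frames_def)
  ultimately have "\<forall>i. \<exists>c. i < 8 \<longrightarrow> L (E ! i) = (\<Sum>j<8. c j *\<^sub>R E ! j)"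
    using span_list[of _ E] unfolding len by blast
  then obtain a where a: "\<And>i. i < 8 \<Longrightarrow> L (E ! i) = (\<Sum>j<8. a i j *\<^sub>R E ! j)"
    by metis
  have "set E \<subseteq> span (set ?F)"
    using EV(1) F by (simp add: orthonormal_basis_def)
  then obtain b where b: "\<And>i. i < 8 \<Longrightarrow> E ! i = (\<Sum>j<8. b i j *\<^sub>R ?F ! j)"
    using frame_change[OF Ff Ef] by metis
  have "vol (map L E) = leibniz_det 8 a * vol E"
    using a len by (intro alternating_form_same_orientation[OF subV alt_vol Ef]) simp_all
  moreover have "vol E = leibniz_det 8 b * vol ?F"
    by (rule alternating_form_same_orientation[OF subV alt_vol Ff b len])
  moreover have "vol (map L E) = leibniz_det 8 b * vol (map (L \<circ> T) std8)"
  proof (rule alternating_form_same_orientation[OF subV alt_vol])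
    show "map (L \<circ> T) std8 \<in> frames V 8"
      using basis_std8[OF LT] orthonormal_frames[OF subV g, of "map (L \<circ> T) std8"] by (simp add: orthonormal_basis_def)
    fix i :: nat assume i: "i < 8"
    have "L (E ! i) = (\<Sum>j<8. b i j *\<^sub>R L (?F ! j))"
      unfolding b[OF i] using linear_on_set_lincomb[OF subV lin FV] by simp
    then show "map L E ! i = (\<Sum>j<8. b i j *\<^sub>R map (L \<circ> T) std8 ! j)"
      using i len by simp
  qed (use len in simp)
  ultimately have "leibniz_det 8 a * vol E = vol E"
    using vol_std8[OF T] vol_std8[OF LT] by simp
  moreover have "vol E \<noteq> 0" using vol_unit[OF E] by auto
  ultimately have "leibniz_det 8 a = 1" by simp
  then show ?thesis
    unfolding same_orientation_def using a len by (intro conjI exI[of _ a]) simp_all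
qed

text \<open>Once \<open>T\<close> is fixed, group elements correspond bijectively to isomorphisms
  with the model by \<open>L \<mapsto> L \<circ> T\<close>. Extensionality fixes the values outside
  \<open>V\<close>, as \<open>Bij\<close> demands; the orientation condition is supplied by
  \<open>orientation_preserving\<close>.\<close>

lemma spin7_carrier_iff:
  assumes T: "iso T"
  shows "L \<in> carrier G \<longleftrightarrow> L \<in> extensional V \<and> iso (L \<circ> T)"
proof
  assume "L \<in> carrier G"
  then have L: "L \<in> Bij V" and lin: "linear_on_set V L" and iso: "\<And>v w. v \<in> V \<Longrightarrow> w \<in> V \<Longrightarrow> g (L v) (L w) = g v w"
    and form: "\<And>xs. set xs \<subseteq> V \<Longrightarrow> length xs = 4 \<Longrightarrow> \<phi> (map L xs) = \<phi> xs"
    by (auto simp: spin7_group_def special_orthogonal_def)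
  have "linear (L \<circ> T)"
  proof (rule linearI)
    have "L (a *\<^sub>R T x + b *\<^sub>R T y) = a *\<^sub>R L (T x) + b *\<^sub>R L (T y)" for a b x y
      using lin isoD(5)[OF T] unfolding linear_on_set_def by blast
    from this[of 1 _ 1] this[of _ _ 0 0]
    show "(L \<circ> T) (x + y) = (L \<circ> T) x + (L \<circ> T) y" "(L \<circ> T) (r *\<^sub>R x) = r *\<^sub>R (L \<circ> T) x" for x y r
      using isoD(1)[OF T] by (simp_all add: linear_add linear_scale)
  qed
  moreover have "bij_betw (L \<circ> T) UNIV V"
    using L isoD(2)[OF T] by (auto simp: Bij_def intro: bij_betw_trans)
  moreover have "\<phi> [L (T x), L (T y), L (T z), L (T w)] = cayley x y z w" for x y z w
    using form[of "[T x, T y, T z, T w]"] isoD(5,7)[OF T] by simp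
  ultimately show "L \<in> extensional V \<and> iso (L \<circ> T)"
    using L iso isoD(5,6)[OF T] by (simp add: cayley_iso_def Bij_def)
next
  assume L: "L \<in> extensional V \<and> iso (L \<circ> T)"
  then have LT: "iso (L \<circ> T)" by blast
  have lift: "\<exists>x. v = T x" if "v \<in> V" for v
    using iso_inv(1)[OF T that] by metis
  have "bij_betw L V V"
    using isoD(2)[OF T] isoD(2)[OF LT] bij_betw_comp_iff by blast
  then have Bij: "L \<in> Bij V" using L by (simp add: Bij_def)
  have lin: "linear_on_set V L"
    unfolding linear_on_set_def
  proof (intro ballI allI)
    fix v w a b assume "v \<in> V" "w \<in> V"
    then obtain x y where xy: "v = T x" "w = T y" using lift by metis
    have "L (T (a *\<^sub>R x + b *\<^sub>R y)) = a *\<^sub>R L (T x) + b *\<^sub>R L (T y)"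
      using linear_add[OF isoD(1)[OF LT]] linear_scale[OF isoD(1)[OF LT]] by simp
    then show "L (a *\<^sub>R v + b *\<^sub>R w) = a *\<^sub>R L v + b *\<^sub>R L w"
      using linear_add[OF isoD(1)[OF T]] linear_scale[OF isoD(1)[OF T]] by (simp add: xy)
  qed
  have "g (L v) (L w) = g v w" if "v \<in> V" "w \<in> V" for v w
    using lift[OF that(1)] lift[OF that(2)] isoD(6)[OF T] isoD(6)[OF LT] by auto
  moreover have "\<phi> (map L xs) = \<phi> xs" if xs: "set xs \<subseteq> V" "length xs = 4" for xs
  proof -
    obtain us where us: "xs = map T us" using lift_list[OF T xs(1)] .
    with xs(2) have "length us = 4" by simp
    then obtain a b c d where "us = [a, b, c, d]" by (rule length_four_cases)
    then show ?thesis using isoD(7)[OF T] isoD(7)[OF LT] by (simp add: us)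
  qed
  ultimately show "L \<in> carrier G"
    using Bij lin orientation_preserving[OF T LT lin]
    by (simp add: spin7_group_def special_orthogonal_def)
qed

lemma group_spin7: "group G"
proof -
  interpret B: group "BijGroup V" by (rule group_BijGroup)
  obtain T where T: "iso T" using ex_iso by blast
  have Bij: "L \<in> Bij V" if "L \<in> carrier G" for L
    using that by (auto simp: spin7_group_def special_orthogonal_def)
  have "subgroup (carrier G) (BijGroup V)"
  proof (rule B.subgroupI)
    show "carrier G \<subseteq> carrier (BijGroup V)" using Bij by (auto simp: BijGroup_def)
    have "restrict (\<lambda>x. x) V \<circ> T = T" using isoD(5)[OF T] by (auto simp: fun_eq_iff)
    then have "restrict (\<lambda>x. x) V \<in> carrier G"
      using T by (simp add: spin7_carrier_iff[OF T])
    then show "carrier G \<noteq> {}" by blast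
    fix L assume L: "L \<in> carrier G"
    then have LT: "iso (L \<circ> T)" by (simp add: spin7_carrier_iff[OF T])
    have "restrict (inv_into V L) V \<circ> (L \<circ> T) = T"
      using Bij[OF L] isoD(5)[OF T] isoD(5)[OF LT] by (auto simp: fun_eq_iff Bij_def bij_betw_def)
    \<comment> \<open>The membership criterion is applied with \<open>L \<circ> T\<close> as
      reference isomorphism, which the inverse carries back to \<open>T\<close>.\<close>
    then have "restrict (inv_into V L) V \<in> carrier G"
      using T by (simp add: spin7_carrier_iff[OF LT])
    then show "inv\<^bsub>BijGroup V\<^esub> L \<in> carrier G"
      using inv_BijGroup[OF Bij[OF L]] by (simp add: restrict_def)
    fix M assume M: "M \<in> carrier G"
    have "compose V L M \<circ> T = L \<circ> (M \<circ> T)"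
      using isoD(5)[OF T] by (auto simp: fun_eq_iff compose_def)
    moreover have "iso (M \<circ> T)" using M by (simp add: spin7_carrier_iff[OF T])
    then have "iso (L \<circ> (M \<circ> T))"
      using L spin7_carrier_iff by blast
    ultimately have "compose V L M \<in> carrier G"
      unfolding spin7_carrier_iff[OF T] by (simp add: compose_extensional)
    then show "L \<otimes>\<^bsub>BijGroup V\<^esub> M \<in> carrier G"
      using Bij L M by (simp add: BijGroup_def)
  qed
  then have "group (BijGroup V\<lparr>carrier := carrier G\<rparr>)"
    by (rule subgroup.subgroup_is_group) (rule B.group_axioms)
  then show ?thesis by (simp add: spin7_group_def)
qed

lemma spin7_mult: "L \<in> carrier G \<Longrightarrow> M \<in> carrier G \<Longrightarrow> L \<otimes>\<^bsub>G\<^esub> M = compose V L M"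
  by (simp add: spin7_group_def special_orthogonal_def BijGroup_def)

lemma spin7_closed: "L \<in> carrier G \<Longrightarrow> M \<in> carrier G \<Longrightarrow> compose V L M \<in> carrier G"
  using group.is_monoid[OF group_spin7] monoid.m_closed spin7_mult by metis

lemma spin7D:
  assumes "L \<in> carrier G"
  shows "bij_betw L V V" "linear_on_set V L" "L \<in> extensional V"
  using assms by (auto simp: spin7_group_def special_orthogonal_def Bij_def)

lemma spin7_inverse:
  assumes "L \<in> carrier G"
  shows "\<exists>M\<in>carrier G. \<forall>v\<in>V. L (M v) = v \<and> M (L v) = v"
proof -
  interpret group G by (rule group_spin7)
  have one: "\<one>\<^bsub>G\<^esub> v = v" if "v \<in> V" for v
    using that by (simp add: spin7_group_def BijGroup_def)
  have "L \<otimes>\<^bsub>G\<^esub> (inv\<^bsub>G\<^esub> L) = \<one>\<^bsub>G\<^esub>" "(inv\<^bsub>G\<^esub> L) \<otimes>\<^bsub>G\<^esub> L = \<one>\<^bsub>G\<^esub>"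
    using assms by simp_all
  then have "L ((inv\<^bsub>G\<^esub> L) v) = v" "(inv\<^bsub>G\<^esub> L) (L v) = v" if "v \<in> V" for v
    using one[OF that] that assms by (auto simp: spin7_mult compose_def fun_eq_iff split: if_splits)
  then show ?thesis using assms inv_closed by blast
qed

section \<open>The action on frames and planes\<close>

lemma spin7_image_frame:
  assumes L: "L \<in> carrier G" and xs: "xs \<in> frames V m"
  shows "map L xs \<in> frames V m"
proof -
  obtain M where M: "M \<in> carrier G" "\<And>v. v \<in> V \<Longrightarrow> L (M v) = v" "\<And>v. v \<in> V \<Longrightarrow> M (L v) = v"
    using spin7_inverse[OF L] by blast
  have xV: "set xs \<subseteq> V" and d: "distinct xs" "independent (set xs)" and len: "length xs = m"
    using xs by (auto simp: frames_def)
  have LV: "L v \<in> V" if "v \<in> V" for v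
    using spin7D(1)[OF L] that by (auto simp: bij_betw_def)
  have "c j = 0" if 0: "(\<Sum>j<length (map L xs). c j *\<^sub>R map L xs ! j) = 0" and j: "j < length (map L xs)" for c j
  proof (rule frame_coefficients[OF d])
    have "L (\<Sum>j<length xs. c j *\<^sub>R xs ! j) = 0"
      using 0 linear_on_set_lincomb[OF subV spin7D(2)[OF L] xV] by simp
    moreover have "(\<Sum>j<length xs. c j *\<^sub>R xs ! j) \<in> V"
      using xV by (intro subspace_sum[OF subV] subspace_scale[OF subV]) auto
    moreover have "M 0 = 0"
      using linear_on_set_sum[OF subV spin7D(2)[OF M(1)], of "{}"] by simp
    ultimately show "(\<Sum>j<length xs. c j *\<^sub>R xs ! j) = 0"
      using M(3) by metis
  qed (use j in simp)
  then show ?thesis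
    using frameI[of "map L xs"] xV LV len unfolding frames_def by auto
qed

lemma spin7_same_orientation:
  assumes L: "L \<in> carrier G" and "set xs \<subseteq> V" "same_orientation xs ys"
  shows "same_orientation (map L xs) (map L ys)"
proof -
  obtain a where a: "length ys = length xs" "leibniz_det (length xs) a > 0"
    "\<And>i. i < length xs \<Longrightarrow> ys ! i = (\<Sum>j<length xs. a i j *\<^sub>R xs ! j)"
    using assms(3) by (auto simp: same_orientation_def)
  then show ?thesis
    using linear_on_set_lincomb[OF subV spin7D(2)[OF L] assms(2)]
    by (auto simp: same_orientation_def)
qed

lemma spin7_image_plane:
  assumes L: "L \<in> carrier G" and xs: "xs \<in> frames V m"
  shows "map L ` plane_of V xs = plane_of V (map L xs)"
proof -
  have sub: "map L ` plane_of V xs \<subseteq> plane_of V (map L xs)" if "L \<in> carrier G" "xs \<in> frames V m" for L xs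
  proof -
    have "set xs \<subseteq> V" using that(2) by (simp add: frames_def)
    then show ?thesis
      using spin7_image_frame[OF that(1)] spin7_same_orientation[OF that(1)] by (auto simp: plane_of_def)
  qed
  obtain M where M: "M \<in> carrier G" "\<And>v. v \<in> V \<Longrightarrow> L (M v) = v" "\<And>v. v \<in> V \<Longrightarrow> M (L v) = v"
    using spin7_inverse[OF L] by blast
  have "zs \<in> map L ` plane_of V xs" if zs: "zs \<in> plane_of V (map L xs)" for zs
  proof -
    have "map M (map L xs) = xs"
      using xs M(3) by (auto simp: frames_def intro!: map_idI)
    then have "map M zs \<in> plane_of V xs"
      using sub[OF M(1) spin7_image_frame[OF L xs]] zs by auto
    moreover have "map L (map M zs) = zs"
      using zs M(2) by (auto simp: plane_of_def frames_def intro!: map_idI)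
    ultimately show ?thesis by (metis image_eqI)
  qed
  with sub[OF L xs] show ?thesis by blast
qed

lemma plane_action_contact:
  assumes L: "L \<in> carrier G" and T: "iso T"
  shows "plane_action contact L (plane_of V (map T std4)) = plane_of V (map (L \<circ> T) std4)"
  using contact_eq T spin7_image_plane[OF L std4_frame(1)[OF T]] by (auto simp: plane_action_def)

lemma contactE:
  assumes "\<xi> \<in> contact"
  obtains T where "iso T" "\<xi> = plane_of V (map T std4)"
  using assms contact_eq by auto

lemma contactI: "iso T \<Longrightarrow> plane_of V (map T std4) \<in> contact"
  using contact_eq by auto

lemma plane_action_in:
  assumes "L \<in> carrier G" "\<xi> \<in> contact"
  shows "plane_action contact L \<xi> \<in> contact"
proof -
  obtain T where T: "iso T" "\<xi> = plane_of V (map T std4)" using contactE[OF assms(2)] .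
  have "iso (L \<circ> T)" using assms(1) spin7_carrier_iff[OF T(1)] by blast
  then show ?thesis
    unfolding T(2) plane_action_contact[OF assms(1) T(1)] by (rule contactI)
qed

lemma plane_action_compose:
  assumes "L \<in> carrier G" "M \<in> carrier G" "\<xi> \<in> contact"
  shows "plane_action contact (compose V L M) \<xi> = plane_action contact L (plane_action contact M \<xi>)"
proof -
  obtain T where T: "iso T" "\<xi> = plane_of V (map T std4)" using contactE[OF assms(3)] .
  have MT: "iso (M \<circ> T)" using assms(2) spin7_carrier_iff[OF T(1)] by blast
  have "compose V L M \<circ> T = L \<circ> (M \<circ> T)"
    using isoD(5)[OF T(1)] by (auto simp: fun_eq_iff compose_def)
  then show ?thesis
    unfolding T(2) plane_action_contact[OF spin7_closed[OF assms(1,2)] T(1)]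
      plane_action_contact[OF assms(2) T(1)] plane_action_contact[OF assms(1) MT] by simp
qed

lemma transitive_contact: "transitive_action G contact (plane_action contact)"
proof -
  have bij: "plane_action contact L \<in> Bij contact" if L: "L \<in> carrier G" for L
  proof -
    obtain M where M: "M \<in> carrier G" "\<And>v. v \<in> V \<Longrightarrow> L (M v) = v" "\<And>v. v \<in> V \<Longrightarrow> M (L v) = v"
      using spin7_inverse[OF L] by blast
    have id: "plane_action contact L (plane_action contact M \<xi>) = \<xi>"
      if *: "L \<in> carrier G" "M \<in> carrier G" "\<And>v. v \<in> V \<Longrightarrow> L (M v) = v" "\<xi> \<in> contact" for L M \<xi>
    proof -
      obtain T where T: "iso T" "\<xi> = plane_of V (map T std4)" using contactE[OF *(4)] .
      have "compose V L M \<circ> T = T"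
        using isoD(5)[OF T(1)] *(3) by (auto simp: fun_eq_iff compose_def)
      then show ?thesis
        unfolding plane_action_compose[OF *(1,2,4), symmetric]
        unfolding T(2) plane_action_contact[OF spin7_closed[OF *(1,2)] T(1)] by simp
    qed
    have "bij_betw (plane_action contact L) contact contact"
      by (rule bij_betw_byWitness[where f' = "plane_action contact M"])
        (use L M id plane_action_in in blast)+
    then show ?thesis
      by (simp add: Bij_def plane_action_def)
  qed
  have "plane_action contact \<in> hom G (BijGroup contact)"
  proof (rule homI)
    show "plane_action contact L \<in> carrier (BijGroup contact)" if "L \<in> carrier G" for L
      using bij[OF that] by (simp add: BijGroup_def)
    show "plane_action contact (L \<otimes>\<^bsub>G\<^esub> M) = plane_action contact L \<otimes>\<^bsub>BijGroup contact\<^esub> plane_action contact M"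
      if LM: "L \<in> carrier G" "M \<in> carrier G" for L M
    proof -
      have "plane_action contact (compose V L M) = compose contact (plane_action contact L) (plane_action contact M)"
      proof
        fix \<xi>
        show "plane_action contact (compose V L M) \<xi> = compose contact (plane_action contact L) (plane_action contact M) \<xi>"
        proof (cases "\<xi> \<in> contact")
          case True
          then show ?thesis using plane_action_compose[OF LM True] by (simp only: compose_eq)
        next
          case False
          then show ?thesis by (simp only: plane_action_def compose_def restrict_def if_False)
        qed
      qed
      then show ?thesis
        using bij[OF LM(1)] bij[OF LM(2)] by (simp add: spin7_mult[OF LM] BijGroup_def)
    qed
  qed
  then have "group_hom G (BijGroup contact) (plane_action contact)"
    by (simp add: group_hom_def group_hom_axioms_def group_spin7 group_BijGroup)
  moreover have "\<exists>L\<in>carrier G. plane_action contact L \<xi> = \<eta>" if *: "\<xi> \<in> contact" "\<eta> \<in> contact" for \<xi> \<eta>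
  proof -
    obtain T where T: "iso T" "\<xi> = plane_of V (map T std4)" using contactE[OF *(1)] .
    obtain T' where T': "iso T'" "\<eta> = plane_of V (map T' std4)" using contactE[OF *(2)] .
    \<comment> \<open>The map carrying the adapted frame of \<open>T\<close> to that of
      \<open>T'\<close>; since both isomorphisms send \<open>std4\<close> to bases of the given
      planes, it moves one plane to the other.\<close>
    let ?L = "restrict (T' \<circ> inv_into UNIV T) V"
    have LT: "?L \<circ> T = T'"
      using isoD(5)[OF T(1)] iso_inv(2)[OF T(1)] by (auto simp: fun_eq_iff)
    then have "?L \<in> carrier G"
      using T' by (simp add: spin7_carrier_iff[OF T(1)])
    moreover from plane_action_contact[OF this T(1)] have "plane_action contact ?L \<xi> = \<eta>"
      by (simp only: LT T(2) T'(2))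
    ultimately show ?thesis by blast
  qed
  ultimately show ?thesis
    by (intro transitive_action.intro group_action.intro transitive_action_axioms.intro)
qed

end

section \<open>The group SU(2) and unit quaternions\<close>

text \<open>Reading the first row is enough, since on SU(2) it determines the second.\<close>

definition quat_of_matrix :: "complex^2^2 \<Rightarrow> quat" where
  "quat_of_matrix A = Quat (Re (A $ 1 $ 1)) (Im (A $ 1 $ 1)) (Re (A $ 1 $ 2)) (Im (A $ 1 $ 2))"

text \<open>The usual embedding: a quaternion written as \<alpha> + \<beta> j, with \<alpha> and
  \<beta> complex, becomes the matrix with first row \<alpha>, \<beta> and second row
  \<open>- cnj \<beta>\<close>, \<open>cnj \<alpha>\<close>.\<close>

definition matrix_of_quat :: "quat \<Rightarrow> complex^2^2" where
  "matrix_of_quat x = (\<chi> i j.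
     if i = 1 then if j = 1 then Complex (q0 x) (q1 x) else Complex (q2 x) (q3 x)
     else if j = 1 then Complex (- q2 x) (q3 x) else Complex (q0 x) (- q1 x))"

lemma matrix_of_quat_nth [simp]:
  "matrix_of_quat x $ 1 $ 1 = Complex (q0 x) (q1 x)" "matrix_of_quat x $ 1 $ 2 = Complex (q2 x) (q3 x)"
  "matrix_of_quat x $ 2 $ 1 = Complex (- q2 x) (q3 x)" "matrix_of_quat x $ 2 $ 2 = Complex (q0 x) (- q1 x)"
  by (simp_all add: matrix_of_quat_def)

lemma quat_of_matrix_of_quat [simp]: "quat_of_matrix (matrix_of_quat x) = x"
  by (simp add: quat_of_matrix_def)

lemma matrix_eq_iff2: "A = B \<longleftrightarrow> A $ 1 $ 1 = B $ 1 $ 1 \<and> A $ 1 $ 2 = B $ 1 $ 2 \<and> A $ 2 $ 1 = B $ 2 $ 1 \<and> A $ 2 $ 2 = B $ 2 $ 2"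
  for A B :: "'a^2^2"
  by (auto simp: vec_eq_iff forall_2)

lemma matrix_mult_nth2: "(A ** B) $ i $ j = A $ i $ 1 * B $ 1 $ j + A $ i $ 2 * B $ 2 $ j"
  for A B :: "'a::semiring_1^2^2"
  by (simp add: matrix_matrix_mult_def sum_2)

lemma matrix_of_quat_mult: "matrix_of_quat (x * y) = matrix_of_quat x ** matrix_of_quat y"
  by (simp add: matrix_eq_iff2 matrix_mult_nth2 complex_eq_iff quat_sel_mult algebra_simps)

lemma matrix_of_quat_1: "matrix_of_quat 1 = mat 1"
  by (simp add: matrix_eq_iff2 mat_def complex_eq_iff)

lemma matrix_of_quat_minus: "matrix_of_quat (- x) = - matrix_of_quat x"
  by (simp add: matrix_eq_iff2 complex_eq_iff)

lemma carrier_SU2: "carrier SU2 = matrix_of_quat ` {x. x \<bullet> x = 1}"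
proof (intro equalityI subsetI)
  fix A assume "A \<in> carrier SU2"
  then have A: "A ** (\<chi> i j. cnj (A $ j $ i)) = mat 1" "det A = 1"
    by (auto simp: SU2_def)
  let ?a = "A $ 1 $ 1" and ?b = "A $ 1 $ 2" and ?c = "A $ 2 $ 1" and ?d = "A $ 2 $ 2"
  have e: "?a * cnj ?a + ?b * cnj ?b = 1" "?c * cnj ?a + ?d * cnj ?b = 0"
    using A(1) by (simp_all add: matrix_eq_iff2 matrix_mult_nth2 mat_def)
  have d: "?a * ?d - ?b * ?c = 1"
    using A(2) by (simp add: det_2)
  \<comment> \<open>Multiply the determinant equation by \<open>cnj ?a\<close> and substitute both
    relations in \<open>e\<close>.\<close>
  have "?d = cnj ?a"
    using e d by algebra
  moreover have "?c = - cnj ?b"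
    using e d by algebra
  ultimately have "A = matrix_of_quat (quat_of_matrix A)"
    by (simp add: matrix_eq_iff2 quat_of_matrix_def complex_eq_iff)
  moreover have "quat_of_matrix A \<bullet> quat_of_matrix A = 1"
    using e(1) by (simp add: inner_quat_def quat_of_matrix_def complex_eq_iff)
  ultimately show "A \<in> matrix_of_quat ` {x. x \<bullet> x = 1}" by blast
next
  fix A assume "A \<in> matrix_of_quat ` {x. x \<bullet> x = 1}"
  then obtain x where x: "A = matrix_of_quat x" "x \<bullet> x = 1" by blast
  then show "A \<in> carrier SU2"
    by (simp add: SU2_def matrix_eq_iff2 matrix_mult_nth2 mat_def det_2 complex_eq_iff inner_quat_def algebra_simps)
qed

lemma quat_of_matrix_SU2:
  assumes "A \<in> carrier SU2"
  shows "quat_of_matrix A \<bullet> quat_of_matrix A = 1" "matrix_of_quat (quat_of_matrix A) = A"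
  using assms by (auto simp: carrier_SU2)

lemma SU2_mult [simp]: "A \<otimes>\<^bsub>SU2\<^esub> B = A ** B" and SU2_one [simp]: "\<one>\<^bsub>SU2\<^esub> = mat 1"
  by (simp_all add: SU2_def)

lemma quat_of_matrix_mult:
  assumes "A \<in> carrier SU2" "B \<in> carrier SU2"
  shows "quat_of_matrix (A ** B) = quat_of_matrix A * quat_of_matrix B"
  using assms by (auto simp: carrier_SU2 simp flip: matrix_of_quat_mult)

lemma group_SU2: "group SU2"
proof (rule groupI)
  show "\<one>\<^bsub>SU2\<^esub> \<in> carrier SU2"
    by (auto simp: carrier_SU2 inner_quat_def simp flip: matrix_of_quat_1)
  show "A \<otimes>\<^bsub>SU2\<^esub> B \<in> carrier SU2" if "A \<in> carrier SU2" "B \<in> carrier SU2" for A B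
    using that by (auto simp: carrier_SU2 inner_mult_left simp flip: matrix_of_quat_mult)
  show "\<exists>B\<in>carrier SU2. B \<otimes>\<^bsub>SU2\<^esub> A = \<one>\<^bsub>SU2\<^esub>" if A: "A \<in> carrier SU2" for A
  proof -
    obtain x where x: "A = matrix_of_quat x" "x \<bullet> x = 1" using A by (auto simp: carrier_SU2)
    then have "matrix_of_quat (qcnj x) ** A = mat 1"
      by (simp add: mult_qcnj matrix_of_quat_1 flip: matrix_of_quat_mult)
    moreover have "matrix_of_quat (qcnj x) \<in> carrier SU2" using x(2) by (auto simp: carrier_SU2)
    ultimately show ?thesis by auto
  qed
qed (simp_all add: matrix_mul_assoc)

lemma linear_matrix_of_quat: "linear matrix_of_quat"
  by (rule linearI) (simp_all add: matrix_eq_iff2 complex_eq_iff)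

lemma linear_quat_of_matrix: "linear quat_of_matrix"
  by (rule linearI) (simp_all add: quat_of_matrix_def quat_eq_iff)

lemma compact_SU2: "compact (carrier SU2)"
proof -
  have "{x::quat. x \<bullet> x = 1} = sphere 0 1"
    by (auto simp: norm_eq_1)
  then show ?thesis
    unfolding carrier_SU2
    by (intro compact_continuous_image linear_continuous_on linear_conv_bounded_linear[THEN iffD1] linear_matrix_of_quat) simp
qed

lemma group_SU2_cubed: "group SU2_cubed"
  unfolding SU2_cubed_def by (intro DirProd_group group_SU2)

lemma carrier_SU2_cubed: "carrier SU2_cubed = carrier SU2 \<times> carrier SU2 \<times> carrier SU2"
  by (simp add: SU2_cubed_def)

text \<open>Algebraically this is the first isomorphism theorem. Topologically, a continuous map
  from a compact space onto a Hausdorff space is closed and hence a quotient map, so continuity of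
  the inverse never has to be examined.\<close>

lemma topological_quotient_isoI:
  fixes H :: "('b::topological_space) monoid"
  assumes "group G" "group H" and hom: "h \<in> hom G H" and onto: "h ` carrier G = carrier H"
    and kernel: "kernel G H h = N"
    and "compact (carrier G)" "continuous_on (carrier G) h" "Hausdorff_space (euclidean :: 'b topology)"
  shows "topological_quotient_iso G N H"
proof -
  interpret group_hom G H h
    using assms by (simp add: group_hom_def group_hom_axioms_def)
  let ?f = "\<lambda>X. the_elem (h ` X)"
  have "?f \<in> iso (G Mod N) H"
    using FactGroup_iso_set[OF onto] kernel by simp
  moreover have "quotient_map (top_of_set (carrier G)) (top_of_set (carrier H)) h"
  proof (rule continuous_closed_imp_quotient_map)
    show c: "continuous_map (top_of_set (carrier G)) (top_of_set (carrier H)) h"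
      using assms(7) onto by auto
    show "closed_map (top_of_set (carrier G)) (top_of_set (carrier H)) h"
      using assms(6,8) by (intro continuous_imp_closed_map c)
        (simp_all add: compact_space_subtopology Hausdorff_space_subtopology)
    show "h ` topspace (top_of_set (carrier G)) = topspace (top_of_set (carrier H))"
      using onto by simp
  qed
  moreover have "?f (N #>\<^bsub>G\<^esub> x) = h x" if "x \<in> carrier G" for x
  proof -
    have "h ` (N #>\<^bsub>G\<^esub> x) = {h x}"
    proof -
      have "h y = h x" if "y \<in> N #>\<^bsub>G\<^esub> x" for y
        using that \<open>x \<in> carrier G\<close> by (auto simp: r_coset_def kernel_def simp flip: kernel)
      moreover have "x \<in> N #>\<^bsub>G\<^esub> x"
        using subgroup_kernel kernel that by (metis G.rcos_self)
      ultimately show ?thesis by blast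
    qed
    then show ?thesis by simp
  qed
  ultimately have "quotient_map (top_of_set (carrier G)) (top_of_set (carrier H)) (\<lambda>x. ?f (N #>\<^bsub>G\<^esub> x))"
    by (elim quotient_map_eq) simp
  with \<open>?f \<in> iso (G Mod N) H\<close> show ?thesis
    unfolding topological_quotient_iso_def by (intro bexI[of _ ?f])
qed

lemma Hausdorff_fun: "Hausdorff_space (euclidean :: ('a \<Rightarrow> 'b::topological_space) topology)"
  if "Hausdorff_space (euclidean :: 'b topology)"
proof -
  have "Hausdorff_space (product_topology (\<lambda>i::'a. euclidean :: 'b topology) UNIV)"
    unfolding Hausdorff_space_product_topology using that by blast
  then show ?thesis by (simp only: euclidean_product_topology)
qed

section \<open>The stabilizer of a contact plane\<close>

definition frame_action :: "'v set \<Rightarrow> (oct \<Rightarrow> 'v) \<Rightarrow> quat \<Rightarrow> quat \<Rightarrow> quat \<Rightarrow> 'v \<Rightarrow> 'v" where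
  "frame_action V T p q r = restrict (T \<circ> octK p q r \<circ> inv_into UNIV T) V"

context oriented_cayley_space
begin

lemma frame_action_comp: "iso T \<Longrightarrow> frame_action V T p q r \<circ> T = T \<circ> octK p q r"
  using isoD(5) iso_inv(2) by (auto simp: frame_action_def fun_eq_iff)

lemma frame_action_mult:
  assumes T: "iso T"
  shows "frame_action V T (p * p') (q * q') (r * r') = compose V (frame_action V T p q r) (frame_action V T p' q' r')"
  using isoD(5)[OF T] iso_inv(2)[OF T]
  by (auto simp: frame_action_def compose_def fun_eq_iff octK_mult)

lemma std4_span: "set ys \<subseteq> {x. snd x = 0} \<Longrightarrow> set ys \<subseteq> span (set std4)"
proof
  fix y assume "set ys \<subseteq> {x. snd x = 0}" "y \<in> set ys"
  then have "y = q0 (fst y) *\<^sub>R (1,0) + q1 (fst y) *\<^sub>R (qi,0) + q2 (fst y) *\<^sub>R (qj,0) + q3 (fst y) *\<^sub>R (qk,0)"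
    by (auto simp: prod_eq_iff quat_eq_iff)
  also have "\<dots> \<in> span (set std4)"
    by (intro span_add span_scale span_base) (auto simp: std4_def)
  finally show "y \<in> span (set std4)" .
qed

text \<open>\<open>octK\<close> maps the plane of \<open>std4\<close> to itself, so a change matrix
  exists. The form equals 1 on both frames, hence this matrix has determinant 1: the form itself
  certifies that the orientation is kept.\<close>

lemma frame_action_stabilizer:
  assumes T: "iso T" and pqr: "p \<bullet> p = 1" "q \<bullet> q = 1" "r \<bullet> r = 1"
  shows "frame_action V T p q r \<in> stabilizer G (plane_action contact) (plane_of V (map T std4))"
proof -
  let ?L = "frame_action V T p q r" and ?M = "octK p q r"
  have TM: "iso (T \<circ> ?M)"
    using cayley_iso_comp[OF T cayley_auto_octK[OF pqr]] .
  have L: "?L \<in> carrier G"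
    unfolding spin7_carrier_iff[OF T] frame_action_comp[OF T] using TM
    by (simp add: frame_action_def)
  let ?xs = "map T std4" and ?ys = "map (T \<circ> ?M) std4"
  note xs = std4_frame[OF T] and ys = std4_frame[OF TM]
  have "set (map ?M std4) \<subseteq> span (set std4)"
    by (intro std4_span) (simp add: std4_def octK_def)
  then have "T ` ?M ` set std4 \<subseteq> T ` span (set std4)" by auto
  then have "set ?ys \<subseteq> span (set ?xs)"
    using linear_span_image[OF isoD(1)[OF T], of "set std4"] by (simp add: image_comp)
  then obtain a where a: "\<And>i. i < 4 \<Longrightarrow> ?ys ! i = (\<Sum>j<4. a i j *\<^sub>R ?xs ! j)"
    using frame_change[OF xs(1) ys(1)] by metis
  have "\<phi> ?ys = leibniz_det 4 a * \<phi> ?xs"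
    using a by (intro alternating_form_same_orientation[OF subV alt xs(1)]) simp_all
  then have "leibniz_det 4 a = 1" using xs(3) ys(3) by simp
  then have "same_orientation ?xs ?ys"
    unfolding same_orientation_def using a by (intro conjI exI[of _ a]) simp_all
  then have "plane_of V ?xs = plane_of V ?ys"
    using plane_of_eq_iff[OF xs(1) ys(1)] by blast
  then show ?thesis
    using plane_action_contact[OF L T] L unfolding frame_action_comp[OF T]
    by (simp add: stabilizer_def)
qed

text \<open>Conjugation by \<open>T\<close> turns \<open>L\<close> into an automorphism
  \<open>M\<close> of the model. Equality of the oriented planes includes equality of their spans,
  so \<open>M\<close> preserves the plane of vectors with second component 0, and
  \<open>cayley_auto_stabilizer\<close> applies.\<close>

lemma stabilizer_frame_action:
  assumes T: "iso T" and L: "L \<in> stabilizer G (plane_action contact) (plane_of V (map T std4))"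
  obtains p q r where "p \<bullet> p = 1" "q \<bullet> q = 1" "r \<bullet> r = 1" "L = frame_action V T p q r"
proof -
  have LG: "L \<in> carrier G" and "plane_action contact L (plane_of V (map T std4)) = plane_of V (map T std4)"
    using L by (auto simp: stabilizer_def)
  then have eq: "plane_of V (map (L \<circ> T) std4) = plane_of V (map T std4)"
    using plane_action_contact[OF LG T] by simp
  have LT: "iso (L \<circ> T)" and ext: "L \<in> extensional V"
    using LG spin7_carrier_iff[OF T] by auto
  define M where "M = inv_into UNIV T \<circ> (L \<circ> T)"
  have TM: "T (M x) = L (T x)" for x
    using iso_inv(1)[OF T isoD(5)[OF LT, of x]] by (simp add: M_def)
  have inj: "T x = T y \<Longrightarrow> x = y" for x y
    using injD[OF isoD(3)[OF T]] .
  have lin: "linear M"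
  proof (rule linearI; rule inj)
    show "T (M (x + y)) = T (M x + M y)" for x y
      using linear_add[OF isoD(1)[OF LT], of x y] linear_add[OF isoD(1)[OF T], of "M x" "M y"] by (simp add: TM)
    show "T (M (c *\<^sub>R x)) = T (c *\<^sub>R M x)" for x c
      using linear_scale[OF isoD(1)[OF LT], of c x] linear_scale[OF isoD(1)[OF T], of c "M x"] by (simp add: TM)
  qed
  moreover have "M x \<bullet> M y = x \<bullet> y" for x y
    using isoD(6)[OF T, of "M x" "M y"] isoD(6)[OF LT, of x y] by (simp add: TM)
  moreover have "cayley (M x) (M y) (M z) (M w) = cayley x y z w" for x y z w
    using isoD(7)[OF T, of "M x" "M y" "M z" "M w"] isoD(7)[OF LT, of x y z w] by (simp add: TM)
  ultimately have auto: "cayley_auto M"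
    unfolding cayley_auto_def orthogonal_transformation_def by blast
  have "same_orientation (map T std4) (map (L \<circ> T) std4)"
    using plane_of_eq_iff[OF std4_frame(1)[OF T] std4_frame(1)[OF LT]] eq by simp
  then have "set (map (L \<circ> T) std4) \<subseteq> span (T ` set std4)"
    using same_orientation_span by fastforce
  then have sub: "L ` T ` set std4 \<subseteq> T ` span (set std4)"
    using linear_span_image[OF isoD(1)[OF T]] by (simp add: image_comp)
  have "span (set std4) \<subseteq> {x. snd x = 0}"
    by (intro span_minimal) (auto simp: std4_def subspace_def)
  with sub have sub': "L ` T ` set std4 \<subseteq> T ` {x. snd x = 0}" by blast
  have std: "snd (M e) = 0" if e: "e \<in> set std4" for e
  proof -
    obtain y where y: "L (T e) = T y" "snd y = 0"
      using sub' e by (auto simp: image_subset_iff simp del: split_paired_All)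
    then have "M e = y" by (intro inj) (simp only: TM)
    with y(2) show ?thesis by simp
  qed
  have "snd (M (a, 0)) = 0" for a
  proof -
    have "(a, 0) = q0 a *\<^sub>R (1,0) + q1 a *\<^sub>R (qi,0) + q2 a *\<^sub>R (qj,0) + q3 a *\<^sub>R (qk,0::quat)"
      by (simp add: prod_eq_iff quat_eq_iff)
    then have "M (a, 0) = q0 a *\<^sub>R M (1,0) + q1 a *\<^sub>R M (qi,0) + q2 a *\<^sub>R M (qj,0) + q3 a *\<^sub>R M (qk,0)"
      by (simp only: linear_add[OF lin] linear_scale[OF lin])
    then show ?thesis
      using std by (simp add: std4_def)
  qed
  then obtain p q r where pqr: "p \<bullet> p = 1" "q \<bullet> q = 1" "r \<bullet> r = 1" "M = octK p q r"
    using cayley_auto_stabilizer[OF auto] by metis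
  have "L = frame_action V T p q r"
  proof
    fix v
    show "L v = frame_action V T p q r v"
    proof (cases "v \<in> V")
      case True
      then show ?thesis
        using TM[of "inv_into UNIV T v"] iso_inv(1)[OF T True] by (simp add: frame_action_def pqr(4))
    next
      case False
      then show ?thesis using ext by (simp add: frame_action_def extensional_def)
    qed
  qed
  with pqr show thesis by (intro that)
qed

section \<open>The stabilizer as a quotient of three copies of SU(2)\<close>

definition SU2_action :: "(oct \<Rightarrow> 'a) \<Rightarrow> (complex^2^2) \<times> (complex^2^2) \<times> (complex^2^2) \<Rightarrow> 'a \<Rightarrow> 'a" where
  "SU2_action T = (\<lambda>(A, B, C). frame_action V T (quat_of_matrix A) (quat_of_matrix B) (quat_of_matrix C))"

abbreviation stab where
  "stab \<xi> \<equiv> G\<lparr>carrier := stabilizer G (plane_action contact) \<xi>\<rparr>"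

lemma group_stab:
  assumes "\<xi> \<in> contact"
  shows "group (stab \<xi>)"
proof -
  interpret transitive_action G contact "plane_action contact" by (rule transitive_contact)
  show ?thesis
    using stabilizer_subgroup[OF assms] group_spin7 by (rule subgroup.subgroup_is_group)
qed

lemma SU2_action_hom:
  assumes T: "iso T"
  shows "SU2_action T \<in> hom SU2_cubed (stab (plane_of V (map T std4)))"
proof (rule homI)
  have in_stab: "SU2_action T x \<in> stabilizer G (plane_action contact) (plane_of V (map T std4))"
    if "x \<in> carrier SU2_cubed" for x
    using that frame_action_stabilizer[OF T] by (auto simp: SU2_action_def carrier_SU2_cubed quat_of_matrix_SU2)
  show "SU2_action T x \<in> carrier (stab (plane_of V (map T std4)))" if "x \<in> carrier SU2_cubed" for x
    using in_stab[OF that] by simp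
  fix x y assume xy: "x \<in> carrier SU2_cubed" "y \<in> carrier SU2_cubed"
  have "SU2_action T x \<in> carrier G" "SU2_action T y \<in> carrier G"
    using in_stab xy by (auto simp: stabilizer_def)
  then have "SU2_action T x \<otimes>\<^bsub>G\<^esub> SU2_action T y = compose V (SU2_action T x) (SU2_action T y)"
    by (rule spin7_mult)
  also have "\<dots> = SU2_action T (x \<otimes>\<^bsub>SU2_cubed\<^esub> y)"
    using xy by (auto simp: SU2_action_def SU2_cubed_def quat_of_matrix_mult frame_action_mult[OF T])
  finally show "SU2_action T (x \<otimes>\<^bsub>SU2_cubed\<^esub> y) = SU2_action T x \<otimes>\<^bsub>stab (plane_of V (map T std4))\<^esub> SU2_action T y"
    by simp
qed

lemma SU2_action_onto:
  assumes T: "iso T"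
  shows "SU2_action T ` carrier SU2_cubed = carrier (stab (plane_of V (map T std4)))"
proof (intro equalityI subsetI)
  fix L assume "L \<in> carrier (stab (plane_of V (map T std4)))"
  then have "L \<in> stabilizer G (plane_action contact) (plane_of V (map T std4))" by simp
  from stabilizer_frame_action[OF T this] obtain p q r
    where pqr: "p \<bullet> p = 1" "q \<bullet> q = 1" "r \<bullet> r = 1" "L = frame_action V T p q r" .
  then have "L = SU2_action T (matrix_of_quat p, matrix_of_quat q, matrix_of_quat r)"
    by (simp add: SU2_action_def)
  moreover have "(matrix_of_quat p, matrix_of_quat q, matrix_of_quat r) \<in> carrier SU2_cubed"
    using pqr by (auto simp: carrier_SU2_cubed carrier_SU2)
  ultimately show "L \<in> SU2_action T ` carrier SU2_cubed" by blast
next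
  fix L assume "L \<in> SU2_action T ` carrier SU2_cubed"
  then show "L \<in> carrier (stab (plane_of V (map T std4)))"
    using hom_in_carrier[OF SU2_action_hom[OF T]] by blast
qed

text \<open>Since \<open>T\<close> is injective, an action is trivial on \<open>V\<close> exactly
  when its \<open>octK\<close> is the identity, and those triples are known from
  \<open>octK_id_iff\<close>.\<close>

lemma SU2_action_kernel:
  assumes T: "iso T"
  shows "kernel SU2_cubed (stab (plane_of V (map T std4))) (SU2_action T) = diagonal_Z2"
proof -
  have one: "\<one>\<^bsub>stab \<xi>\<^esub> = restrict (\<lambda>v. v) V" for \<xi>
    by (simp add: spin7_group_def BijGroup_def)
  have id: "frame_action V T p q r = restrict (\<lambda>v. v) V \<longleftrightarrow> octK p q r = (\<lambda>x. x)" for p q r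
  proof
    assume "frame_action V T p q r = restrict (\<lambda>v. v) V"
    then have "T (octK p q r x) = T x" for x
      using fun_cong[OF frame_action_comp[OF T, of p q r], of x] isoD(5)[OF T, of x] by simp
    then show "octK p q r = (\<lambda>x. x)"
      by (intro ext injD[OF isoD(3)[OF T]])
  next
    assume "octK p q r = (\<lambda>x. x)"
    then show "frame_action V T p q r = restrict (\<lambda>v. v) V"
      by (intro ext) (simp add: frame_action_def iso_inv(1)[OF T] restrict_def)
  qed
  have m: "matrix_of_quat (- 1) = - mat 1"
    by (simp add: matrix_of_quat_minus matrix_of_quat_1)
  have inner1: "(1::quat) \<bullet> 1 = 1" "(-1::quat) \<bullet> -1 = 1"
    by (simp_all add: inner_quat_def)
  have "(A, B, C) \<in> kernel SU2_cubed (stab (plane_of V (map T std4))) (SU2_action T) \<longleftrightarrow> (A, B, C) \<in> diagonal_Z2" for A B C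
  proof
    assume "(A, B, C) \<in> kernel SU2_cubed (stab (plane_of V (map T std4))) (SU2_action T)"
    then have ABC: "A \<in> carrier SU2" "B \<in> carrier SU2" "C \<in> carrier SU2"
      and "octK (quat_of_matrix A) (quat_of_matrix B) (quat_of_matrix C) = (\<lambda>x. x)"
      by (auto simp: kernel_def carrier_SU2_cubed SU2_action_def one id[symmetric])
    then have "(quat_of_matrix A = 1 \<and> quat_of_matrix B = 1 \<and> quat_of_matrix C = 1) \<or>
        (quat_of_matrix A = - 1 \<and> quat_of_matrix B = - 1 \<and> quat_of_matrix C = - 1)"
      using octK_id_iff quat_of_matrix_SU2(1) by blast
    then show "(A, B, C) \<in> diagonal_Z2"
      using quat_of_matrix_SU2(2)[OF ABC(1)] quat_of_matrix_SU2(2)[OF ABC(2)] quat_of_matrix_SU2(2)[OF ABC(3)]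
      by (auto simp: diagonal_Z2_def matrix_of_quat_1 m)
  next
    assume "(A, B, C) \<in> diagonal_Z2"
    then obtain x where x: "x = 1 \<or> x = - 1" "A = matrix_of_quat x" "B = matrix_of_quat x" "C = matrix_of_quat x"
      using that[of 1] that[of "- 1"] by (auto simp: diagonal_Z2_def matrix_of_quat_1 m)
    then have "octK x x x = (\<lambda>x. x)" "x \<bullet> x = 1"
      using octK_id_iff[of x x x] inner1 by auto
    then show "(A, B, C) \<in> kernel SU2_cubed (stab (plane_of V (map T std4))) (SU2_action T)"
      using id[of x x x] one x(2-4)
      by (simp add: kernel_def carrier_SU2_cubed SU2_action_def carrier_SU2)
  qed
  then show ?thesis by auto
qed

end

section \<open>The Cayley form of a coframe\<close>

lemma wedge_1_1: "wedge 1 1 \<alpha> \<beta> xs = \<alpha> [xs ! 0] * \<beta> [xs ! 1] - \<alpha> [xs ! 1] * \<beta> [xs ! 0]"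
proof -
  have S: "{..<1 + 1::nat} = insert 0 {1}" by auto
  have f: "finite {1::nat}" "0 \<notin> {1::nat}" by auto
  show ?thesis
    unfolding wedge_def S sum_over_permutations_insert[OF f] permutes_sing
    by (simp add: sign_swap_id sign_id)
qed

lemma sum_permutations_four:
  fixes F :: "nat \<Rightarrow> nat \<Rightarrow> nat \<Rightarrow> nat \<Rightarrow> real"
  shows "(\<Sum>\<sigma> | \<sigma> permutes {..<4::nat}. of_int (sign \<sigma>) * F (\<sigma> 0) (\<sigma> 1) (\<sigma> 2) (\<sigma> 3)) =
    F 0 1 2 3 - F 0 1 3 2 - F 0 2 1 3 + F 0 2 3 1 + F 0 3 1 2 - F 0 3 2 1
  - F 1 0 2 3 + F 1 0 3 2 + F 1 2 0 3 - F 1 2 3 0 - F 1 3 0 2 + F 1 3 2 0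
  + F 2 0 1 3 - F 2 0 3 1 - F 2 1 0 3 + F 2 1 3 0 + F 2 3 0 1 - F 2 3 1 0
  - F 3 0 1 2 + F 3 0 2 1 + F 3 1 0 2 - F 3 1 2 0 - F 3 2 0 1 + F 3 2 1 0"
proof -
  have S: "{..<4::nat} = insert 0 (insert 1 (insert 2 {3}))" by auto
  have f: "finite {1, 2, 3::nat}" "0 \<notin> {1, 2, 3::nat}" "finite {2, 3::nat}" "1 \<notin> {2, 3::nat}"
    "finite {3::nat}" "2 \<notin> {3::nat}" by auto
  show ?thesis
    unfolding S sum_over_permutations_insert[OF f(1,2)] sum_over_permutations_insert[OF f(3,4)]
      sum_over_permutations_insert[OF f(5,6)] permutes_sing
    by (simp add: sign_swap_id sign_id sign_compose permutation_swap_id permutation_compose Transposition.transpose_def)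
qed

text \<open>The 24 permutations fall into six groups of four, one for each shuffle; antisymmetry
  makes the members of a group equal and the factor 1/(2! 2!) removes the multiplicity.\<close>

lemma wedge_2_2:
  assumes "\<And>x y. \<alpha> [y, x] = - \<alpha> [x, y]" "\<And>x y. \<beta> [y, x] = - \<beta> [x, y]"
  shows "wedge 2 2 \<alpha> \<beta> [x, y, z, w] =
    \<alpha> [x, y] * \<beta> [z, w] - \<alpha> [x, z] * \<beta> [y, w] + \<alpha> [x, w] * \<beta> [y, z]
  + \<alpha> [y, z] * \<beta> [x, w] - \<alpha> [y, w] * \<beta> [x, z] + \<alpha> [z, w] * \<beta> [x, y]"
proof -
  let ?l = "[x, y, z, w]"
  have "wedge 2 2 \<alpha> \<beta> ?l = (\<Sum>\<sigma> | \<sigma> permutes {..<4::nat}. of_int (sign \<sigma>) *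
      (\<alpha> [?l ! \<sigma> 0, ?l ! \<sigma> 1] * \<beta> [?l ! \<sigma> 2, ?l ! \<sigma> 3])) / 4"
    by (simp add: wedge_def upt_rec mult.assoc)
  also have "\<dots> = \<alpha> [x, y] * \<beta> [z, w] - \<alpha> [x, z] * \<beta> [y, w] + \<alpha> [x, w] * \<beta> [y, z]
      + \<alpha> [y, z] * \<beta> [x, w] - \<alpha> [y, w] * \<beta> [x, z] + \<alpha> [z, w] * \<beta> [x, y]"
    unfolding sum_permutations_four[of "\<lambda>a b c d. \<alpha> [?l ! a, ?l ! b] * \<beta> [?l ! c, ?l ! d]"]
    using assms(1)[of y x] assms(1)[of z x] assms(1)[of w x] assms(1)[of z y] assms(1)[of w y] assms(1)[of w z]
      assms(2)[of y x] assms(2)[of z x] assms(2)[of w x] assms(2)[of z y] assms(2)[of w y] assms(2)[of w z]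
    by (simp add: numeral_eq_Suc)
  finally show ?thesis .
qed


text \<open>The order is that of the coframe, with position \<open>k\<close> belonging to
  \<open>e (Suc k)\<close>: lists count from 0 and coframes from 1.\<close>

definition oct_coords :: "oct \<Rightarrow> real list" where
  "oct_coords x = [q0 (fst x), q1 (fst x), q2 (fst x), q3 (fst x), q0 (snd x), q1 (snd x), q2 (snd x), q3 (snd x)]"

lemma sum_lessThan_8: "(\<Sum>i<8. f i) = f 0 + f 1 + f 2 + f 3 + f 4 + f 5 + f 6 + f (7::nat)"
  by (simp add: eval_nat_numeral)

text \<open>All factors are combinations of the \<open>d i j\<close>, hence antisymmetric, so
  \<open>wedge_2_2\<close> reduces both sides to polynomials in the coordinates of the four
  vectors.\<close>

lemma cayley_form_coframe:
  assumes "\<And>x k. k < 8 \<Longrightarrow> e (Suc k) [T x] = oct_coords x ! k"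
  shows "cayley_form e [T x, T y, T z, T w] = cayley x y z w"
proof -
  have e: "e 1 [T x] = q0 (fst x)" "e 2 [T x] = q1 (fst x)" "e 3 [T x] = q2 (fst x)" "e 4 [T x] = q3 (fst x)"
    "e 5 [T x] = q0 (snd x)" "e 6 [T x] = q1 (snd x)" "e 7 [T x] = q2 (snd x)" "e 8 [T x] = q3 (snd x)" for x
    using assms[of 0 x] assms[of 1 x] assms[of 2 x] assms[of 3 x] assms[of 4 x] assms[of 5 x] assms[of 6 x] assms[of 7 x]
    by (simp_all add: oct_coords_def numeral_eq_Suc)
  define d where "d i j = wedge 1 1 (e i) (e j)" for i j
  have d: "d i j [u, v] = e i [u] * e j [v] - e i [v] * e j [u]" for i j u v
    unfolding d_def wedge_1_1 by simp
  have w: "wedge 2 2 \<alpha> \<beta> [x, y, z, w] =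
      \<alpha> [x, y] * \<beta> [z, w] - \<alpha> [x, z] * \<beta> [y, w] + \<alpha> [x, w] * \<beta> [y, z]
    + \<alpha> [y, z] * \<beta> [x, w] - \<alpha> [y, w] * \<beta> [x, z] + \<alpha> [z, w] * \<beta> [x, y]"
    if "\<alpha> \<in> {d 1 2, d 1 2 - d 3 4, d 1 3 + d 2 4, d 1 4 - d 2 3, d 5 6}"
      "\<beta> \<in> {d 3 4, d 5 6 - d 7 8, d 5 7 + d 6 8, d 5 8 - d 6 7, d 7 8}" for \<alpha> \<beta> x y z w
    using that by (intro wedge_2_2) (auto simp: d)
  have fun_apply: "(f + h) l = f l + h l" "(f - h) l = f l - h l" for f h :: "'a list \<Rightarrow> real" and l
    by (simp_all add: plus_fun_def)
  show ?thesis
    unfolding cayley_form_def Let_def d_def[symmetric]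
    by (simp only: fun_apply w insert_iff simp_thms)
      (simp only: fun_apply d e cayley_def qvol_coord qform_coord, algebra)
qed

text \<open>The isomorphism is the linear parametrization of \<open>V\<close> by the orthonormal
  basis dual to the coframe. Positive definiteness of the model gives its injectivity, and the basis
  spanning \<open>V\<close> gives its image.\<close>

lemma coframe_cayley_iso:
  assumes g: "inner_product_on V g" and co: "orthonormal_coframe V g 8 e"
    and \<phi>: "\<And>xs. set xs \<subseteq> V \<Longrightarrow> length xs = 4 \<Longrightarrow> \<phi> xs = cayley_form e xs"
  shows "subspace V \<and> (\<exists>T. cayley_iso V g \<phi> T)"
proof
  obtain E where E: "orthonormal_basis V g E" "length E = 8"
    and e: "\<And>i. i \<in> {1..8} \<Longrightarrow> alternating_form V 1 (e i)"
    and eE: "\<And>i j. i \<in> {1..8} \<Longrightarrow> j \<in> {1..8} \<Longrightarrow> e i [E ! (j - 1)] = (if i = j then 1 else 0)"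
    using co unfolding orthonormal_coframe_def by blast
  have EV: "set E \<subseteq> V" and orth: "orthonormal g E" and span: "span (set E) = V"
    using E(1) by (auto simp: orthonormal_basis_def)
  show V: "subspace V" using span subspace_span by metis
  have lin: "linear_on_set V (g v)" if "v \<in> V" for v
    using g that by (simp add: inner_product_on_def)
  have sym: "g v w = g w v" if "v \<in> V" "w \<in> V" for v w
    using g that by (simp add: inner_product_on_def)
  have Ei: "E ! i \<in> V" if "i < 8" for i using that EV E(2) by auto
  define T where "T x = (\<Sum>i<8. oct_coords x ! i *\<^sub>R E ! i)" for x
  have TV: "T x \<in> V" for x
    unfolding T_def using Ei by (intro subspace_sum[OF V] subspace_scale[OF V]) auto
  have linT: "linear T"
    by (rule linearI) (simp_all add: T_def sum_lessThan_8 oct_coords_def scaleR_add_left scaleR_add_right)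
  have lin_expand: "f (T x) = (\<Sum>i<8. oct_coords x ! i * f (E ! i))" if "linear_on_set V f" for f :: "'a \<Rightarrow> real" and x
    unfolding T_def using linear_on_set_sum[OF V that, of "{..<8}" "\<lambda>i. E ! i"] Ei by simp
  have "g (E ! i) (T x) = oct_coords x ! i" if i: "i < 8" for i x
  proof -
    have "g (E ! i) (T x) = (\<Sum>j<8. if j = i then oct_coords x ! j else 0)"
      unfolding lin_expand[OF lin[OF Ei[OF i]]] using orth i E(2)
      by (intro sum.cong) (auto simp: orthonormal_def)
    then show ?thesis using i by simp
  qed
  then have inner: "g (T x) (T y) = x \<bullet> y" for x y
    unfolding lin_expand[OF lin[OF TV]] using sym[OF TV Ei]
    by (simp add: sum_lessThan_8) (simp add: oct_coords_def inner_prod_def inner_quat_def mult.commute)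
  have "inj T"
    unfolding linear_injective_0[OF linT]
  proof (intro allI impI)
    fix x assume "T x = 0"
    then have "x \<bullet> x = g (T 0) (T 0)"
      using inner[of x x] linear_0[OF linT] by simp
    then show "x = 0" by (simp only: inner) simp
  qed
  moreover have "V \<subseteq> range T"
    unfolding span[symmetric]
  proof (rule span_minimal)
    show "subspace (range T)" using linT by (intro linear_subspace_image) auto
    show "set E \<subseteq> range T"
    proof
      fix v assume "v \<in> set E"
      then obtain i where i: "v = E ! i" "i < 8" using E(2) by (metis in_set_conv_nth)
      define x where "x = (Quat (if i = 0 then 1 else 0) (if i = 1 then 1 else 0) (if i = 2 then 1 else 0) (if i = 3 then 1 else 0),
        Quat (if i = 4 then 1 else 0) (if i = 5 then 1 else 0) (if i = 6 then 1 else 0) (if i = 7 then 1 else 0))"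
      have "i \<in> {0, 1, 2, 3, 4, 5, 6, 7}" using i(2) by auto
      then have "T x = v"
        by (auto simp: T_def x_def sum_lessThan_8 oct_coords_def i(1))
      then show "v \<in> range T" by blast
    qed
  qed
  ultimately have bij: "bij_betw T UNIV V"
    using TV by (auto simp: bij_betw_def)
  have "e (Suc k) [T x] = oct_coords x ! k" if k: "k < 8" for k x
  proof -
    \<comment> \<open>Linearity of forms is expressed through updates of a list, so a singleton list
      is needed as a starting point; its entry is overwritten at once.\<close>
    have "linear_on_set V (\<lambda>v. e (Suc k) ([E ! 0][0 := v]))"
      using k e[of "Suc k"] Ei[of 0] by (intro alternating_form_linear[of V 1]) auto
    then have "linear_on_set V (\<lambda>v. e (Suc k) [v])" by simp
    then have "e (Suc k) [T x] = (\<Sum>i<8. oct_coords x ! i * e (Suc k) [E ! i])"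
      by (rule lin_expand)
    also have "\<dots> = (\<Sum>i<8. if i = k then oct_coords x ! i else 0)"
      using eE[of "Suc k" "Suc i" for i] k by (intro sum.cong) auto
    finally show ?thesis using k by simp
  qed
  then have "cayley_form e [T x, T y, T z, T w] = cayley x y z w" for x y z w
    by (rule cayley_form_coframe)
  then have "\<phi> [T x, T y, T z, T w] = cayley x y z w" for x y z w
    using TV by (subst \<phi>) auto
  with linT bij inner show "\<exists>T. cayley_iso V g \<phi> T"
    unfolding cayley_iso_def by blast
qed

section \<open>The topology of the stabilizer\<close>

lemma linear_qcnj: "linear qcnj"
  by (rule linearI) simp_all

text \<open>In the topology of pointwise convergence continuity may be tested at one vector
  \<open>v\<close> and one component \<open>c\<close> at a time. There the action is a polynomial
  expression in the matrix entries, followed by a linear map; outside \<open>V\<close> it is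
  constant.\<close>

lemma continuous_SU2_action:
  fixes V :: "('c \<Rightarrow> 'd::real_normed_vector) set"
  assumes "oriented_cayley_space V g \<phi> vol" and iso: "cayley_iso V g \<phi> T"
  shows "continuous_on S (oriented_cayley_space.SU2_action V T)"
proof -
  interpret oriented_cayley_space V g \<phi> vol by fact
  have bl: "continuous_on UNIV f" if "linear f" for f :: "'x::euclidean_space \<Rightarrow> 'y::real_normed_vector"
    using that linear_conv_bounded_linear linear_continuous_on by blast
  have "continuous_on S (\<lambda>x. SU2_action T x v c)" for v c
  proof (cases "v \<in> V")
    case True
    have q: "continuous_on S (\<lambda>x. quat_of_matrix (f x))" if "continuous_on S f" for f :: "_ \<Rightarrow> complex^2^2"
      using that by (rule continuous_on_compose2[OF bl[OF linear_quat_of_matrix]]) simp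
    have qc: "continuous_on S (\<lambda>x. qcnj (f x))" if "continuous_on S f" for f
      using that by (rule continuous_on_compose2[OF bl[OF linear_qcnj]]) simp
    \<comment> \<open>\<open>T\<close> takes values in a function space; evaluation at
      \<open>c\<close> turns it into a linear map from a Euclidean to a normed space, which is
      continuous.\<close>
    have "linear (\<lambda>x. T x c)"
      using linear_add[OF isoD(1)[OF iso]] linear_scale[OF isoD(1)[OF iso]]
      by (intro linearI) (simp_all add: plus_fun_def scaleR_fun_def)
    then have Tc: "continuous_on UNIV (\<lambda>x. T x c)" by (rule bl)
    have "continuous_on S (\<lambda>x. octK (quat_of_matrix (fst x)) (quat_of_matrix (fst (snd x)))
        (quat_of_matrix (snd (snd x))) w)" for w
      unfolding octK_def by (intro continuous_intros q qc)
    then have "continuous_on S (\<lambda>x. T (octK (quat_of_matrix (fst x)) (quat_of_matrix (fst (snd x)))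
        (quat_of_matrix (snd (snd x))) w) c)" for w
      by (rule continuous_on_compose2[OF Tc]) simp
    then show ?thesis
      using True by (simp add: SU2_action_def frame_action_def case_prod_unfold)
  next
    case False
    then show ?thesis
      by (simp add: SU2_action_def frame_action_def case_prod_unfold)
  qed
  then show ?thesis
    by (intro continuous_on_coordinatewise_then_product)
qed

lemma stabilizer_topological:
  fixes V :: "('c \<Rightarrow> 'd::real_normed_vector) set"
  assumes "oriented_cayley_space V g \<phi> vol"
  defines "C \<equiv> {\<xi> \<in> oriented_planes V 4. plane_value g \<phi> \<xi> = 1}"
  assumes \<xi>: "\<xi> \<in> C"
  shows "topological_quotient_iso SU2_cubed diagonal_Z2
    (spin7_group V g \<phi>\<lparr>carrier := stabilizer (spin7_group V g \<phi>) (plane_action C) \<xi>\<rparr>)"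
proof -
  interpret oriented_cayley_space V g \<phi> vol by fact
  have \<xi>': "\<xi> \<in> contact" using \<xi> unfolding C_def .
  obtain T where T: "iso T" "\<xi> = plane_of V (map T std4)"
    using contactE[OF \<xi>'] .
  show ?thesis
    unfolding C_def
  proof (rule topological_quotient_isoI)
    show "group (stab \<xi>)" by (rule group_stab[OF \<xi>'])
    show "SU2_action T \<in> hom SU2_cubed (stab \<xi>)" unfolding T(2) by (rule SU2_action_hom[OF T(1)])
    show "SU2_action T ` carrier SU2_cubed = carrier (stab \<xi>)" unfolding T(2) by (rule SU2_action_onto[OF T(1)])
    show "kernel SU2_cubed (stab \<xi>) (SU2_action T) = diagonal_Z2" unfolding T(2) by (rule SU2_action_kernel[OF T(1)])
    show "compact (carrier SU2_cubed)"
      unfolding carrier_SU2_cubed by (intro compact_Times compact_SU2)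
    show "continuous_on (carrier SU2_cubed) (SU2_action T)"
      by (rule continuous_SU2_action[OF assms(1) T(1)])
    show "Hausdorff_space (euclidean :: (('c \<Rightarrow> 'd) \<Rightarrow> 'c \<Rightarrow> 'd) topology)"
      by (intro Hausdorff_fun Hausdorff_space_euclidean)
  qed (rule group_SU2_cubed)
qed

theorem proposition4:
  fixes X :: "'m topology"
    and A :: "('m, 8) chart set"
    and g :: "'m \<Rightarrow> ('m, 8) tangent \<Rightarrow> ('m, 8) tangent \<Rightarrow> real"
    and vol \<Phi> :: "'m \<Rightarrow> ('m, 8) tangent list \<Rightarrow> real"
  assumes "smooth_manifold X A"
    and "riemannian_metric X A g"
    and "riemannian_volume_form X A g vol"
    and "spin7_structure X A g \<Phi>"
    and "self_dual X A g vol \<Phi>"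
  shows "generalized_calibration X A g 4 \<Phi> \<and>
    (\<forall>p\<in>topspace X.
       let C = contact_set A g 4 \<Phi> p;
           G = spin7_group (tangent_space A p) (g p) (\<Phi> p)
       in C \<noteq> {} \<and>
          transitive_action G C (plane_action C) \<and>
          (\<forall>\<xi>\<in>C. topological_quotient_iso SU2_cubed diagonal_Z2
             (G\<lparr>carrier := stabilizer G (plane_action C) \<xi>\<rparr>)))"
proof -
  have form: "differential_form A (topspace X) 4 \<Phi>"
    using assms(4) by (simp add: spin7_structure_def)
  have space: "oriented_cayley_space (tangent_space A p) (g p) (\<Phi> p) (vol p)" if p: "p \<in> topspace X" for p
  proof -
    have g: "inner_product_on (tangent_space A p) (g p)"
      using assms(2) p by (simp add: riemannian_metric_def)
    obtain e where "orthonormal_coframe (tangent_space A p) (g p) 8 e"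
      "\<And>xs. set xs \<subseteq> tangent_space A p \<Longrightarrow> length xs = 4 \<Longrightarrow> \<Phi> p xs = cayley_form e xs"
      using assms(4) p unfolding spin7_structure_def by blast
    \<comment> \<open>Besides the isomorphism with the model this yields that the tangent space is a
      subspace, namely the span of the basis dual to the coframe.\<close>
    from coframe_cayley_iso[OF g this] show ?thesis
      using assms(3,5) form g p
      by unfold_locales (auto simp: riemannian_volume_form_def differential_form_def self_dual_def)
  qed
  have "plane_value (g p) (\<Phi> p) \<xi> \<le> 1" if p: "p \<in> topspace X" and "\<xi> \<in> oriented_planes (tangent_space A p) 4" for p \<xi>
  proof -
    interpret oriented_cayley_space "tangent_space A p" "g p" "\<Phi> p" "vol p" by (rule space[OF p])
    show ?thesis by (rule calibration) fact
  qed
  moreover have "contact_set A g 4 \<Phi> p \<noteq> {}"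
      "transitive_action (spin7_group (tangent_space A p) (g p) (\<Phi> p)) (contact_set A g 4 \<Phi> p)
         (plane_action (contact_set A g 4 \<Phi> p))"
    if p: "p \<in> topspace X" for p
  proof -
    interpret oriented_cayley_space "tangent_space A p" "g p" "\<Phi> p" "vol p" by (rule space[OF p])
    obtain T where "iso T" using ex_iso by blast
    then show "contact_set A g 4 \<Phi> p \<noteq> {}"
      using contactI unfolding contact_set_def by blast
    show "transitive_action (spin7_group (tangent_space A p) (g p) (\<Phi> p)) (contact_set A g 4 \<Phi> p)
         (plane_action (contact_set A g 4 \<Phi> p))"
      unfolding contact_set_def by (rule transitive_contact)
  qed
  moreover have "topological_quotient_iso SU2_cubed diagonal_Z2
      (spin7_group (tangent_space A p) (g p) (\<Phi> p)\<lparr>carrier :=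
        stabilizer (spin7_group (tangent_space A p) (g p) (\<Phi> p)) (plane_action (contact_set A g 4 \<Phi> p)) \<xi>\<rparr>)"
    if p: "p \<in> topspace X" and "\<xi> \<in> contact_set A g 4 \<Phi> p" for p \<xi>
    using stabilizer_topological[OF space[OF p]] that(2) unfolding contact_set_def .
  ultimately show ?thesis
    using form by (simp add: generalized_calibration_def Let_def)
qed

end
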